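(* Let $\varepsilon > 0$ and $k \geq 2$. There is a randomized algorithm in the SSAC framework for $\mathsf{MinDisAgree}[k]$ that, on an $n$-vertex input, uses $O\left( \frac{k^{14}\log k\log n}{\varepsilon^6} \right)$ same-cluster queries, runs in time $O\left(\frac{n k^{14}\log k\log n}{\varepsilon^6}\right)$, and outputs a $(1 + \varepsilon)$-approximate solution with high probability.
   Context: Correlation clustering: the input is a complete graph $G$ on $n$ vertices whose every edge (pair of vertices) is labeled either positive ("similar") or negative ("dissimilar"). For a partition (clustering) of the vertices, the disagreements are the negative edges with both endpoints in the same cluster plus the positive edges whose endpoints lie in different clusters; agreements are the remaining edges. $\mathsf{MinDisAgree}[k]$ is the problem of finding a clustering into at most $k$ clusters minimising the number of disagreements; a $(1+\varepsilon)$-approximate solution is a clustering into at most $k$ clusters whose number of disagreements is at most $(1+\varepsilon)$ times the minimum. SSAC (semi-supervised active clustering) framework: the algorithm has access to an oracle which, given any two vertices $u,v$, answers Yes/No to "do $u$ and $v$ belong to the same cluster of the optimal clustering?", where all answers are consistent with one fixed optimal clustering; each oracle call is a same-cluster query. *)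

theory Defs
  imports
    "HOL-Probability.Probability_Mass_Function"
    "HOL-Library.Disjoint_Sets"
begin

section \<open>Correlation clustering\<close>

text \<open>
  The vertex set is {..<n}. A labelling of the complete graph is given by the set pos of its
  positive edges, pos \<subseteq> edges n; the negative edges are edges n - pos.
\<close>

definition edges :: "nat \<Rightarrow> nat set set" where
  "edges n = {e. e \<subseteq> {..<n} \<and> card e = 2}"

definition disagreements :: "nat \<Rightarrow> nat set set \<Rightarrow> nat set set \<Rightarrow> nat" where
  "disagreements n pos P =
     card {e \<in> edges n - pos. \<exists>A\<in>P. e \<subseteq> A} + card {e \<in> pos. \<not> (\<exists>A\<in>P. e \<subseteq> A)}"

definition clusterings :: "nat \<Rightarrow> nat \<Rightarrow> nat set set set" where
  "clusterings k n = {P. partition_on {..<n} P \<and> card P \<le> k}"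

definition min_disagreements :: "nat \<Rightarrow> nat \<Rightarrow> nat set set \<Rightarrow> nat" where
  "min_disagreements k n pos = Min (disagreements n pos ` clusterings k n)"

definition optimal_clustering :: "nat \<Rightarrow> nat \<Rightarrow> nat set set \<Rightarrow> nat set set \<Rightarrow> bool" where
  "optimal_clustering k n pos P \<longleftrightarrow>
     P \<in> clusterings k n \<and> disagreements n pos P = min_disagreements k n pos"

definition approx_solution :: "real \<Rightarrow> nat \<Rightarrow> nat \<Rightarrow> nat set set \<Rightarrow> nat set set \<Rightarrow> bool" where
  "approx_solution \<epsilon> k n pos P \<longleftrightarrow>
     P \<in> clusterings k n \<and>
     real (disagreements n pos P) \<le> (1 + \<epsilon>) * real (min_disagreements k n pos)"


section \<open>Randomized algorithms in the SSAC framework\<close>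

text \<open>
  Algorithms are structured programs for a word RAM with w-bit words, extended by uniform random
  choice, random access to the edge labels of the input, and the same-cluster oracle. Each
  executed instruction (including each evaluation of a branch or loop condition) takes one unit
  of time. Numbers are reduced modulo 2 ^ w, so that unit-cost arithmetic cannot be exploited on
  long integers. Register indices are fixed by the program; memory is addressed indirectly.
\<close>

datatype arith = Plus | Minus | Times | Div | Less

fun arith_op :: "arith \<Rightarrow> nat \<Rightarrow> nat \<Rightarrow> nat" where
  "arith_op Plus a b = a + b"
| "arith_op Minus a b = a - b"
| "arith_op Times a b = a * b"
| "arith_op Div a b = a div b"
| "arith_op Less a b = of_bool (a < b)"

datatype instr =
    Const nat nat             \<comment> \<open>\<open>Const r c\<close>: r := c\<close>
  | Arith arith nat nat nat   \<comment> \<open>\<open>Arith f r a b\<close>: r := f a b\<close>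
  | Load nat nat              \<comment> \<open>\<open>Load r a\<close>: r := memory cell with address a\<close>
  | Store nat nat             \<comment> \<open>\<open>Store a b\<close>: memory cell with address a := b\<close>
  | Rand nat nat              \<comment> \<open>\<open>Rand r a\<close>: r := uniformly random number below a (0 if a = 0)\<close>
  | Label nat nat nat         \<comment> \<open>\<open>Label r a b\<close>: r := 1 if {a, b} is a positive edge, else 0\<close>
  | SameCluster nat nat nat   \<comment> \<open>\<open>SameCluster r a b\<close>: r := oracle answer (1 for Yes, 0 for No)\<close>
  | Cond nat "instr list" "instr list"   \<comment> \<open>first branch iff the register is nonzero\<close>
  | While nat "instr list"               \<comment> \<open>iterate as long as the register is nonzero\<close>

record state =
  reg :: "nat \<Rightarrow> nat"
  mem :: "nat \<Rightarrow> nat"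
  queries :: nat     \<comment> \<open>number of same-cluster queries made so far; not readable by programs\<close>

text \<open>A configuration consists of the instructions still to be executed and the state.\<close>

type_synonym config = "instr list \<times> state"

definition set_reg :: "nat \<Rightarrow> nat \<Rightarrow> state \<Rightarrow> state" where
  "set_reg r x s = s\<lparr>reg := (reg s)(r := x)\<rparr>"

text \<open>The argument P is the clustering according to which the oracle answers.\<close>

fun step :: "nat \<Rightarrow> nat set set \<Rightarrow> nat set set \<Rightarrow> config \<Rightarrow> config pmf" where
  "step w pos P ([], s) = return_pmf ([], s)"
| "step w pos P (Const r c # is, s) = return_pmf (is, set_reg r (c mod 2 ^ w) s)"
| "step w pos P (Arith f r a b # is, s) =
     return_pmf (is, set_reg r (arith_op f (reg s a) (reg s b) mod 2 ^ w) s)"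
| "step w pos P (Load r a # is, s) = return_pmf (is, set_reg r (mem s (reg s a)) s)"
| "step w pos P (Store a b # is, s) =
     return_pmf (is, s\<lparr>mem := (mem s)(reg s a := reg s b)\<rparr>)"
| "step w pos P (Rand r a # is, s) =
     (if reg s a = 0 then return_pmf (is, set_reg r 0 s)
      else map_pmf (\<lambda>x. (is, set_reg r x s)) (pmf_of_set {..<reg s a}))"
| "step w pos P (Label r a b # is, s) =
     return_pmf (is, set_reg r (of_bool ({reg s a, reg s b} \<in> pos)) s)"
| "step w pos P (SameCluster r a b # is, s) =
     return_pmf (is, set_reg r (of_bool (\<exists>A\<in>P. reg s a \<in> A \<and> reg s b \<in> A))
                       (s\<lparr>queries := Suc (queries s)\<rparr>))"
| "step w pos P (Cond r is1 is2 # is, s) =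
     return_pmf ((if reg s r \<noteq> 0 then is1 else is2) @ is, s)"
| "step w pos P (While r is1 # is, s) =
     return_pmf (if reg s r \<noteq> 0 then is1 @ While r is1 # is else is, s)"

text \<open>Distribution of the configuration after t steps; halted configurations are stationary.\<close>

primrec run :: "nat \<Rightarrow> nat set set \<Rightarrow> nat set set \<Rightarrow> nat \<Rightarrow> config \<Rightarrow> config pmf" where
  "run w pos P 0 c = return_pmf c"
| "run w pos P (Suc t) c = bind_pmf (run w pos P t c) (step w pos P)"

text \<open>Initially, register 0 contains n; all other registers and all memory cells are zero.\<close>

definition init :: "instr list \<Rightarrow> nat \<Rightarrow> config" where
  "init prog n = (prog, \<lparr>reg = (\<lambda>_. 0)(0 := n), mem = (\<lambda>_. 0), queries = 0\<rparr>)"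

definition halted :: "config \<Rightarrow> bool" where
  "halted c \<longleftrightarrow> fst c = []"

text \<open>
  A clustering is output by writing a cluster label for each vertex v < n into memory cell v.
\<close>

definition output_clustering :: "nat \<Rightarrow> config \<Rightarrow> nat set set" where
  "output_clustering n c = (\<lambda>v. {u \<in> {..<n}. mem (snd c) u = mem (snd c) v}) ` {..<n}"

text \<open>Words of O(log (n k / \<epsilon>)) bits; the summand 1 keeps the logarithm positive for large \<epsilon>.\<close>

definition word_size :: "nat \<Rightarrow> nat \<Rightarrow> nat \<Rightarrow> real \<Rightarrow> nat" where
  "word_size b n k \<epsilon> = b * nat \<lceil>log 2 (real n * real k * (1 + 1 / \<epsilon>))\<rceil>"

text \<open>
  The time and query bounds hold for every outcome of the random choices, and "with high
  probability" means with probability at least 1 - 1/n. The oracle may be consistent with any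
  optimal clustering P.
\<close>

definition solves_MinDisAgree ::
    "instr list \<Rightarrow> nat \<Rightarrow> real \<Rightarrow> nat \<Rightarrow> nat \<Rightarrow> real \<Rightarrow> real \<Rightarrow> bool" where
  "solves_MinDisAgree prog w \<epsilon> k n query_bound time_bound \<longleftrightarrow>
     (\<forall>pos P. pos \<subseteq> edges n \<longrightarrow> optimal_clustering k n pos P \<longrightarrow>
       (\<exists>t. real t \<le> time_bound \<and>
         (\<forall>c \<in> set_pmf (run w pos P t (init prog n)).
            halted c \<and> real (queries (snd c)) \<le> query_bound) \<and>
         measure_pmf.prob (run w pos P t (init prog n))
           {c. approx_solution \<epsilon> k n pos (output_clustering n c)} \<ge> 1 - 1 / real n))"

end

theory Submission
  imports Defs "HOL-Probability.Hoeffding"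
begin

text \<open>
  The clusters are given names in \<open>{..<k}\<close>, called slots. The algorithm works in at most \<open>k\<close> rounds on
  the list \<open>W\<close> of undecided vertices. A round samples \<open>W\<close>, locates the samples with the oracle, picks the most
  frequent slot \<open>L\<close> (which then contains at least \<open>card W / (2 * k)\<close> vertices), and scans \<open>W\<close> in batches,
  each of which uses a fresh sample. A vertex \<open>v\<close> gets the slot \<open>g\<close> with the best estimated
  balance of positive minus negative edges. If \<open>g = L\<close>, then \<open>v\<close> is moved to \<open>L\<close> for good; if the current
  slot of \<open>v\<close> is \<open>L\<close>, then \<open>v\<close> is moved to \<open>g\<close>; otherwise it stays. Slot \<open>L\<close> is closed at the end of the round.

  The current slot of \<open>v\<close> is not known to the algorithm. It stores for every slot \<open>i\<close> where \<open>v\<close> is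
  if its optimal cluster has slot \<open>i\<close>, so only the sampled vertices need to be queried.

  A move increases the cost by at most \<open>\<gamma> * card W\<close>, up to a constant factor. It involves \<open>L\<close>, so \<open>v\<close> disagrees,
  before or after the move, with about half of the large_slot slot \<open>L\<close>. Unless there were \<open>card W / (16 * k)\<close> moves
  already, this disagreement is present at the beginning of the round. Hence the number of moves times
  \<open>card W\<close> is \<open>O(k\<^sup>2)\<close> times the cost, and a round loses a factor \<open>1 + O(k\<^sup>2 * \<gamma>)\<close> only, no
  matter how small the optimum is.

  The order in which the oracle reveals the clusters depends on the samples. The invariants are therefore
  stated for all namings of the clusters that are consistent with the representatives found so far, and
  the failure probability is summed over all of the at most \<open>k ^ k\<close> namings.
\<close>

section \<open>Program logic for the word RAM\<close>

text \<open>The samples of a batch describe the clustering at the start of that batch, and all later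
  decisions depend on them. The concentration event is therefore fixed before the draw: it covers
  every naming at once. Later moves are handled by keeping the batch short. The permitted error
  \<open>\<gamma> * card W\<close> of a move splits into quarters: two sampling errors and two
  drifts since the sample was taken. Let \<open>q\<close> be 1/\<epsilon> rounded up. A round costs
  a factor \<open>1 + 256 * k\<^sup>2 * \<gamma>\<close>, and \<open>k\<close> such factors stay
  below \<open>1 + 1 / q\<close> for \<open>\<gamma> = 1 / (512 * k ^ 3 * q)\<close>. A drift of one
  quarter then asks for \<open>4 / \<gamma> = 2048 * k ^ 3 * q\<close> batches. The tail exponent of
  a sample of size \<open>S\<close> is \<open>S * \<gamma>\<^sup>2 / 32\<close> and has to beat
  \<open>k ^ k\<close> namings and a multiple of \<open>n\<close> tests;
  \<open>30 * 2 ^ 23 * k ^ 8 * q ^ 3\<close> samples per bit of \<open>n\<close> are enough. With at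
  most \<open>k\<close> queries per sample, \<open>k\<close> rounds need a number of queries of the
  order \<open>k ^ 13 * q ^ 4\<close> times log n.\<close>

lemma run_Suc_left: "run w pos P (Suc t) c = bind_pmf (step w pos P c) (run w pos P t)"
proof (induction t)
  case 0
  have "run w pos P 0 = return_pmf" by (rule ext) simp
  then show ?case by (simp add: bind_return_pmf bind_return_pmf')
next
  case (Suc t)
  have "run w pos P (Suc (Suc t)) c = bind_pmf (run w pos P (Suc t) c) (step w pos P)" by simp
  also have "\<dots> = bind_pmf (step w pos P c) (\<lambda>x. bind_pmf (run w pos P t x) (step w pos P))"
    unfolding Suc.IH by (simp add: bind_assoc_pmf)
  finally show ?case by simp
qed

lemma run_halted [simp]: "run w pos P t ([], s) = return_pmf ([], s)"
  by (induction t) (auto simp: bind_return_pmf)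

lemma run_add: "run w pos P (a + b) c = bind_pmf (run w pos P a c) (run w pos P b)"
proof (induction a arbitrary: c)
  case 0 then show ?case by (simp add: bind_return_pmf)
next
  case (Suc a)
  have "run w pos P (Suc a + b) c = bind_pmf (step w pos P c) (run w pos P (a + b))"
    by (simp only: add_Suc run_Suc_left)
  also have "\<dots> = bind_pmf (run w pos P (Suc a) c) (run w pos P b)"
    unfolding run_Suc_left using Suc.IH by (simp add: bind_assoc_pmf cong: bind_pmf_cong)
  finally show ?case .
qed

lemma step_append:
  "step w pos P (i # is @ rest, s) = map_pmf (\<lambda>(l, s'). (l @ rest, s')) (step w pos P (i # is, s))"
  by (cases i) (auto simp: map_pmf_comp o_def)

section \<open>Termination of randomized programs within a time bound\<close>

locale ram =
  fixes w :: nat and pos P :: "nat set set"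
begin

text \<open>Equality is demanded at all times from \<open>T\<close> on, because the branches of a
  random computation halt at different moments and a time bound has to be weakenable. Since halted
  configurations are stationary, \<open>c\<close> determines the final distribution
  \<open>D\<close>.\<close>

definition terminates :: "config \<Rightarrow> nat \<Rightarrow> state pmf \<Rightarrow> bool" where
  "terminates c T D \<longleftrightarrow> (\<forall>t\<ge>T. run w pos P t c = map_pmf (Pair []) D)"

lemma terminates_Nil: "terminates ([], s) T (return_pmf s)"
  by (simp add: terminates_def)

lemma terminates_mono: "terminates c T D \<Longrightarrow> T \<le> T' \<Longrightarrow> terminates c T' D"
  by (simp add: terminates_def)

lemma terminates_step:
  assumes "\<And>c'. c' \<in> set_pmf (step w pos P c) \<Longrightarrow> terminates c' T (D c')"
  shows "terminates c (Suc T) (bind_pmf (step w pos P c) D)"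
  unfolding terminates_def
proof (intro allI impI)
  fix t assume "Suc T \<le> t"
  then obtain t' where t: "t = Suc t'" "T \<le> t'" by (cases t) auto
  have "run w pos P t c = bind_pmf (step w pos P c) (\<lambda>c'. map_pmf (Pair []) (D c'))"
    unfolding t(1) run_Suc_left
    by (rule bind_pmf_cong) (use assms t(2) in \<open>auto simp: terminates_def\<close>)
  then show "run w pos P t c = map_pmf (Pair []) (bind_pmf (step w pos P c) D)"
    by (simp add: map_bind_pmf)
qed

lemma terminates_if_halted:
  assumes "\<And>x. x \<in> set_pmf (run w pos P T c) \<Longrightarrow> halted x"
  shows "terminates c T (map_pmf snd (run w pos P T c))"
  unfolding terminates_def
proof (intro allI impI)
  fix t assume "T \<le> t"
  then obtain d where d: "t = T + d" using le_Suc_ex by blast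
  have "run w pos P t c = bind_pmf (run w pos P T c) (\<lambda>x. return_pmf ([], snd x))"
    unfolding d run_add
  proof (rule bind_pmf_cong)
    fix x assume "x \<in> set_pmf (run w pos P T c)"
    then have "fst x = []" using assms halted_def by blast
    then show "run w pos P d x = return_pmf ([], snd x)" by (cases x) auto
  qed simp
  then show "run w pos P t c = map_pmf (Pair []) (map_pmf snd (run w pos P T c))"
    by (simp add: map_pmf_comp) (simp add: map_pmf_def)
qed

text \<open>Induction on \<open>T\<close>, peeling off the first step. Random outcomes may finish
  \<open>is\<close> at different times; the stepwise induction lets each of them enter
  \<open>rest\<close> at its own moment, and \<open>T + T'\<close> bounds them all.\<close>

lemma terminates_append:
  assumes "terminates (is, s) T D"
    and "\<And>s'. s' \<in> set_pmf D \<Longrightarrow> terminates (rest, s') T' (D' s')"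
  shows "terminates (is @ rest, s) (T + T') (bind_pmf D D')"
  using assms
proof (induction T arbitrary: "is" s D)
  case 0
  have "run w pos P 0 (is, s) = map_pmf (Pair []) D"
    using 0(1) unfolding terminates_def by blast
  then have "return_pmf (is, s) = map_pmf (Pair []) D" by simp
  \<comment> \<open>A bound of 0 means that the program is already empty: the point mass at
    \<open>(is, s)\<close> lies in the image of \<open>Pair []\<close>.\<close>
  then have "set_pmf (return_pmf (is, s)) = Pair [] ` set_pmf D" by simp
  then have *: "is = []" "set_pmf D = {s}"
    by (auto simp: set_eq_iff image_iff)
  then have "D = return_pmf s" using set_pmf_subset_singleton[of D s] by blast
  then show ?case using 0 * by (auto simp: bind_return_pmf)
next
  case (Suc T)
  show ?case
  proof (cases "is")
    case Nil
    have "run w pos P (Suc T) ([], s) = map_pmf (Pair []) D"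
      using Suc.prems(1) unfolding Nil terminates_def by blast
    then have "map_pmf snd (return_pmf ([] :: instr list, s)) = map_pmf snd (map_pmf (Pair ([] :: instr list)) D)"
      by (simp only: run_halted)
    then have "D = return_pmf s" by (simp add: map_pmf_comp)
    then show ?thesis using Suc.prems Nil
      by (auto simp: bind_return_pmf intro: terminates_mono)
  next
    case (Cons i is')
    let ?X = "step w pos P (is, s)"
    \<comment> \<open>\<open>D\<close> comes without a decomposition along the first step; the part
      that belongs to a successor \<open>c\<close> is recovered by running \<open>c\<close> for the
      remaining \<open>T\<close> steps.\<close>
    define E where "E c = map_pmf snd (run w pos P T c)" for c
    have r: "run w pos P (Suc T) (is, s) = map_pmf (Pair []) D"
      using Suc.prems(1) unfolding terminates_def by blast
    have E: "terminates c T (E c)" if "c \<in> set_pmf ?X" for c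
      unfolding E_def
    proof (rule terminates_if_halted)
      fix x assume "x \<in> set_pmf (run w pos P T c)"
      then have "x \<in> set_pmf (run w pos P (Suc T) (is, s))"
        using that unfolding run_Suc_left by auto
      then show "halted x" unfolding r by (auto simp: halted_def)
    qed
    have D: "D = bind_pmf ?X E"
    proof -
      have "D = map_pmf snd (run w pos P (Suc T) (is, s))" unfolding r by (simp add: map_pmf_comp)
      then show ?thesis unfolding run_Suc_left E_def by (simp add: map_bind_pmf)
    qed
    have step: "step w pos P (is @ rest, s) = map_pmf (\<lambda>(l, s'). (l @ rest, s')) ?X"
      unfolding Cons using step_append[of w pos P i is' rest s] by simp
    have ex: "terminates (l @ rest, s') (T + T') (bind_pmf (E (l, s')) D')" if "(l, s') \<in> set_pmf ?X" for l s'
      by (rule Suc.IH[OF E[OF that]]) (use that Suc.prems(2) D in auto)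
    have "run w pos P t (is @ rest, s) = map_pmf (Pair []) (bind_pmf D D')" if t: "t \<ge> Suc T + T'" for t
    proof -
      obtain t' where t': "t = Suc t'" "t' \<ge> T + T'" using t by (cases t) auto
      have "run w pos P t (is @ rest, s) = bind_pmf ?X (\<lambda>(l, s'). run w pos P t' (l @ rest, s'))"
        unfolding t'(1) run_Suc_left step by (simp add: bind_map_pmf case_prod_unfold)
      also have "\<dots> = bind_pmf ?X (\<lambda>c. map_pmf (Pair []) (bind_pmf (E c) D'))"
        by (rule bind_pmf_cong) (use ex t' in \<open>auto simp: terminates_def\<close>)
      finally show ?thesis unfolding D by (simp add: map_bind_pmf bind_assoc_pmf)
    qed
    then show ?thesis by (simp add: terminates_def)
  qed
qed

section \<open>Hoare triples with time bound and failure probability\<close>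

definition triple :: "instr list \<Rightarrow> state \<Rightarrow> nat \<Rightarrow> (state \<Rightarrow> bool) \<Rightarrow> bool" where
  "triple is s T R \<longleftrightarrow> (\<exists>s'. terminates (is, s) T (return_pmf s') \<and> R s')"

text \<open>There are two postconditions: \<open>R\<close> holds for every outcome, as the time and
  query bounds require, while \<open>Q\<close> may fail with probability \<open>p\<close>. The flag
  \<open>g\<close> is the precondition of \<open>Q\<close> only. In a composition, the
  \<open>Q\<close> of one piece becomes the flag of the next.\<close>

definition prob_triple :: "instr list \<Rightarrow> state \<Rightarrow> nat \<Rightarrow> (state \<Rightarrow> bool) \<Rightarrow> bool \<Rightarrow> (state \<Rightarrow> bool) \<Rightarrow> real \<Rightarrow> bool" where
  "prob_triple is s T R g Q p \<longleftrightarrow> (\<exists>D. terminates (is, s) T D \<and> (\<forall>s'\<in>set_pmf D. R s') \<and>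
     (g \<longrightarrow> measure_pmf.prob D {s'. \<not> Q s'} \<le> p))"

lemma triple_Nil: "R s \<Longrightarrow> triple [] s T R"
  unfolding triple_def using terminates_Nil by blast

lemma triple_mono: "triple is s T R \<Longrightarrow> T \<le> T' \<Longrightarrow> (\<And>s'. R s' \<Longrightarrow> R' s') \<Longrightarrow> triple is s T' R'"
  unfolding triple_def using terminates_mono by blast

lemma triple_append:
  assumes "triple is1 s T1 R1" "\<And>s1. R1 s1 \<Longrightarrow> triple is2 s1 T2 R"
  shows "triple (is1 @ is2) s (T1 + T2) R"
proof -
  obtain s1 where s1: "terminates (is1, s) T1 (return_pmf s1)" "R1 s1"
    using assms(1) by (auto simp: triple_def)
  obtain s2 where s2: "terminates (is2, s1) T2 (return_pmf s2)" "R s2"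
    using assms(2)[OF s1(2)] by (auto simp: triple_def)
  have "terminates (is1 @ is2, s) (T1 + T2) (bind_pmf (return_pmf s1) (\<lambda>_. return_pmf s2))"
    by (rule terminates_append[OF s1(1)]) (use s2 in auto)
  then show ?thesis using s2 unfolding triple_def by (auto simp: bind_return_pmf)
qed

lemma triple_step:
  fixes i :: instr
  assumes "step w pos P (i # is, s) = return_pmf (is', s')" "triple is' s' T R"
  shows "triple (i # is) s (Suc T) R"
proof -
  obtain s2 where s2: "terminates (is', s') T (return_pmf s2)" "R s2"
    using assms(2) by (auto simp: triple_def)
  have "terminates (i # is, s) (Suc T) (bind_pmf (step w pos P (i # is, s)) (\<lambda>_. return_pmf s2))"
    by (rule terminates_step) (use assms s2 in auto)
  then show ?thesis using s2 assms unfolding triple_def by (auto simp: bind_return_pmf)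
qed

lemma triple_while_exit: "reg s r = 0 \<Longrightarrow> triple [While r body] s 1 (\<lambda>s'. s' = s)"
  using triple_step[of "While r body" "[]" s "[]" s 0 "\<lambda>s'. s' = s"] triple_Nil by simp

lemma prob_triple_mono:
  assumes "prob_triple is s T R g Q p" "T \<le> T'" "\<And>s'. R s' \<Longrightarrow> R' s'" "g' \<Longrightarrow> g"
    "\<And>s'. R s' \<Longrightarrow> Q s' \<Longrightarrow> Q' s'" "p \<le> p'"
  shows "prob_triple is s T' R' g' Q' p'"
proof -
  obtain D where D: "terminates (is, s) T D" "\<forall>s'\<in>set_pmf D. R s'"
    "g \<longrightarrow> measure_pmf.prob D {s'. \<not> Q s'} \<le> p"
    using assms(1) by (auto simp: prob_triple_def)
  have "measure_pmf.prob D {s'. \<not> Q' s'} \<le> p'" if g'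
  proof -
    have "measure_pmf.prob D {s'. \<not> Q' s'} = measure_pmf.prob D ({s'. \<not> Q' s'} \<inter> set_pmf D)"
      by (simp add: measure_Int_set_pmf)
    also have "\<dots> \<le> measure_pmf.prob D {s'. \<not> Q s'}"
      by (rule measure_pmf.finite_measure_mono) (use D(2) assms(5) in auto)
    finally show ?thesis using D(3) assms(4,6) that by linarith
  qed
  then show ?thesis unfolding prob_triple_def using D(1,2) assms(2,3) terminates_mono by blast
qed

lemma triple_imp_prob_triple: "triple is s T (\<lambda>s'. R s' \<and> (g \<longrightarrow> Q s')) \<Longrightarrow> prob_triple is s T R g Q 0"
proof -
  assume "triple is s T (\<lambda>s'. R s' \<and> (g \<longrightarrow> Q s'))"
  then obtain s' where "terminates (is, s) T (return_pmf s')" "R s' \<and> (g \<longrightarrow> Q s')"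
    by (auto simp: triple_def)
  then show ?thesis unfolding prob_triple_def by (intro exI[of _ "return_pmf s'"]) (auto simp: measure_return)
qed

text \<open>A union bound that needs no independence: an intermediate state violating
  \<open>Q1\<close> is charged failure probability 1, any other at most \<open>p2\<close>.\<close>

lemma prob_triple_append:
  assumes "prob_triple is1 s T1 R1 g Q1 p1" "\<And>s1. R1 s1 \<Longrightarrow> prob_triple is2 s1 T2 R (Q1 s1) Q p2" "0 \<le> p2"
  shows "prob_triple (is1 @ is2) s (T1 + T2) R g Q (p1 + p2)"
proof -
  obtain D where D: "terminates (is1, s) T1 D" "\<And>s'. s' \<in> set_pmf D \<Longrightarrow> R1 s'"
    "g \<longrightarrow> measure_pmf.prob D {s'. \<not> Q1 s'} \<le> p1"
    using assms(1) by (auto simp: prob_triple_def)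
  have "\<forall>s1. \<exists>D2. R1 s1 \<longrightarrow> terminates (is2, s1) T2 D2 \<and> (\<forall>s'\<in>set_pmf D2. R s') \<and>
     (Q1 s1 \<longrightarrow> measure_pmf.prob D2 {s'. \<not> Q s'} \<le> p2)"
    using assms(2) unfolding prob_triple_def by blast
  then obtain E where E: "\<And>s1. R1 s1 \<Longrightarrow> terminates (is2, s1) T2 (E s1) \<and> (\<forall>s'\<in>set_pmf (E s1). R s') \<and>
     (Q1 s1 \<longrightarrow> measure_pmf.prob (E s1) {s'. \<not> Q s'} \<le> p2)" by metis
  have t: "terminates (is1 @ is2, s) (T1 + T2) (bind_pmf D E)"
    by (rule terminates_append[OF D(1)]) (use D(2) E in auto)
  have "measure_pmf.prob (bind_pmf D E) {s'. \<not> Q s'} \<le> p1 + p2" if g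
  proof -
    have "measure_pmf.prob (bind_pmf D E) {s'. \<not> Q s'} = measure_pmf.expectation D (\<lambda>x. measure_pmf.prob (E x) {s'. \<not> Q s'})"
    proof -
      have "measure_pmf.prob (bind_pmf D E) {s'. \<not> Q s'} = enn2real (emeasure (measure_pmf (bind_pmf D E)) {s'. \<not> Q s'})"
        by (simp add: measure_def)
      also have "\<dots> = enn2real (\<integral>\<^sup>+x. ennreal (measure_pmf.prob (E x) {s'. \<not> Q s'}) \<partial>measure_pmf D)"
        unfolding emeasure_bind_pmf by (simp only: measure_pmf.emeasure_eq_measure)
      also have "\<dots> = measure_pmf.expectation D (\<lambda>x. measure_pmf.prob (E x) {s'. \<not> Q s'})"
        by (rule integral_eq_nn_integral[symmetric]) auto
      finally show ?thesis .
    qed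
    also have "\<dots> \<le> measure_pmf.expectation D (\<lambda>x. indicator {s'. \<not> Q1 s'} x + p2)"
    proof (rule integral_mono_AE)
      show "integrable (measure_pmf D) (\<lambda>x. measure_pmf.prob (E x) {s'. \<not> Q s'})"
        by (rule measure_pmf.integrable_const_bound[where B=1]) auto
      show "integrable (measure_pmf D) (\<lambda>x. indicator {s'. \<not> Q1 s'} x + p2)"
        by (rule measure_pmf.integrable_const_bound[where B="1 + p2"]) (auto simp: indicator_def assms(3))
      show "AE x in measure_pmf D. measure_pmf.prob (E x) {s'. \<not> Q s'} \<le> indicator {s'. \<not> Q1 s'} x + p2"
      proof (rule AE_pmfI)
        fix x assume x: "x \<in> set_pmf D"
        show "measure_pmf.prob (E x) {s'. \<not> Q s'} \<le> indicator {s'. \<not> Q1 s'} x + p2"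
        proof (cases "Q1 x")
          case True
          then show ?thesis using E[OF D(2)[OF x]] by (simp del: not_not)
        next
          case False
          have "measure_pmf.prob (E x) {s'. \<not> Q s'} \<le> 1" by (rule measure_pmf.prob_le_1)
          also have "\<dots> \<le> 1 + p2" using assms(3) by simp
          also have "\<dots> = indicator {s'. \<not> Q1 s'} x + p2" using False by (simp del: not_not)
          finally show ?thesis .
        qed
      qed
    qed
    also have "\<dots> = measure_pmf.prob D {s'. \<not> Q1 s'} + p2"
      by (subst Bochner_Integration.integral_add) (auto intro!: measure_pmf.integrable_const_bound[where B=1])
    finally show ?thesis using D(3) that by linarith
  qed
  then show ?thesis unfolding prob_triple_def
  proof (intro exI[of _ "bind_pmf D E"] conjI ballI t)
    fix s' assume "s' \<in> set_pmf (bind_pmf D E)"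
    then obtain x where "x \<in> set_pmf D" "s' \<in> set_pmf (E x)" by (auto simp: set_bind_pmf)
    then show "R s'" using E[OF D(2)] by blast
  qed blast
qed

text \<open>The index counts iterations, so an exit forced by \<open>I N\<close> yields a time bound
  although the loop may stop earlier. \<open>I\<close> holds surely, whereas \<open>G\<close> may be
  lost with probability \<open>p\<close> in each iteration; induction on \<open>N - i\<close> adds
  up these losses.\<close>

lemma prob_triple_while:
  assumes "\<And>i s. i < N \<Longrightarrow> I i s \<Longrightarrow> reg s r \<noteq> 0 \<Longrightarrow> prob_triple body s T (I (Suc i)) (G i s) (G (Suc i)) p"
    and "\<And>s. I N s \<Longrightarrow> reg s r = 0"
    and "i \<le> N" "I i s" "0 \<le> p"
  shows "prob_triple [While r body] s ((N - i) * Suc T + 1) (\<lambda>s'. \<exists>j\<le>N. I j s' \<and> reg s' r = 0) (G i s)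
     (\<lambda>s'. \<exists>j\<le>N. I j s' \<and> G j s' \<and> reg s' r = 0) (real (N - i) * p)"
  using assms(3,4)
proof (induction "N - i" arbitrary: i s)
  case (0 i s)
  then have "reg s r = 0" using assms(2) by simp
  then have "triple [While r body] s 1 (\<lambda>s'. s' = s)"
    by (rule triple_while_exit)
  then have "triple [While r body] s ((N - i) * Suc T + 1) (\<lambda>s'. s' = s)"
    by (rule triple_mono) auto
  then have "prob_triple [While r body] s ((N - i) * Suc T + 1) (\<lambda>s'. \<exists>j\<le>N. I j s' \<and> reg s' r = 0) (G i s)
     (\<lambda>s'. \<exists>j\<le>N. I j s' \<and> G j s' \<and> reg s' r = 0) 0"
    by (intro triple_imp_prob_triple) (erule triple_mono, use 0 \<open>reg s r = 0\<close> in auto)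
  then show ?case by (rule prob_triple_mono) (use assms(5) in auto)
next
  case (Suc d i s)
  show ?case
  proof (cases "reg s r = 0")
    case True
    then have "triple [While r body] s 1 (\<lambda>s'. s' = s)"
      by (rule triple_while_exit)
    then have "triple [While r body] s ((N - i) * Suc T + 1) (\<lambda>s'. s' = s)"
      by (rule triple_mono) auto
    then have "prob_triple [While r body] s ((N - i) * Suc T + 1) (\<lambda>s'. \<exists>j\<le>N. I j s' \<and> reg s' r = 0) (G i s)
     (\<lambda>s'. \<exists>j\<le>N. I j s' \<and> G j s' \<and> reg s' r = 0) 0"
      by (intro triple_imp_prob_triple) (erule triple_mono, use Suc.prems True in auto)
    then show ?thesis by (rule prob_triple_mono) (use assms(5) in auto)
  next
    case False
    have iN: "i < N" using Suc by linarith
    have IH: "prob_triple [While r body] s1 ((N - Suc i) * Suc T + 1) (\<lambda>s'. \<exists>j\<le>N. I j s' \<and> reg s' r = 0) (G (Suc i) s1)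
     (\<lambda>s'. \<exists>j\<le>N. I j s' \<and> G j s' \<and> reg s' r = 0) (real (N - Suc i) * p)" if "I (Suc i) s1" for s1
      by (rule Suc.hyps(1)) (use Suc.hyps(2) iN that in auto)
    have a: "prob_triple (body @ [While r body]) s (T + ((N - Suc i) * Suc T + 1)) (\<lambda>s'. \<exists>j\<le>N. I j s' \<and> reg s' r = 0) (G i s)
     (\<lambda>s'. \<exists>j\<le>N. I j s' \<and> G j s' \<and> reg s' r = 0) (p + real (N - Suc i) * p)"
      by (rule prob_triple_append[OF assms(1)[OF iN Suc.prems(2) False] IH]) (use assms(5) in auto)
    then obtain D where D: "terminates (body @ [While r body], s) (T + ((N - Suc i) * Suc T + 1)) D"
      "\<forall>s'\<in>set_pmf D. \<exists>j\<le>N. I j s' \<and> reg s' r = 0"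
      "G i s \<longrightarrow> measure_pmf.prob D {s'. \<not> (\<exists>j\<le>N. I j s' \<and> G j s' \<and> reg s' r = 0)} \<le> p + real (N - Suc i) * p"
      unfolding prob_triple_def by blast
    have bD: "bind_pmf (step w pos P ([While r body], s)) (\<lambda>_. D) = D" by (rule bind_pmf_const)
    have "terminates ([While r body], s) (Suc (T + ((N - Suc i) * Suc T + 1))) (bind_pmf (step w pos P ([While r body], s)) (\<lambda>_. D))"
      by (rule terminates_step) (use D(1) False in auto)
    moreover have "Suc (T + ((N - Suc i) * Suc T + 1)) = (N - i) * Suc T + 1"
    proof -
      have "N - i = Suc (N - Suc i)" using iN by simp
      then show ?thesis by simp
    qed
    ultimately have t: "terminates ([While r body], s) ((N - i) * Suc T + 1) D" unfolding bD by (simp only:)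
    have "p + real (N - Suc i) * p = real (N - i) * p"
      using iN by (simp add: of_nat_diff algebra_simps)
    then have "G i s \<longrightarrow> measure_pmf.prob D {s'. \<not> (\<exists>j\<le>N. I j s' \<and> G j s' \<and> reg s' r = 0)} \<le> real (N - i) * p"
      using D(3) by simp
    with t D(2) show ?thesis unfolding prob_triple_def by (intro exI[of _ D] conjI)
  qed
qed

lemma triple_while:
  assumes "\<And>i s. i < N \<Longrightarrow> I i s \<Longrightarrow> reg s r \<noteq> 0 \<Longrightarrow> triple body s T (I (Suc i))"
    and "\<And>s. I N s \<Longrightarrow> reg s r = 0"
    and "i \<le> N" "I i s"
  shows "triple [While r body] s ((N - i) * Suc T + 1) (\<lambda>s'. \<exists>j\<le>N. I j s' \<and> reg s' r = 0)"
  using assms(3,4)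
proof (induction "N - i" arbitrary: i s)
  case (0 i s)
  then have *: "reg s r = 0" "i = N" using assms(2) by auto
  then show ?case
    by (intro triple_mono[OF triple_while_exit[OF *(1)]]) (use 0 in auto)
next
  case (Suc d i s)
  show ?case
  proof (cases "reg s r = 0")
    case True
    then have "triple [While r body] s 1 (\<lambda>s'. s' = s)"
      by (rule triple_while_exit)
    then show ?thesis
      by (rule triple_mono) (use Suc.prems True in auto)
  next
    case False
    have iN: "i < N" using Suc by linarith
    have IH: "triple [While r body] s1 ((N - Suc i) * Suc T + 1) (\<lambda>s'. \<exists>j\<le>N. I j s' \<and> reg s' r = 0)" if "I (Suc i) s1" for s1
      by (rule Suc.hyps(1)) (use Suc.hyps(2) iN that in auto)
    have a: "triple (body @ [While r body]) s (T + ((N - Suc i) * Suc T + 1)) (\<lambda>s'. \<exists>j\<le>N. I j s' \<and> reg s' r = 0)"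
      by (rule triple_append[OF assms(1)[OF iN Suc.prems(2) False] IH])
    have "triple [While r body] s (Suc (T + ((N - Suc i) * Suc T + 1))) (\<lambda>s'. \<exists>j\<le>N. I j s' \<and> reg s' r = 0)"
      by (rule triple_step[OF _ a]) (use False in simp)
    moreover have "Suc (T + ((N - Suc i) * Suc T + 1)) = (N - i) * Suc T + 1"
    proof -
      have "N - i = Suc (N - Suc i)" using iN by simp
      then show ?thesis by simp
    qed
    ultimately show ?thesis by (simp only:)
  qed
qed

section \<open>Symbolic evaluation of loop-free code\<close>

fun exec_det :: "instr list \<Rightarrow> state \<Rightarrow> state" where
  "exec_det [] s = s"
| "exec_det (Const r c # is) s = exec_det is (set_reg r (c mod 2 ^ w) s)"
| "exec_det (Arith f r a b # is) s = exec_det is (set_reg r (arith_op f (reg s a) (reg s b) mod 2 ^ w) s)"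
| "exec_det (Load r a # is) s = exec_det is (set_reg r (mem s (reg s a)) s)"
| "exec_det (Store a b # is) s = exec_det is (s\<lparr>mem := (mem s)(reg s a := reg s b)\<rparr>)"
| "exec_det (Label r a b # is) s = exec_det is (set_reg r (of_bool ({reg s a, reg s b} \<in> pos)) s)"
| "exec_det (SameCluster r a b # is) s = exec_det is (set_reg r (of_bool (\<exists>A\<in>P. reg s a \<in> A \<and> reg s b \<in> A))
                       (s\<lparr>queries := Suc (queries s)\<rparr>))"
| "exec_det (Cond r is1 is2 # is) s = exec_det is (if reg s r \<noteq> 0 then exec_det is1 s else exec_det is2 s)"
| "exec_det (Rand r a # is) s = s"
| "exec_det (While r is1 # is) s = s"

fun loop_free :: "instr list \<Rightarrow> bool" where
  "loop_free [] = True"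
| "loop_free (Cond r is1 is2 # is) = (loop_free is1 \<and> loop_free is2 \<and> loop_free is)"
| "loop_free (Rand r a # is) = False"
| "loop_free (While r is1 # is) = False"
| "loop_free (_ # is) = loop_free is"

fun time_of :: "instr list \<Rightarrow> nat" where
  "time_of [] = 0"
| "time_of (Cond r is1 is2 # is) = Suc (max (time_of is1) (time_of is2) + time_of is)"
| "time_of (_ # is) = Suc (time_of is)"

text \<open>A loop-free block acts as a function on states, so its correctness becomes a matter of
  simplification. The values of \<open>exec_det\<close> at \<open>Rand\<close> and
  \<open>While\<close> are defaults, which \<open>loop_free\<close> excludes.\<close>

lemma triple_exec_aux: "loop_free is \<Longrightarrow> triple is s (time_of is) (\<lambda>s'. s' = exec_det is s)"
proof (induction "is" arbitrary: s rule: loop_free.induct)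
  case 1 then show ?case by (simp add: triple_Nil)
next
  case (2 r is1 is2 "is")
  have a: "triple (if reg s r \<noteq> 0 then is1 else is2) s (max (time_of is1) (time_of is2))
     (\<lambda>s'. s' = (if reg s r \<noteq> 0 then exec_det is1 s else exec_det is2 s))"
    using 2 by (auto intro: triple_mono[OF _ max.cobounded1] triple_mono[OF _ max.cobounded2])
  have b: "triple ((if reg s r \<noteq> 0 then is1 else is2) @ is) s (max (time_of is1) (time_of is2) + time_of is)
     (\<lambda>s'. s' = exec_det (Cond r is1 is2 # is) s)"
    by (rule triple_append[OF a]) (use 2 in simp)
  show ?case
    using triple_step[OF _ b, of "Cond r is1 is2" "is" s] by simp
next
  case 3 then show ?case by simp
next
  case 4 then show ?case by simp
next
  case ("5_1")
  show ?case unfolding exec_det.simps time_of.simps by (rule triple_step[OF step.simps(2)]) (use "5_1" in simp)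
next
  case ("5_2")
  show ?case unfolding exec_det.simps time_of.simps by (rule triple_step[OF step.simps(3)]) (use "5_2" in simp)
next
  case ("5_3")
  show ?case unfolding exec_det.simps time_of.simps by (rule triple_step[OF step.simps(4)]) (use "5_3" in simp)
next
  case ("5_4")
  show ?case unfolding exec_det.simps time_of.simps by (rule triple_step[OF step.simps(5)]) (use "5_4" in simp)
next
  case ("5_5")
  show ?case unfolding exec_det.simps time_of.simps by (rule triple_step[OF step.simps(7)]) (use "5_5" in simp)
next
  case ("5_6")
  show ?case unfolding exec_det.simps time_of.simps by (rule triple_step[OF step.simps(8)]) (use "5_6" in simp)
qed

lemma triple_exec: "loop_free is \<Longrightarrow> time_of is \<le> T \<Longrightarrow> R (exec_det is s) \<Longrightarrow> triple is s T R"
  by (rule triple_mono[OF triple_exec_aux]) auto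

end

section \<open>Cost of labelings\<close>

locale correlation =
  fixes n :: nat and pos :: "nat set set"
begin

text \<open>Zero on the diagonal, because a sample may contain the examined vertex itself and this
  must not count as a vote.\<close>

definition edge_sign :: "nat \<Rightarrow> nat \<Rightarrow> int" where
  "edge_sign v u = (if u = v then 0 else if {u, v} \<in> pos then 1 else - 1)"

definition disagree :: "nat \<Rightarrow> nat \<Rightarrow> bool \<Rightarrow> int" where
  "disagree v u together = of_bool (u \<noteq> v \<and> ({u, v} \<in> pos) \<noteq> together)"

definition vcost :: "(nat \<Rightarrow> nat) \<Rightarrow> nat \<Rightarrow> nat \<Rightarrow> int" where
  "vcost f v i = (\<Sum>u<n. disagree v u (f u = i))"

text \<open>Ordered pairs are summed, so every disagreement is counted twice.\<close>
definition cost :: "(nat \<Rightarrow> nat) \<Rightarrow> int" where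
  "cost f = (\<Sum>v<n. vcost f v (f v))"

definition balance :: "(nat \<Rightarrow> nat) \<Rightarrow> nat set \<Rightarrow> nat \<Rightarrow> nat \<Rightarrow> int" where
  "balance f W v i = (\<Sum>u\<in>W. of_bool (f u = i) * edge_sign v u)"

lemma disagree_commute: "disagree v u b = disagree u v b"
  by (simp add: disagree_def insert_commute eq_commute)

lemma disagree_self [simp]: "disagree v v b = 0"
  by (simp add: disagree_def)

lemma disagree_sg: "disagree v u b = disagree v u False - of_bool b * edge_sign v u"
  by (auto simp: disagree_def edge_sign_def)

lemma edge_sign_self [simp]: "edge_sign v v = 0" by (simp add: edge_sign_def)

lemma abs_sg: "\<bar>edge_sign v u\<bar> \<le> 1" by (simp add: edge_sign_def)

lemma vcost_nonneg: "0 \<le> vcost f v i"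
  unfolding vcost_def by (intro sum_nonneg) (simp add: disagree_def)

text \<open>The first sum is the cost of isolating \<open>v\<close> and does not depend on
  \<open>i\<close>. Cheap slots are thus those of large balance, and a balance is a sum over
  vertices that sampling can estimate.\<close>

lemma vcost_bal:
  "vcost f v i = (\<Sum>u<n. disagree v u False) - balance f {..<n} v i"
  unfolding vcost_def balance_def by (subst disagree_sg) (simp add: sum_subtractf)

lemma vcost_upd: "vcost (f(v := j)) v i = vcost f v i"
  unfolding vcost_def by (rule sum.cong) auto

text \<open>Ordered pairs meet \<open>v\<close> once in each component, hence the factor 2; the
  remaining double sum does not see the slot of \<open>v\<close>.\<close>

lemma cost_split:
  assumes "v < n"
  shows "cost f = 2 * vcost f v (f v) + (\<Sum>x\<in>{..<n}-{v}. \<Sum>u\<in>{..<n}-{v}. disagree x u (f u = f x))"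
proof -
  have r: "vcost f x (f x) = disagree x v (f v = f x) + (\<Sum>u\<in>{..<n}-{v}. disagree x u (f u = f x))" for x
    unfolding vcost_def using assms by (subst sum.remove[of _ v]) auto
  have "cost f = vcost f v (f v) + (\<Sum>x\<in>{..<n}-{v}. vcost f x (f x))"
    unfolding cost_def using assms by (subst sum.remove[of _ v]) auto
  also have "(\<Sum>x\<in>{..<n}-{v}. vcost f x (f x)) =
      (\<Sum>x\<in>{..<n}-{v}. disagree x v (f v = f x)) + (\<Sum>x\<in>{..<n}-{v}. \<Sum>u\<in>{..<n}-{v}. disagree x u (f u = f x))"
    unfolding r by (rule sum.distrib)
  also have "(\<Sum>x\<in>{..<n}-{v}. disagree x v (f v = f x)) = vcost f v (f v)"
    unfolding vcost_def using assms
    by (subst (2) sum.remove[of _ v]) (auto simp: disagree_commute[of v] eq_commute intro!: sum.cong)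
  finally show ?thesis by simp
qed

lemma cost_upd:
  assumes "v < n"
  shows "cost (f(v := j)) = cost f + 2 * (vcost f v j - vcost f v (f v))"
proof -
  have "(\<Sum>x\<in>{..<n}-{v}. \<Sum>u\<in>{..<n}-{v}. disagree x u ((f(v := j)) u = (f(v := j)) x)) =
    (\<Sum>x\<in>{..<n}-{v}. \<Sum>u\<in>{..<n}-{v}. disagree x u (f u = f x))"
    by (intro sum.cong) auto
  then show ?thesis
    using cost_split[OF assms, of f] cost_split[OF assms, of "f(v := j)"] by (simp add: vcost_upd)
qed

text \<open>Decided vertices sit in closed slots, so the balance of an open slot can be estimated
  from samples of the undecided vertices alone.\<close>

lemma balance_restrict:
  assumes "W \<subseteq> {..<n}" "\<And>u. u < n \<Longrightarrow> u \<notin> W \<Longrightarrow> f u \<noteq> i"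
  shows "balance f {..<n} v i = balance f W v i"
  unfolding balance_def by (rule sum.mono_neutral_right) (use assms in auto)

lemma balance_diff:
  assumes "finite W" "D \<subseteq> W" "\<And>u. u \<in> W \<Longrightarrow> u \<notin> D \<Longrightarrow> f u = f' u"
  shows "\<bar>balance f W v i - balance f' W v i\<bar> \<le> card D"
proof -
  have "balance f W v i - balance f' W v i = (\<Sum>u\<in>W. (of_bool (f u = i) - of_bool (f' u = i)) * edge_sign v u)"
    unfolding balance_def by (simp add: sum_subtractf left_diff_distrib)
  also have "\<dots> = (\<Sum>u\<in>D. (of_bool (f u = i) - of_bool (f' u = i)) * edge_sign v u)"
    by (rule sum.mono_neutral_right) (use assms in auto)
  also have "\<bar>\<dots>\<bar> \<le> (\<Sum>u\<in>D. \<bar>(of_bool (f u = i) - of_bool (f' u = i)) * edge_sign v u\<bar>)"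
    by (rule sum_abs)
  also have "\<dots> \<le> (\<Sum>u\<in>D. 1)"
    by (rule sum_mono) (auto simp: abs_mult abs_sg)
  finally show ?thesis by simp
qed

lemma vcost_diff:
  assumes "D \<subseteq> {..<n}" "\<And>u. u < n \<Longrightarrow> u \<notin> D \<Longrightarrow> f u = f' u"
  shows "\<bar>vcost f v i - vcost f' v i\<bar> \<le> card D"
  using balance_diff[of "{..<n}" D f f' v i] assms by (auto simp: vcost_bal)

text \<open>A vertex of \<open>L\<close> other than \<open>v\<close> disagrees with \<open>v\<close> in exactly one of two slots, one of which is \<open>L\<close>.\<close>
lemma vcost_sum_ge:
  assumes "i \<noteq> j" "L = i \<or> L = j"
  shows "int (card {u. u < n \<and> f u = L}) - 1 \<le> vcost f v i + vcost f v j"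
proof -
  have "int (card {u. u < n \<and> f u = L}) - 1 \<le> int (card ({u. u < n \<and> f u = L} - {v}))"
    by (cases "v \<in> {u. u < n \<and> f u = L}") (auto simp: card_Diff_singleton of_nat_diff)
  also have "\<dots> = (\<Sum>u\<in>{u. u < n \<and> f u = L} - {v}. 1)" by simp
  also have "\<dots> \<le> (\<Sum>u\<in>{u. u < n \<and> f u = L} - {v}. disagree v u (f u = i) + disagree v u (f u = j))"
    by (rule sum_mono) (use assms in \<open>auto simp: disagree_def\<close>)
  also have "\<dots> \<le> (\<Sum>u<n. disagree v u (f u = i) + disagree v u (f u = j))"
    by (rule sum_mono2) (auto simp: disagree_def)
  also have "\<dots> = vcost f v i + vcost f v j" by (simp add: vcost_def sum.distrib)
  finally show ?thesis .
qed

text \<open>Pairs \<open>v < u\<close> correspond to edges, and swapping the components accounts for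
  the other half of the ordered pairs.\<close>

lemma cost_disagreements:
  assumes pos: "pos \<subseteq> edges n"
    and f: "\<And>u v. u < n \<Longrightarrow> v < n \<Longrightarrow> f u = f v \<longleftrightarrow> (\<exists>A\<in>P. u \<in> A \<and> v \<in> A)"
  shows "cost f = 2 * int (disagreements n pos P)"
proof -
  let ?E = "{e \<in> edges n. (e \<in> pos) \<noteq> (\<exists>A\<in>P. e \<subseteq> A)}"
  have fin: "finite (edges n)" unfolding edges_def by simp
  have "disagreements n pos P = card ({e \<in> edges n - pos. \<exists>A\<in>P. e \<subseteq> A} \<union> {e \<in> pos. \<not> (\<exists>A\<in>P. e \<subseteq> A)})"
    unfolding disagreements_def
    by (rule card_Un_disjoint[symmetric]) (use fin pos in \<open>auto intro: finite_subset[OF _ fin]\<close>)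
  also have "{e \<in> edges n - pos. \<exists>A\<in>P. e \<subseteq> A} \<union> {e \<in> pos. \<not> (\<exists>A\<in>P. e \<subseteq> A)} = ?E"
    using pos by auto
  finally have dE: "disagreements n pos P = card ?E" .
  let ?S = "{(v, u). v < n \<and> u < n \<and> u \<noteq> v \<and> ({u, v} \<in> pos) \<noteq> (f u = f v)}"
  have S: "?S \<subseteq> {..<n} \<times> {..<n}" by auto
  have "cost f = (\<Sum>p\<in>{..<n} \<times> {..<n}. of_bool (p \<in> ?S))"
    unfolding cost_def vcost_def sum.cartesian_product
    by (rule sum.cong) (auto simp: disagree_def)
  also have "\<dots> = int (card ?S)"
    using S by (simp add: Int_absorb1 flip: sum.inter_restrict)
  also have "card ?S = card {(v, u) \<in> ?S. v < u} + card {(v, u) \<in> ?S. u < v}"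
    by (subst card_Un_disjoint[symmetric]) (auto intro!: arg_cong[where f=card] finite_subset[OF _ finite_cartesian_product[of "{..<n}" "{..<n}"]])
  also have "card {(v, u) \<in> ?S. u < v} = card {(v, u) \<in> ?S. v < u}"
    by (rule bij_betw_same_card[of prod.swap], rule bij_betw_byWitness[where f' = prod.swap])
       (auto simp: insert_commute)
  also have "card {(v, u) \<in> ?S. v < u} = card ?E"
  proof (rule bij_betw_same_card[of "\<lambda>(v, u). {u, v}"])
    show "bij_betw (\<lambda>(v, u). {u, v}) {(v, u) \<in> ?S. v < u} ?E"
      unfolding bij_betw_def
    proof
      show "inj_on (\<lambda>(v, u). {u, v}) {(v, u) \<in> ?S. v < u}"
        by (auto simp: inj_on_def doubleton_eq_iff)
      show "(\<lambda>(v, u). {u, v}) ` {(v, u) \<in> ?S. v < u} = ?E"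
      proof (intro set_eqI iffI)
        fix e assume "e \<in> (\<lambda>(v, u). {u, v}) ` {(v, u) \<in> ?S. v < u}"
        then show "e \<in> ?E" using f by (auto simp: edges_def card_insert_if)
      next
        fix e assume e: "e \<in> ?E"
        then obtain x y where xy: "e = {x, y}" "x \<noteq> y" by (auto simp: edges_def card_2_iff)
        define a b where "a = min x y" and "b = max x y"
        have ab: "e = {b, a}" "a < b" using xy by (auto simp: a_def b_def min_def max_def)
        then have "(a, b) \<in> {(v, u) \<in> ?S. v < u}" using e f by (auto simp: edges_def)
        then show "e \<in> (\<lambda>(v, u). {u, v}) ` {(v, u) \<in> ?S. v < u}" using ab by force
      qed
    qed
  qed
  finally show ?thesis unfolding dE by simp
qed


section \<open>Charging the moves of a round to disagreements at its beginning\<close>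

definition moved :: "nat set \<Rightarrow> (nat \<Rightarrow> nat) \<Rightarrow> (nat \<Rightarrow> nat) \<Rightarrow> nat set" where
  "moved W f0 f = {v \<in> W. f v \<noteq> f0 v}"

text \<open>The floor exploits that costs are integers: if \<open>\<gamma> * card W < 1\<close>,
  moves cannot increase the cost and nothing has to be charged. Otherwise the second part bounds the
  disagreements at moved vertices from below, measured in the clustering \<open>f0\<close> before
  the round. It stops growing at \<open>card W / (16 * k)\<close> moves, since disagreements seen
  later may stem from the moves themselves.\<close>

definition move_inv :: "nat \<Rightarrow> real \<Rightarrow> nat set \<Rightarrow> (nat \<Rightarrow> nat) \<Rightarrow> (nat \<Rightarrow> nat) \<Rightarrow> bool" where
  "move_inv k \<gamma> W f0 f \<longleftrightarrow>
     cost f \<le> cost f0 + 2 * int (card (moved W f0 f)) * \<lfloor>\<gamma> * real (card W)\<rfloor> \<and>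
     (1 \<le> \<gamma> * real (card W) \<longrightarrow>
       min (real (card (moved W f0 f))) (real (card W) / (16 * k)) * (real (card W) / (8 * k))
         \<le> real_of_int (\<Sum>v\<in>moved W f0 f. vcost f0 v (f0 v)))"

lemma move_inv_refl: "move_inv k \<gamma> W f f"
  by (simp add: move_inv_def moved_def)

text \<open>A move is cheap by \<open>balance\<close>. Its charge comes from
  \<open>vcost_sum_ge\<close>, because the old or the new slot is the large slot \<open>L\<close>.
  Assumption \<open>fv\<close> says that \<open>v\<close> has not moved before in this round, so its
  disagreements under \<open>f0\<close> are charged only once.\<close>

lemma move_inv_step:
  fixes \<gamma> :: real
  assumes W: "W \<subseteq> {..<n}" "v \<in> W" and fv: "f v = f0 v" and R: "move_inv k \<gamma> W f0 f"
    and k: "k \<ge> 1" and \<gamma>: "0 < \<gamma>" "\<gamma> \<le> 1 / (32 * k)"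
    and out: "\<And>u. u < n \<Longrightarrow> u \<notin> W \<Longrightarrow> f u = f0 u \<and> f u \<notin> Op"
    and Op: "f v \<in> Op" "g \<in> Op"
    and large_slot: "card W \<le> 2 * k * card {u \<in> W. f0 u = L}"
    and balance: "balance f W v (f v) - \<gamma> * real (card W) \<le> balance f W v g"
    and f': "f' = f(v := if g = L \<or> f v = L then g else f v)"
  shows "move_inv k \<gamma> W f0 f'"
proof (cases "(g = L \<or> f v = L) \<and> g \<noteq> f v")
  case False
  then have "f' = f" using f' by auto
  then show ?thesis using R by simp
next
  case True
  then have f'g: "f' = f(v := g)" using f' by auto
  have vn: "v < n" using W by auto
  have finW: "finite W" using W(1) finite_subset by blast
  let ?M = "moved W f0 f" and ?w = "real (card W)"
  have M: "moved W f0 f' = insert v ?M" "v \<notin> ?M" "finite ?M"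
    using True f'g fv W finW by (auto simp: moved_def)
  have cM: "card (moved W f0 f') = Suc (card ?M)" using M by simp
  have balV: "balance f {..<n} v j = balance f W v j" if "j \<in> Op" for j
    using out that by (intro balance_restrict[OF W(1)]) metis
  have "vcost f v g - vcost f v (f v) = balance f W v (f v) - balance f W v g"
    unfolding vcost_bal balV[OF Op(1)] balV[OF Op(2)] by simp
  moreover have "balance f W v (f v) - balance f W v g \<le> \<lfloor>\<gamma> * ?w\<rfloor>"
    using balance by (simp add: le_floor_iff)
  ultimately have rd: "vcost f v g - vcost f v (f v) \<le> \<lfloor>\<gamma> * ?w\<rfloor>" by simp
  have "cost f' \<le> cost f0 + 2 * int (card (moved W f0 f')) * \<lfloor>\<gamma> * ?w\<rfloor>"
  proof -
    have "cost f' = cost f + 2 * (vcost f v g - vcost f v (f v))" unfolding f'g by (rule cost_upd[OF vn])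
    moreover have "cost f \<le> cost f0 + 2 * int (card ?M) * \<lfloor>\<gamma> * ?w\<rfloor>" using R by (simp add: move_inv_def)
    moreover have "2 * int (card (moved W f0 f')) * \<lfloor>\<gamma> * ?w\<rfloor> = 2 * int (card ?M) * \<lfloor>\<gamma> * ?w\<rfloor> + 2 * \<lfloor>\<gamma> * ?w\<rfloor>"
      unfolding cM by (simp add: algebra_simps)
    moreover have "\<And>a b c x y z l :: int. a = b + 2 * x \<Longrightarrow> b \<le> c + y \<Longrightarrow> z = y + 2 * l \<Longrightarrow> x \<le> l \<Longrightarrow> a \<le> c + z"
      by linarith
    ultimately show ?thesis using rd by blast
  qed
  moreover have "min (real (card (moved W f0 f'))) (?w / (16 * k)) * (?w / (8 * k))
         \<le> real_of_int (\<Sum>v\<in>moved W f0 f'. vcost f0 v (f0 v))" if gw: "1 \<le> \<gamma> * ?w"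
  proof -
    let ?m = "real (card ?M)"
    have s: "(\<Sum>v\<in>moved W f0 f'. vcost f0 v (f0 v)) = vcost f0 v (f0 v) + (\<Sum>v\<in>?M. vcost f0 v (f0 v))"
      using M by simp
    have old: "min ?m (?w / (16 * k)) * (?w / (8 * k)) \<le> real_of_int (\<Sum>v\<in>?M. vcost f0 v (f0 v))"
      using R gw by (simp add: move_inv_def)
    show ?thesis
    \<comment> \<open>At the cap the left side no longer grows, and a further nonnegative cost on
      the right does no harm. Only below the cap does the new vertex have to contribute.\<close>
    proof (cases "?w / (16 * k) \<le> ?m")
      case True
      then have "min (real (card (moved W f0 f'))) (?w / (16 * k)) = min ?m (?w / (16 * k))"
        unfolding cM by auto
      then show ?thesis unfolding s using old vcost_nonneg[of f0 v "f0 v"] by simp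
    next
      case False
      have a: "vcost f v (f v) - vcost f0 v (f v) \<le> card ?M"
      proof -
        have "f u = f0 u" if "u < n" "u \<notin> ?M" for u
          using that out[of u] by (cases "u \<in> W") (auto simp: moved_def)
        moreover have "?M \<subseteq> {..<n}" using W by (auto simp: moved_def)
        ultimately show ?thesis using vcost_diff[of ?M f f0 v "f v"] by simp
      qed
      have b: "int (card {u. u < n \<and> f u = L}) - 1 \<le> vcost f v (f v) + vcost f v g"
        by (rule vcost_sum_ge) (use True in auto)
      have "card {u \<in> W. f0 u = L} \<le> card ({u. u < n \<and> f u = L} \<union> ?M)"
        by (rule card_mono) (use W M in \<open>auto simp: moved_def\<close>)
      also have "\<dots> \<le> card {u. u < n \<and> f u = L} + card ?M" by (rule card_Un_le)
      finally have c: "real (card {u \<in> W. f0 u = L}) \<le> real (card {u. u < n \<and> f u = L}) + ?m" by simp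
      have rd': "real_of_int (vcost f v g) \<le> vcost f v (f v) + \<gamma> * ?w"
        using rd by linarith
      have c': "?w / (2 * k) \<le> real (card {u \<in> W. f0 u = L})"
      proof -
        have "?w \<le> real (2 * k * card {u \<in> W. f0 u = L})" using large_slot of_nat_mono by blast
        then show ?thesis using k by (simp add: field_simps)
      qed
      have gw': "\<gamma> * ?w \<le> ?w / (32 * k)"
        using mult_right_mono[OF \<gamma>(2), of ?w] by simp
      \<comment> \<open>In units of \<open>z\<close>: slot \<open>L\<close> had at least
        \<open>8 * z\<close> vertices and lost fewer than \<open>z\<close> to moves, while the 1 for
        \<open>v\<close> itself and the error \<open>\<gamma> * ?w\<close> are at most
        \<open>z / 2\<close> each. Hence twice the cost of \<open>v\<close> at \<open>f v\<close> is
        at least \<open>6 * z\<close>. Going back from \<open>f\<close> to \<open>f0\<close> loses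
        less than another \<open>z\<close>, which leaves \<open>2 * z\<close>.\<close>
      define z where "z = ?w / (16 * k)"
      have z: "?w / (2 * k) = 8 * z" "?w / (32 * k) = z / 2" "?w / (8 * k) = 2 * z" "?w / (16 * k) = z"
        unfolding z_def using k by (auto simp: field_simps)
      have "real_of_int (vcost f v (f v)) - vcost f0 v (f v) \<le> ?m" using a by linarith
      moreover have "real (card {u. u < n \<and> f u = L}) - 1 \<le> vcost f v (f v) + vcost f v g" using b by linarith
      ultimately have "2 * z \<le> vcost f0 v (f0 v)"
        using c rd' c' gw' gw False unfolding z fv by linarith
      moreover have "min (real (card (moved W f0 f'))) (?w / (16 * k)) * (2 * z) \<le> (min ?m (?w / (16 * k)) + 1) * (2 * z)"
        unfolding cM by (rule mult_right_mono) (auto simp: z_def)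
      ultimately show ?thesis unfolding s z using old unfolding z by (simp add: algebra_simps)
    qed
  qed
  ultimately show ?thesis unfolding move_inv_def by blast
qed

text \<open>The increase is at most \<open>2 * \<gamma>\<close> times the number of moves times
  \<open>card W\<close>. That product is at most \<open>8 * k\<close> times the old cost up to the
  cap of \<open>move_inv\<close>, and at most \<open>128 * k\<^sup>2\<close> times it beyond, where
  128 is 16 times 8 and the number of moves is bounded by \<open>card W\<close>.\<close>

lemma move_inv_cost:
  fixes \<gamma> :: real
  assumes R: "move_inv k \<gamma> W f0 f" and k: "k \<ge> 1" and \<gamma>: "0 < \<gamma>" and W: "W \<subseteq> {..<n}"
  shows "cost f \<le> cost f0 * (1 + 256 * k\<^sup>2 * \<gamma>)"
proof -
  let ?M = "moved W f0 f" and ?w = "real (card W)"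
  let ?m = "real (card ?M)"
  have c0: "0 \<le> cost f0" unfolding cost_def by (intro sum_nonneg vcost_nonneg)
  have c1: "real_of_int (cost f) \<le> cost f0 + 2 * ?m * \<lfloor>\<gamma> * ?w\<rfloor>"
  proof -
    have "real_of_int (cost f) \<le> real_of_int (cost f0 + 2 * int (card ?M) * \<lfloor>\<gamma> * ?w\<rfloor>)"
      using R unfolding move_inv_def of_int_le_iff by blast
    then show ?thesis by simp
  qed
  show ?thesis
  proof (cases "1 \<le> \<gamma> * ?w")
    case False
    \<comment> \<open>The error is below 1 and costs are integers, so the moves have not increased
      the cost.\<close>
    then have "\<lfloor>\<gamma> * ?w\<rfloor> = 0" using \<gamma> by (auto simp: floor_eq_iff)
    moreover have "0 \<le> cost f0 * (256 * (real k)\<^sup>2 * \<gamma>)" using c0 \<gamma> by auto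
    ultimately show ?thesis using c1 by (simp add: algebra_simps)
  next
    case True
    have "real_of_int (\<Sum>v\<in>?M. vcost f0 v (f0 v)) \<le> cost f0"
      unfolding cost_def of_int_le_iff by (rule sum_mono2) (use W vcost_nonneg in \<open>auto simp: moved_def\<close>)
    then have ch: "min ?m (?w / (16 * k)) * (?w / (8 * k)) \<le> cost f0"
      using R True by (auto simp: move_inv_def)
    have mw: "?m \<le> ?w" unfolding moved_def using W by (auto intro!: card_mono intro: finite_subset)
    have k2: "real k \<le> real k ^ 2" using k by (simp add: self_le_power)
    have "?m * ?w \<le> 128 * (real k)\<^sup>2 * cost f0"
    proof (cases "?m \<le> ?w / (16 * k)")
      case True
      then have "?m * ?w \<le> 8 * real k * cost f0" using ch k by (simp add: min_def field_simps)
      also have "\<dots> \<le> 128 * (real k)\<^sup>2 * cost f0"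
      proof (rule mult_right_mono)
        show "8 * real k \<le> 128 * (real k)\<^sup>2" using k2 by linarith
      qed (use c0 in simp)
      finally show ?thesis .
    next
      case False
      then have "?w * ?w \<le> 128 * (real k)\<^sup>2 * cost f0"
        using ch k by (simp add: min_def field_simps power2_eq_square)
      moreover have "?m * ?w \<le> ?w * ?w" using mw by (intro mult_right_mono) auto
      ultimately show ?thesis by linarith
    qed
    then have "\<gamma> * (?m * ?w) \<le> \<gamma> * (128 * (real k)\<^sup>2 * cost f0)" using \<gamma> by (intro mult_left_mono) auto
    moreover have "?m * \<lfloor>\<gamma> * ?w\<rfloor> \<le> ?m * (\<gamma> * ?w)" by (intro mult_left_mono) auto
    ultimately show ?thesis using c1 by (simp add: algebra_simps)
  qed
qed

end

section \<open>Concentration\<close>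

text \<open>Independence of the entries lets the exponential moment factorise along the list. Each
  factor is Hoeffding's lemma on an interval of width 2, which turns the 8 in that lemma into
  2.\<close>

lemma nn_integral_exp_sum_replicate_pmf:
  fixes h :: "'a \<Rightarrow> real"
  assumes h: "\<And>x. x \<in> set_pmf p \<Longrightarrow> \<bar>h x\<bar> \<le> 1" and l: "l > 0"
  shows "(\<integral>\<^sup>+xs. ennreal (exp (l * (sum_list (map h xs) - real S * measure_pmf.expectation p h))) \<partial>replicate_pmf S p)
    \<le> ennreal (exp (real S * (l\<^sup>2 / 2)))"
proof (induction S)
  case 0 then show ?case by simp
next
  case (Suc S)
  define \<mu> where "\<mu> = measure_pmf.expectation p h"
  interpret X: interval_bounded_random_variable "measure_pmf p" h "-1" 1
    by unfold_locales (use h in \<open>auto simp: AE_measure_pmf_iff abs_le_iff minus_le_iff\<close>)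
  have H: "(\<integral>\<^sup>+x. ennreal (exp (l * (h x - \<mu>))) \<partial>measure_pmf p) \<le> ennreal (exp (l\<^sup>2 / 2))"
    using X.Hoeffdings_lemma_nn_integral[OF l] by (simp add: \<mu>_def power2_eq_square)
  let ?E = "\<lambda>xs. ennreal (exp (l * (sum_list (map h xs) - real S * \<mu>)))"
  have "(\<integral>\<^sup>+xs. ennreal (exp (l * (sum_list (map h xs) - real (Suc S) * \<mu>))) \<partial>replicate_pmf (Suc S) p)
    = (\<integral>\<^sup>+x. (\<integral>\<^sup>+xs. ennreal (exp (l * (h x - \<mu>))) * ?E xs \<partial>replicate_pmf S p) \<partial>measure_pmf p)"
    by (simp add: nn_integral_return ennreal_mult[symmetric] exp_add[symmetric] algebra_simps)
  also have "\<dots> = (\<integral>\<^sup>+x. ennreal (exp (l * (h x - \<mu>))) \<partial>measure_pmf p) * (\<integral>\<^sup>+xs. ?E xs \<partial>replicate_pmf S p)"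
    by (simp add: nn_integral_cmult nn_integral_multc)
  also have "\<dots> \<le> ennreal (exp (l\<^sup>2 / 2)) * ennreal (exp (real S * (l\<^sup>2 / 2)))"
    by (intro mult_mono H) (use Suc.IH in \<open>simp_all add: \<mu>_def\<close>)
  also have "\<dots> = ennreal (exp (real (Suc S) * (l\<^sup>2 / 2)))"
    by (simp add: ennreal_mult[symmetric] exp_add[symmetric] algebra_simps)
  finally show ?case by (simp add: \<mu>_def)
qed

text \<open>Markov's inequality for the exponential moment, with the exponent \<open>l = t\<close>
  that minimises \<open>l\<^sup>2 / 2 - l * t\<close>.\<close>

lemma replicate_pmf_upper_tail:
  fixes h :: "'a \<Rightarrow> real"
  assumes h: "\<And>x. x \<in> set_pmf p \<Longrightarrow> \<bar>h x\<bar> \<le> 1" and t: "t > 0"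
  shows "measure_pmf.prob (replicate_pmf S p) {xs. real S * (measure_pmf.expectation p h + t) \<le> sum_list (map h xs)}
    \<le> exp (- real S * t\<^sup>2 / 2)"
proof -
  define \<mu> where "\<mu> = measure_pmf.expectation p h"
  define u where "u xs = ennreal (exp (t * (sum_list (map h xs) - real S * \<mu>)))" for xs
  have "emeasure (replicate_pmf S p) {xs. real S * (\<mu> + t) \<le> sum_list (map h xs)} \<le>
    emeasure (replicate_pmf S p) {xs\<in>UNIV. 1 \<le> ennreal (exp (- real S * t\<^sup>2)) * u xs}"
  proof (rule emeasure_mono)
    show "{xs. real S * (\<mu> + t) \<le> sum_list (map h xs)} \<subseteq> {xs\<in>UNIV. 1 \<le> ennreal (exp (- real S * t\<^sup>2)) * u xs}"
    proof
      fix xs assume "xs \<in> {xs. real S * (\<mu> + t) \<le> sum_list (map h xs)}"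
      then have *: "real S * (\<mu> + t) \<le> sum_list (map h xs)" by simp
      have "ennreal (exp (- real S * t\<^sup>2)) * u xs = ennreal (exp (t * (sum_list (map h xs) - real S * \<mu> - real S * t)))"
        by (simp add: u_def ennreal_mult[symmetric] exp_add[symmetric] algebra_simps power2_eq_square)
      also have "\<dots> \<ge> ennreal (exp 0)"
      proof (rule ennreal_leI)
        have "0 \<le> t * (sum_list (map h xs) - real S * \<mu> - real S * t)"
          by (rule mult_nonneg_nonneg) (use * t in \<open>auto simp: algebra_simps\<close>)
        then show "exp 0 \<le> exp (t * (sum_list (map h xs) - real S * \<mu> - real S * t))" by simp
      qed
      finally show "xs \<in> {xs\<in>UNIV. 1 \<le> ennreal (exp (- real S * t\<^sup>2)) * u xs}" by simp
    qed
  qed simp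
  also have "\<dots> \<le> ennreal (exp (- real S * t\<^sup>2)) * (\<integral>\<^sup>+xs. u xs * indicator UNIV xs \<partial>replicate_pmf S p)"
    by (rule nn_integral_Markov_inequality) auto
  also have "\<dots> \<le> ennreal (exp (- real S * t\<^sup>2)) * ennreal (exp (real S * (t\<^sup>2 / 2)))"
    using nn_integral_exp_sum_replicate_pmf[OF h t, where S = S] by (intro mult_left_mono) (auto simp: u_def \<mu>_def)
  also have "\<dots> = ennreal (exp (- real S * t\<^sup>2 / 2))"
    by (simp add: ennreal_mult[symmetric] exp_add[symmetric] algebra_simps)
  finally show ?thesis by (simp add: \<mu>_def measure_pmf.emeasure_eq_measure)
qed

lemma replicate_pmf_tail:
  fixes h :: "'a \<Rightarrow> real"
  assumes h: "\<And>x. x \<in> set_pmf p \<Longrightarrow> \<bar>h x\<bar> \<le> 1" and t: "t > 0" and S: "S > 0"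
  shows "measure_pmf.prob (replicate_pmf S p)
     {xs. \<not> \<bar>sum_list (map h xs) / real S - measure_pmf.expectation p h\<bar> \<le> t}
    \<le> 2 * exp (- real S * t\<^sup>2 / 2)"
proof -
  define \<mu> where "\<mu> = measure_pmf.expectation p h"
  let ?A = "{xs. real S * (\<mu> + t) \<le> sum_list (map h xs)}"
  let ?B = "{xs. real S * (measure_pmf.expectation p (\<lambda>x. - h x) + t) \<le> sum_list (map (\<lambda>x. - h x) xs)}"
  have neg: "sum_list (map (\<lambda>x. - h x) xs) = - sum_list (map h xs)" for xs
    by (induction xs) auto
  have "{xs. \<not> \<bar>sum_list (map h xs) / real S - \<mu>\<bar> \<le> t} \<subseteq> ?A \<union> ?B"
  proof
    fix xs assume "xs \<in> {xs. \<not> \<bar>sum_list (map h xs) / real S - \<mu>\<bar> \<le> t}"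
    then have "\<mu> + t \<le> sum_list (map h xs) / real S \<or> sum_list (map h xs) / real S \<le> \<mu> - t" by auto
    then have "(\<mu> + t) * real S \<le> sum_list (map h xs) \<or> sum_list (map h xs) \<le> (\<mu> - t) * real S"
      using S by (simp only: pos_le_divide_eq pos_divide_le_eq of_nat_0_less_iff)
    then show "xs \<in> ?A \<union> ?B"
      by (auto simp: neg \<mu>_def[symmetric] algebra_simps)
  qed
  then have "measure_pmf.prob (replicate_pmf S p) {xs. \<not> \<bar>sum_list (map h xs) / real S - \<mu>\<bar> \<le> t}
    \<le> measure_pmf.prob (replicate_pmf S p) (?A \<union> ?B)"
    by (intro measure_pmf.finite_measure_mono) auto
  also have "\<dots> \<le> measure_pmf.prob (replicate_pmf S p) ?A + measure_pmf.prob (replicate_pmf S p) ?B"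
    by (rule measure_Un_le) auto
  also have "\<dots> \<le> exp (- real S * t\<^sup>2 / 2) + exp (- real S * t\<^sup>2 / 2)"
    unfolding \<mu>_def by (intro add_mono replicate_pmf_upper_tail) (use h t in auto)
  finally show ?thesis by (simp add: \<mu>_def)
qed

text \<open>The tests \<open>h j\<close> are fixed before the draw, so a single sample serves all of
  them.\<close>

lemma replicate_pmf_of_set_union_tail:
  fixes h :: "'b \<Rightarrow> 'a \<Rightarrow> real"
  assumes W: "finite W" "W \<noteq> {}" and J: "finite J"
    and h: "\<And>j x. j \<in> J \<Longrightarrow> x \<in> W \<Longrightarrow> \<bar>h j x\<bar> \<le> 1" and t: "t > 0" and S: "S > 0"
  shows "measure_pmf.prob (replicate_pmf S (pmf_of_set W))
     {us. \<not> (\<forall>j\<in>J. \<bar>sum_list (map (h j) us) / real S - (\<Sum>u\<in>W. h j u) / real (card W)\<bar> \<le> t)}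
    \<le> real (card J) * (2 * exp (- real S * t\<^sup>2 / 2))"
proof -
  let ?B = "\<lambda>j. {us. \<not> \<bar>sum_list (map (h j) us) / real S - (\<Sum>u\<in>W. h j u) / real (card W)\<bar> \<le> t}"
  have "{us. \<not> (\<forall>j\<in>J. \<bar>sum_list (map (h j) us) / real S - (\<Sum>u\<in>W. h j u) / real (card W)\<bar> \<le> t)} = (\<Union>j\<in>J. ?B j)"
    by auto
  also have "measure_pmf.prob (replicate_pmf S (pmf_of_set W)) \<dots> \<le>
    (\<Sum>j\<in>J. measure_pmf.prob (replicate_pmf S (pmf_of_set W)) (?B j))"
    by (rule measure_UNION_le[OF J]) auto
  also have "\<dots> \<le> (\<Sum>j\<in>J. 2 * exp (- real S * t\<^sup>2 / 2))"
  proof (rule sum_mono)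
    fix j assume j: "j \<in> J"
    have "measure_pmf.expectation (pmf_of_set W) (h j) = (\<Sum>u\<in>W. h j u) / real (card W)"
      by (rule integral_pmf_of_set) (use W in auto)
    then show "measure_pmf.prob (replicate_pmf S (pmf_of_set W)) (?B j) \<le> 2 * exp (- real S * t\<^sup>2 / 2)"
      using replicate_pmf_tail[of "pmf_of_set W" "h j" t S] h[OF j] W t S by auto
  qed
  finally show ?thesis by simp
qed

section \<open>Namings of the clusters\<close>

locale clustering =
  fixes n k :: nat and P :: "nat set set"
  assumes part: "partition_on {..<n} P" and card_P: "card P \<le> k" and k1: "k \<ge> 1"
begin

definition same :: "nat \<Rightarrow> nat \<Rightarrow> bool" where
  "same u v \<longleftrightarrow> (\<exists>A\<in>P. u \<in> A \<and> v \<in> A)"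

text \<open>Extensional functions are used so that a naming is determined by the vertices and the
  namings can be counted.\<close>

definition labelings :: "(nat \<Rightarrow> nat) set" where
  "labelings = {c \<in> {..<n} \<rightarrow>\<^sub>E {..<k}. \<forall>u<n. \<forall>v<n. c u = c v \<longleftrightarrow> same u v}"

lemma finite_P: "finite P"
  using part finite_elements by blast

lemma same_refl: "u < n \<Longrightarrow> same u u"
  using part unfolding same_def partition_on_def by blast

lemma block_unique: "A \<in> P \<Longrightarrow> B \<in> P \<Longrightarrow> u \<in> A \<Longrightarrow> u \<in> B \<Longrightarrow> A = B"
  using part unfolding partition_on_def disjoint_def by blast

lemma same_sym: "same u v \<Longrightarrow> same v u"
  unfolding same_def by blast

lemma finite_labelings: "finite labelings"
  unfolding labelings_def by (rule finite_subset[of _ "{..<n} \<rightarrow>\<^sub>E {..<k}"]) (auto intro: finite_PiE)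

lemma labelings_lt: "c \<in> labelings \<Longrightarrow> u < n \<Longrightarrow> c u < k"
  by (auto simp: labelings_def)

lemma labelings_same: "c \<in> labelings \<Longrightarrow> u < n \<Longrightarrow> v < n \<Longrightarrow> c u = c v \<longleftrightarrow> same u v"
  unfolding labelings_def by blast

lemma labelings_outside: "c \<in> labelings \<Longrightarrow> \<not> u < n \<Longrightarrow> c u = undefined"
  unfolding labelings_def by (auto intro: PiE_arb)

text \<open>A naming is determined by the slots of one chosen vertex per cluster. The logarithm of
  the bound, k log k, is what the unknown order of discovery costs in the union bound.\<close>

lemma card_labelings: "card labelings \<le> k ^ k"
proof -
  define F where "F c = (\<lambda>A\<in>P. c (SOME a. a \<in> A))" for c :: "nat \<Rightarrow> nat"
  have A: "(SOME a. a \<in> A) \<in> A" "A \<subseteq> {..<n}" if "A \<in> P" for A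
    using part that by (auto simp: partition_on_def some_in_eq)
  have "inj_on F labelings"
  proof (rule inj_onI)
    fix c c' assume c: "c \<in> labelings" "c' \<in> labelings" "F c = F c'"
    show "c = c'"
    proof
      fix u show "c u = c' u"
      proof (cases "u < n")
        case True
        then obtain A where A': "A \<in> P" "u \<in> A" using part by (auto simp: partition_on_def)
        let ?a = "SOME a. a \<in> A"
        have "same u ?a" "?a < n" using A' A by (auto simp: same_def)
        then have "c u = c ?a" "c' u = c' ?a"
          using labelings_same[OF c(1) True] labelings_same[OF c(2) True] by blast+
        moreover have "c ?a = c' ?a" using fun_cong[OF c(3), of A] A' by (simp add: F_def)
        ultimately show ?thesis by simp
      next
        case False
        show ?thesis using labelings_outside[OF c(1) False] labelings_outside[OF c(2) False] by simp
      qed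
    qed
  qed
  moreover have "F ` labelings \<subseteq> P \<rightarrow>\<^sub>E {..<k}"
  proof
    fix g assume "g \<in> F ` labelings"
    then obtain c where c: "c \<in> labelings" "g = F c" by blast
    show "g \<in> P \<rightarrow>\<^sub>E {..<k}" unfolding c(2) F_def
    proof (rule restrict_PiE_iff[THEN iffD2], rule ballI)
      fix B assume "B \<in> P"
      then have "(SOME a. a \<in> B) < n" using A[of B] by blast
      then show "c (SOME a. a \<in> B) \<in> {..<k}" using labelings_lt[OF c(1)] by simp
    qed
  qed
  ultimately have "card labelings \<le> card (P \<rightarrow>\<^sub>E {..<k})"
    by (intro card_inj_on_le[of F]) (auto intro: finite_PiE finite_P)
  also have "\<dots> = k ^ card P" by (simp add: card_PiE finite_P)
  also have "\<dots> \<le> k ^ k" using card_P k1 by (simp add: power_increasing)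
  finally show ?thesis .
qed

text \<open>Clusters without a representative receive distinct slots from \<open>{d..<k}\<close>;
  there is room because there are at most \<open>k\<close> clusters. The first claim limits the
  number of discoveries, the second ensures that statements about all consistent namings are not
  vacuous.\<close>

lemma labeling_exists:
  assumes r: "\<And>i. i < d \<Longrightarrow> r i < n" "\<And>i j. i < d \<Longrightarrow> j < d \<Longrightarrow> i \<noteq> j \<Longrightarrow> \<not> same (r i) (r j)"
  shows "d \<le> card P" "\<exists>c\<in>labelings. \<forall>i<d. c (r i) = i"
proof -
  define cl where "cl u = (THE A. A \<in> P \<and> u \<in> A)" for u
  have cl_eq: "cl u = A" if "A \<in> P" "u \<in> A" for u A
    unfolding cl_def by (rule the_equality) (use that block_unique in blast)+
  have cl: "cl u \<in> P \<and> u \<in> cl u" if "u < n" for u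
  proof -
    obtain A where "A \<in> P" "u \<in> A" using \<open>u < n\<close> part by (auto simp: partition_on_def)
    then show ?thesis using cl_eq by simp
  qed
  have same_cl: "same u v \<longleftrightarrow> cl u = cl v" if "u < n" "v < n" for u v
  proof
    assume "same u v"
    then show "cl u = cl v" using cl_eq by (auto simp: same_def)
  next
    assume "cl u = cl v"
    then show "same u v" using cl[OF that(1)] cl[OF that(2)] by (auto simp: same_def)
  qed
  have inj: "inj_on (\<lambda>i. cl (r i)) {..<d}"
  proof (rule inj_onI)
    fix i j assume "i \<in> {..<d}" "j \<in> {..<d}" "cl (r i) = cl (r j)"
    then show "i = j" using r same_cl[of "r i" "r j"] by blast
  qed
  have sub: "(\<lambda>i. cl (r i)) ` {..<d} \<subseteq> P" using cl r by auto
  have cd: "card ((\<lambda>i. cl (r i)) ` {..<d}) = d" using inj by (simp add: card_image)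
  show d: "d \<le> card P" using card_mono[OF finite_P sub] cd by simp
  let ?R = "P - (\<lambda>i. cl (r i)) ` {..<d}"
  have "card ?R \<le> card {d..<k}" using card_Diff_subset[OF _ sub] cd card_P by simp
  then obtain g where g: "g ` ?R \<subseteq> {d..<k}" "inj_on g ?R"
    using card_le_inj[of ?R "{d..<k}"] finite_P by auto
  define h where "h A = (if A \<in> ?R then g A else the_inv_into {..<d} (\<lambda>i. cl (r i)) A)" for A
  have h1: "h (cl (r i)) = i" if "i < d" for i
    using that the_inv_into_f_f[OF inj, of i] by (auto simp: h_def)
  have h_inj: "inj_on h P"
  proof (rule inj_onI)
    fix A B assume AB: "A \<in> P" "B \<in> P" "h A = h B"
    have *: "A \<in> ?R \<and> h A \<ge> d \<or> (\<exists>i<d. A = cl (r i) \<and> h A = i)" if "A \<in> P" for A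
      using that g h1 by (cases "A \<in> ?R") (auto simp: h_def image_subset_iff)
    show "A = B"
    proof (cases "A \<in> ?R \<and> B \<in> ?R")
      case True then show ?thesis using AB g by (auto simp: h_def inj_on_def)
    next
      case False then show ?thesis using *[OF AB(1)] *[OF AB(2)] AB(3) h1 by fastforce
    qed
  qed
  have h_lt: "h A < k" if "A \<in> P" for A
  proof (cases "A \<in> ?R")
    case True then show ?thesis using g by (auto simp: h_def image_subset_iff)
  next
    case False
    then obtain i where "i < d" "A = cl (r i)" using \<open>A \<in> P\<close> by auto
    then show ?thesis using h1 d card_P by auto
  qed
  define c where "c = (\<lambda>u\<in>{..<n}. h (cl u))"
  have "c \<in> labelings"
    unfolding labelings_def using h_lt cl same_cl by (auto simp: c_def inj_on_eq_iff[OF h_inj])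
  moreover have "\<forall>i<d. c (r i) = i" using h1 r by (auto simp: c_def)
  ultimately show "\<exists>c\<in>labelings. \<forall>i<d. c (r i) = i" by blast
qed

end

section \<open>The algorithm\<close>

lemma set_reg_simps [simp]:
  "reg (set_reg r x s) q = (if q = r then x else reg s q)"
  "mem (set_reg r x s) = mem s"
  "queries (set_reg r x s) = queries s"
  by (simp_all add: set_reg_def)

text \<open>
  Register conventions: \<open>0, \<dots>, 3\<close> hold \<open>n\<close>, \<open>k\<close>, the number \<open>S\<close> of samples, and the bound \<open>m\<close> on the number
  of batches; \<open>4, \<dots>, 9\<close> the base addresses \<open>NK\<close> (undecided vertices), \<open>SB\<close> (samples), \<open>LB\<close> (slots of
  the samples), \<open>SC\<close> (scores), \<open>BB\<close> (initial scores, 0 for closed slots), \<open>RB\<close> (representatives of the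
  clusters); \<open>10\<close> the number of representatives, \<open>11\<close> the number of undecided vertices, \<open>12\<close> the slot \<open>L\<close>,
  \<open>13\<close> the batch size, \<open>14\<close> the position in the list, \<open>15\<close> the end of the batch, \<open>16\<close> the constant 1, \<open>17\<close> the
  current vertex, \<open>18\<close> and \<open>19\<close> the loop conditions. Registers from \<open>20\<close> on are temporary.
  The cell \<open>v + n * i\<close> holds the slot where \<open>v\<close> currently is if its cluster has slot \<open>i\<close>, so cell \<open>v\<close>
  holds the output once \<open>v\<close> is decided.
\<close>
definition for_loop :: "nat \<Rightarrow> nat \<Rightarrow> nat \<Rightarrow> instr list \<Rightarrow> instr list" where
  "for_loop r b f body = [Const r 0, Arith Less f r b] @
     [While f (body @ [Arith Plus r r 16, Arith Less f r b])]"

text \<open>The invariant \<open>I\<close> is closed under writes to the counter \<open>r\<close>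
  and the flag \<open>f\<close>, so it need not mention them; \<open>J\<close> adds their values.
  Each iteration spends 3 extra steps on the increment, the comparison and the loop test.\<close>

lemma (in ram) triple_for:
  assumes ins: "\<And>i s x. I i s \<Longrightarrow> I i (set_reg r x s)" "\<And>i s x. I i s \<Longrightarrow> I i (set_reg f x s)"
    and body: "\<And>i s. i < N \<Longrightarrow> I i s \<Longrightarrow> reg s r = i \<Longrightarrow> triple body s T (\<lambda>s'. I (Suc i) s' \<and> reg s' r = i)"
    and inv: "\<And>i s. I i s \<Longrightarrow> reg s b = N \<and> reg s 16 = 1"
    and neq: "r \<noteq> f" "r \<noteq> b" "f \<noteq> b" "r \<noteq> 16" "f \<noteq> 16"
    and N: "N < 2 ^ w"
    and I0: "I 0 s"
  shows "triple (for_loop r b f body) s (N * (T + 3) + 3) (I N)"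
proof -
  define J where "J i s \<longleftrightarrow> I i s \<and> reg s r = i \<and> reg s f = of_bool (i < N)" for i s
  \<comment> \<open>For \<open>w = 0\<close> all values are reduced to 0, but then
    \<open>N = 0\<close> and the flag has to be 0 anyway.\<close>
  have w1: "(1::nat) < 2 ^ w \<or> N = 0" using N by (cases "2 ^ w = (1::nat)") (auto simp: Suc_lessI)
  have b01: "of_bool b mod 2 ^ w = (of_bool b :: nat)" if "b \<longrightarrow> 0 < N" for b
    using w1 that by auto
  have a: "triple [Const r 0, Arith Less f r b] s 2 (J 0)"
    by (rule triple_exec) (use I0 ins inv neq b01 in \<open>auto simp: J_def\<close>)
  have step: "triple (body @ [Arith Plus r r 16, Arith Less f r b]) s (T + 2) (J (Suc i))"
    if "i < N" "J i s" for i s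
  proof (rule triple_append[OF body])
    fix s1 assume s1: "I (Suc i) s1 \<and> reg s1 r = i"
    have "Suc i mod 2 ^ w = Suc i" using that(1) N by simp
    then show "triple [Arith Plus r r 16, Arith Less f r b] s1 2 (J (Suc i))"
      by (intro triple_exec) (use s1 ins inv neq b01 in \<open>auto simp: J_def\<close>)
  qed (use that in \<open>auto simp: J_def\<close>)
  have "triple (for_loop r b f body) s (2 + ((N - 0) * Suc (T + 2) + 1)) (\<lambda>s'. \<exists>j\<le>N. J j s' \<and> reg s' f = 0)"
    unfolding for_loop_def
  proof (rule triple_append[OF a], rule triple_while[where I = J])
    show "J N s \<Longrightarrow> reg s f = 0" for s by (simp add: J_def)
  qed (use step in auto)
  then show ?thesis
    by (rule triple_mono) (auto simp: J_def algebra_simps)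
qed

lemma (in ram) triple_execI:
  assumes "loop_free is" "time_of is \<le> T" "\<And>s'. s' = exec_det is s \<Longrightarrow> R s'"
  shows "triple is s T R"
  using assms triple_exec by blast

text \<open>A vertex that belongs to none of the known clusters is first made a representative; the query then succeeds.\<close>
definition find_prog :: "instr list" where
  "find_prog = [Const 23 0, Const 26 1] @ [While 26 [
     Arith Less 27 23 10,
     Cond 27 [] [Arith Plus 28 9 23, Store 28 22, Arith Plus 10 10 16],
     Arith Plus 28 9 23, Load 29 28, SameCluster 27 22 29,
     Cond 27 [Const 26 0] [Arith Plus 23 23 16]]]"

definition locate_prog :: "instr list" where
  "locate_prog = for_loop 20 2 25 (
     [Arith Plus 21 5 20, Load 22 21] @ find_prog @
     [Arith Times 24 0 23, Arith Plus 24 24 22, Load 24 24, Arith Plus 21 6 20, Store 21 24])"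

text \<open>Assumption \<open>word\<close> leaves room for all addresses and for scores up to
  \<open>2 * S + 3\<close>, so that the reductions modulo \<open>2 ^ w\<close> can be discharged by
  \<open>mod_w\<close>.\<close>

locale algorithm = ram w pos P + correlation n pos + clustering n k P
  for w :: nat and pos :: "nat set set" and P :: "nat set set" and n k :: nat +
  fixes S m :: nat
  assumes n0: "0 < n" and S0: "0 < S" and m0: "0 < m"
    and word: "4 * (n * k + n + 2 * S + 3 * k + m + 2) \<le> 2 ^ w"
begin

definition "NK = n * k"
definition "SB = NK + n"
definition "LB = SB + S"
definition "SC = LB + S"
definition "BB = SC + k"
definition "RB = BB + k"

lemma addr_defs: "SB = NK + n" "LB = NK + n + S" "SC = NK + n + 2 * S" "BB = NK + n + 2 * S + k"
  "RB = NK + n + 2 * S + 2 * k"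
  by (simp_all add: SB_def LB_def SC_def BB_def RB_def)

lemma word': "4 * (RB + k + m + 2) \<le> 2 ^ w"
  using word by (simp add: addr_defs NK_def)

lemma of_bool_neq: "(of_bool (a < b) + of_bool (b < a) :: nat) = of_bool (a \<noteq> b)" for a b :: nat
  by auto

lemma n_le_NK: "n \<le> NK" "k \<le> NK"
  using k1 n0 by (simp_all add: NK_def)

lemma cell_lt: "u < n \<Longrightarrow> i < k \<Longrightarrow> u + n * i < NK"
proof -
  assume "u < n" "i < k"
  then have "u + n * i < n * Suc i" by simp
  also have "\<dots> \<le> n * k" using \<open>i < k\<close> by (intro mult_le_mono2) simp
  finally show ?thesis by (simp add: NK_def)
qed

lemma mod_w: "x \<le> 2 * (RB + k + m + 2) \<Longrightarrow> x mod 2 ^ w = x"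
  using word' by simp

lemma mod_of_bool: "(of_bool c :: nat) mod 2 ^ w = of_bool c"
  by (rule mod_w) simp

section \<open>Representatives, consistent namings and the search with the oracle\<close>

definition regs_ok :: "state \<Rightarrow> bool" where
  "regs_ok s \<longleftrightarrow> reg s 0 = n \<and> reg s 1 = k \<and> reg s 2 = S \<and> reg s 3 = m \<and> reg s 4 = NK \<and>
  reg s 5 = SB \<and> reg s 6 = LB \<and> reg s 7 = SC \<and> reg s 8 = BB \<and> reg s 9 = RB \<and> reg s 16 = 1"

definition reps_ok :: "state \<Rightarrow> bool" where
  "reps_ok s \<longleftrightarrow> reg s 10 \<le> k \<and> (\<forall>i<reg s 10. mem s (RB + i) < n) \<and>
  (\<forall>i<reg s 10. \<forall>j<reg s 10. i \<noteq> j \<longrightarrow> \<not> same (mem s (RB + i)) (mem s (RB + j)))"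

definition consistent :: "(nat \<Rightarrow> nat) \<Rightarrow> state \<Rightarrow> bool" where
  "consistent c s \<longleftrightarrow> c \<in> labelings \<and> (\<forall>i<reg s 10. c (mem s (RB + i)) = i)"

text \<open>Register 10 counts the representatives discovered so far; they are never changed later.\<close>
definition reps_extend :: "state \<Rightarrow> state \<Rightarrow> bool" where
  "reps_extend s s' \<longleftrightarrow> reps_ok s' \<and> reg s 10 \<le> reg s' 10 \<and> (\<forall>i<reg s 10. mem s' (RB + i) = mem s (RB + i))"

text \<open>More representatives leave fewer consistent namings. A claim about all namings
  consistent with an earlier state thus stays available for those consistent with a later
  one.\<close>

lemma reps_extend_consistent: "reps_extend s s' \<Longrightarrow> consistent c s' \<Longrightarrow> consistent c s"
  unfolding reps_extend_def consistent_def by (metis less_le_trans)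

lemma reps_extend_trans: "reps_extend s s' \<Longrightarrow> reps_extend s' s'' \<Longrightarrow> reps_extend s s''"
  by (auto simp: reps_extend_def)

lemma w0 [simp]: "0 < w"
proof (rule ccontr)
  assume "\<not> 0 < w"
  then have "(2::nat) ^ w = 1" by simp
  then show False using word' by simp
qed

text \<open>The vertex \<open>u\<close> and the representatives lie in pairwise different clusters,
  of which there are at most \<open>k\<close>.\<close>

lemma new_rep_le:
  assumes "reps_ok s" "u < n" "\<forall>i<reg s 10. \<not> same u (mem s (RB + i))"
  shows "reg s 10 < k"
proof -
  have "\<forall>i<reg s 10. \<not> same (mem s (RB + i)) u" using assms(3) same_sym by blast
  then have "Suc (reg s 10) \<le> card P"
    by (intro labeling_exists(1)[of _ "\<lambda>i. if i < reg s 10 then mem s (RB + i) else u"])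
       (use assms in \<open>auto simp: reps_ok_def less_Suc_eq\<close>)
  then show ?thesis using card_P by simp
qed

text \<open>Two phases: while register 26 is 1, exactly the first \<open>t\<close> representatives
  have been ruled out; once it is 0, register 23 is the index of the representative that shares the
  cluster of \<open>u\<close>.\<close>

definition find_inv :: "state \<Rightarrow> nat \<Rightarrow> nat \<Rightarrow> state \<Rightarrow> bool" where
  "find_inv s0 u t s \<longleftrightarrow>
  (\<forall>r<23. r \<noteq> 10 \<longrightarrow> reg s r = reg s0 r) \<and>
  (\<forall>a. a < RB \<or> RB + k \<le> a \<longrightarrow> mem s a = mem s0 a) \<and> reps_extend s0 s \<and> queries s \<le> queries s0 + t \<and>
  (reg s 26 = 1 \<and> reg s 23 = t \<and> t \<le> reg s 10 \<and> (\<forall>i<t. \<not> same u (mem s (RB + i))) \<or>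
   reg s 26 = 0 \<and> reg s 23 < reg s 10 \<and> same u (mem s (RB + reg s 23)))"

lemma find_step:
  assumes "find_inv s0 u t s" "reg s 26 \<noteq> 0" "regs_ok s0" "reg s0 22 = u" "u < n" "t < k"
  shows "triple [Arith Less 27 23 10,
     Cond 27 [] [Arith Plus 28 9 23, Store 28 22, Arith Plus 10 10 16],
     Arith Plus 28 9 23, Load 29 28, SameCluster 27 22 29,
     Cond 27 [Const 26 0] [Arith Plus 23 23 16]] s 11 (find_inv s0 u (Suc t))"
proof -
  have regs: "reg s 22 = u" "reg s 9 = RB" "reg s 16 = 1" "reg s 23 = t" "t \<le> reg s 10" "reg s 26 = 1"
    and nt: "\<forall>i<t. \<not> same u (mem s (RB + i))" and ok: "reps_ok s"
    using assms by (auto simp: find_inv_def regs_ok_def reps_extend_def)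
  have fi: "\<forall>r<23. r \<noteq> 10 \<longrightarrow> reg s r = reg s0 r"
    "\<forall>a. a < RB \<or> RB + k \<le> a \<longrightarrow> mem s a = mem s0 a" "queries s \<le> queries s0 + t"
    using assms(1) unfolding find_inv_def by blast+
  have d: "reg s 10 < k" if "t = reg s 10"
    using new_rep_le[OF ok assms(5)] nt that by simp
  have b: "(of_bool b :: nat) mod 2 ^ w = of_bool b" for b
    by (rule mod_w) simp
  have [simp]: "(RB + t) mod 2 ^ w = RB + t" "Suc t mod 2 ^ w = Suc t" "Suc 0 mod 2 ^ w = Suc 0"
    using assms(6) n_le_NK by (auto intro!: mod_w simp: addr_defs simp del: One_nat_def)
  have sd: "Suc (reg s 10) mod 2 ^ w = Suc (reg s 10)" if "t = reg s 10"
    using d[OF that] n_le_NK by (auto intro!: mod_w simp: addr_defs)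
  have su: "same u u" by (rule same_refl[OF assms(5)])
  have nt': "\<forall>i<t. \<not> same (mem s (RB + i)) u" using nt same_sym by blast
  define s' where "s' = exec_det [Arith Less 27 23 10,
     Cond 27 [] [Arith Plus 28 9 23, Store 28 22, Arith Plus 10 10 16],
     Arith Plus 28 9 23, Load 29 28, SameCluster 27 22 29,
     Cond 27 [Const 26 0] [Arith Plus 23 23 16]] s"
  have "find_inv s0 u (Suc t) s'"
    proof (cases "t = reg s 10")
      case True
      have t10: "reg s 10 = t" using True by simp
      note rr = regs(1-4,6) t10 sd[OF True, unfolded t10]
      have e: "mem s' = (mem s)(RB + t := u)" "reg s' 10 = Suc t" "reg s' 26 = 0" "reg s' 23 = t"
        "queries s' = Suc (queries s)" "\<And>r. r < 23 \<Longrightarrow> r \<noteq> 10 \<Longrightarrow> reg s' r = reg s r"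
        unfolding s'_def using rr su by (simp_all add: same_def)
      have "reps_ok s'" unfolding reps_ok_def e(1,2)
        using ok nt nt' d[OF True] t10 assms(5) by (auto simp: reps_ok_def less_Suc_eq)
      then have "reps_extend s s'" unfolding reps_extend_def e(1,2) t10 by simp
      then have "reps_extend s0 s'" using assms(1) reps_extend_trans unfolding find_inv_def by blast
      moreover have "\<forall>r<23. r \<noteq> 10 \<longrightarrow> reg s' r = reg s0 r" using fi(1) e(6) by metis
      moreover have "\<forall>a. a < RB \<or> RB + k \<le> a \<longrightarrow> mem s' a = mem s0 a"
        using fi(2) d[OF True] t10 unfolding e(1) by auto
      moreover have "queries s' \<le> queries s0 + Suc t" using fi(3) unfolding e(5) by simp
      moreover have "reg s' 23 < reg s' 10" "same u (mem s' (RB + reg s' 23))"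
        unfolding e(1,2,4) using su by simp_all
      ultimately show ?thesis unfolding find_inv_def using e(3) by blast
    next
      case False
      then have lt: "t < reg s 10" using regs by simp
      note rr = regs(1-4,6) lt
      have e: "mem s' = mem s" "reg s' 10 = reg s 10"
        "queries s' = Suc (queries s)" "\<And>r. r < 23 \<Longrightarrow> r \<noteq> 10 \<Longrightarrow> reg s' r = reg s r"
        and e': "if same u (mem s (RB + t)) then reg s' 26 = 0 \<and> reg s' 23 = t else reg s' 26 = 1 \<and> reg s' 23 = Suc t"
      proof -
        define b where "b = same u (mem s (RB + t))"
        have b: "(\<exists>A\<in>P. u \<in> A \<and> mem s (RB + t) \<in> A) = b" by (simp add: b_def same_def)
        note e = s'_def exec_det.simps set_reg_simps rr b
        show "mem s' = mem s" "reg s' 10 = reg s 10" "queries s' = Suc (queries s)"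
            "\<And>r. r < 23 \<Longrightarrow> r \<noteq> 10 \<Longrightarrow> reg s' r = reg s r"
          by (cases b; simp add: e)+
        show "if same u (mem s (RB + t)) then reg s' 26 = 0 \<and> reg s' 23 = t else reg s' 26 = 1 \<and> reg s' 23 = Suc t"
          unfolding b_def[symmetric] by (cases b; simp add: e)
      qed
      have "reps_extend s0 s'" using assms(1) unfolding find_inv_def reps_extend_def reps_ok_def e(1,2) by blast
      moreover have "\<forall>r<23. r \<noteq> 10 \<longrightarrow> reg s' r = reg s0 r" using fi(1) e(4) by metis
      moreover have "\<forall>a. a < RB \<or> RB + k \<le> a \<longrightarrow> mem s' a = mem s0 a"
        using fi(2) unfolding e(1) .
      moreover have "queries s' \<le> queries s0 + Suc t" using fi(3) unfolding e(3) by simp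
      moreover have "reg s' 26 = 1 \<and> reg s' 23 = Suc t \<and> Suc t \<le> reg s' 10 \<and> (\<forall>i<Suc t. \<not> same u (mem s' (RB + i))) \<or>
         reg s' 26 = 0 \<and> reg s' 23 < reg s' 10 \<and> same u (mem s' (RB + reg s' 23))"
      proof (cases "same u (mem s (RB + t))")
        case True
        then show ?thesis using e' lt unfolding e(1,2) by simp
      next
        case False
        then have "\<forall>i<Suc t. \<not> same u (mem s (RB + i))" using nt less_Suc_eq by blast
        with False show ?thesis using e' lt unfolding e(1,2) by simp
      qed
      ultimately show ?thesis unfolding find_inv_def by blast
    qed
  then show ?thesis by (intro triple_exec) (simp_all only: s'_def, simp_all)
qed

text \<open>After \<open>k\<close> failed comparisons \<open>u\<close> would need a further cluster,
  so the search ends within \<open>k\<close> queries. The index found is the slot of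
  \<open>u\<close> in every naming that is consistent afterwards, as \<open>u\<close> shares the
  cluster of that representative.\<close>

lemma find_ok:
  assumes "regs_ok s0" "reg s0 22 = u" "u < n" "reps_ok s0"
  shows "triple find_prog s0 (k * 12 + 3) (\<lambda>s.
    (\<forall>r<23. r \<noteq> 10 \<longrightarrow> reg s r = reg s0 r) \<and>
    (\<forall>a. a < RB \<or> RB + k \<le> a \<longrightarrow> mem s a = mem s0 a) \<and> reps_extend s0 s \<and> queries s \<le> queries s0 + k \<and>
    reg s 23 < reg s 10 \<and> (\<forall>c. consistent c s \<longrightarrow> c u = reg s 23))"
proof -
  have w1: "(1::nat) mod 2 ^ w = 1" by (rule mod_w) simp
  have a: "triple [Const 23 0, Const 26 1] s0 2 (find_inv s0 u 0)"
    by (rule triple_exec) (use assms w1 in \<open>auto simp: find_inv_def reps_extend_def reps_ok_def\<close>)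
  have "triple find_prog s0 (2 + ((k - 0) * Suc 11 + 1)) (\<lambda>s. \<exists>j\<le>k. find_inv s0 u j s \<and> reg s 26 = 0)"
    unfolding find_prog_def
  proof (rule triple_append[OF a], rule triple_while)
    show "reg s 26 = 0" if "find_inv s0 u k s" for s
    proof (rule ccontr)
      assume "reg s 26 \<noteq> 0"
      with that have *: "reg s 10 \<ge> k" "\<forall>i<k. \<not> same u (mem s (RB + i))" "reps_ok s"
        by (auto simp: find_inv_def reps_extend_def)
      then have "reg s 10 = k" by (simp add: reps_ok_def)
      with * new_rep_le[OF *(3) assms(3)] show False by simp
    qed
  qed (use find_step assms in auto)
  then show ?thesis
  proof (rule triple_mono)
    fix s assume "\<exists>j\<le>k. find_inv s0 u j s \<and> reg s 26 = 0"
    then obtain j where j: "j \<le> k" "find_inv s0 u j s" "reg s 26 = 0" by blast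
    then have sm: "reg s 23 < reg s 10" "same u (mem s (RB + reg s 23))" by (auto simp: find_inv_def)
    have "c u = reg s 23" if c: "consistent c s" for c
    proof -
      have "mem s (RB + reg s 23) < n" using j(2) sm(1) by (auto simp: find_inv_def reps_extend_def reps_ok_def)
      then have "c u = c (mem s (RB + reg s 23))"
        using c labelings_same[of c u "mem s (RB + reg s 23)"] assms(3) sm unfolding consistent_def by blast
      then show ?thesis using c sm by (auto simp: consistent_def)
    qed
    with j sm show "(\<forall>r<23. r \<noteq> 10 \<longrightarrow> reg s r = reg s0 r) \<and>
    (\<forall>a. a < RB \<or> RB + k \<le> a \<longrightarrow> mem s a = mem s0 a) \<and> reps_extend s0 s \<and> queries s \<le> queries s0 + k \<and>
    reg s 23 < reg s 10 \<and> (\<forall>c. consistent c s \<longrightarrow> c u = reg s 23)"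
      by (auto simp: find_inv_def)
  qed simp
qed

abbreviation "cell s u i \<equiv> mem s (u + n * i)"

text \<open>The index of the cluster selects a cell of the sampled vertex, which translates the
  optimal slot into the current one. The stored value is one number although the naming is not
  fixed: consistent namings agree on vertices of discovered clusters.\<close>

definition locate_inv :: "state \<Rightarrow> nat list \<Rightarrow> nat \<Rightarrow> state \<Rightarrow> bool" where
  "locate_inv s0 us i s \<longleftrightarrow>
  (\<forall>r<20. r \<noteq> 10 \<longrightarrow> reg s r = reg s0 r) \<and>
  (\<forall>a. a < LB \<or> SC \<le> a \<and> a < RB \<or> RB + k \<le> a \<longrightarrow> mem s a = mem s0 a) \<and>
  reps_extend s0 s \<and> queries s \<le> queries s0 + i * k \<and>
  (\<forall>j<i. mem s (LB + j) < k \<and> (\<forall>c. consistent c s \<longrightarrow> mem s (LB + j) = cell s0 (us ! j) (c (us ! j))))"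

lemma locate_ok:
  assumes s0: "regs_ok s0" "reps_ok s0" and us: "length us = S" "set us \<subseteq> {..<n}" "\<forall>j<S. mem s0 (SB + j) = us ! j"
    and cells: "\<forall>u<n. \<forall>i<k. cell s0 u i < k"
  shows "triple locate_prog s0 (S * (k * 12 + 13) + 3) (locate_inv s0 us S)"
proof -
  have "triple locate_prog s0 (S * ((k * 12 + 10) + 3) + 3) (locate_inv s0 us S)"
    unfolding locate_prog_def
  proof (rule triple_for[where I = "locate_inv s0 us" and N = S])
    show "reg s 2 = S \<and> reg s 16 = 1" if "locate_inv s0 us i s" for i s
      using that s0 by (auto simp: locate_inv_def regs_ok_def)
    show "S < 2 ^ w" using word' by (simp add: addr_defs)
    show "locate_inv s0 us 0 s0" using s0 by (auto simp: locate_inv_def reps_extend_def)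
    fix i s assume i: "i < S" and inv: "locate_inv s0 us i s" and r20: "reg s 20 = i"
    let ?u = "us ! i"
    have u: "?u < n" using us i nth_mem by blast
    have cs: "regs_ok s" using inv s0 by (auto simp: locate_inv_def regs_ok_def)
    have [simp]: "(SB + i) mod 2 ^ w = SB + i" "(LB + i) mod 2 ^ w = LB + i"
      using i by (auto intro!: mod_w simp: addr_defs)
    have memu: "mem s (SB + i) = ?u" using inv us i by (auto simp: locate_inv_def LB_def)
    have a: "triple [Arith Plus 21 5 20, Load 22 21] s 2 (\<lambda>s1. s1 = set_reg 22 ?u (set_reg 21 (SB + i) s))"
      by (rule triple_exec) (use cs r20 memu in \<open>auto simp: regs_ok_def\<close>)
    let ?s1 = "set_reg 22 ?u (set_reg 21 (SB + i) s)"
    have b: "triple find_prog ?s1 (k * 12 + 3) (\<lambda>s2.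
      (\<forall>r<23. r \<noteq> 10 \<longrightarrow> reg s2 r = reg ?s1 r) \<and>
      (\<forall>a. a < RB \<or> RB + k \<le> a \<longrightarrow> mem s2 a = mem ?s1 a) \<and> reps_extend ?s1 s2 \<and> queries s2 \<le> queries ?s1 + k \<and>
      reg s2 23 < reg s2 10 \<and> (\<forall>c. consistent c s2 \<longrightarrow> c ?u = reg s2 23))"
      by (rule find_ok) (use cs u inv in \<open>auto simp: regs_ok_def locate_inv_def reps_extend_def reps_ok_def\<close>)
    show "triple ([Arith Plus 21 5 20, Load 22 21] @ find_prog @
     [Arith Times 24 0 23, Arith Plus 24 24 22, Load 24 24, Arith Plus 21 6 20, Store 21 24]) s (k * 12 + 10)
       (\<lambda>s'. locate_inv s0 us (Suc i) s' \<and> reg s' 20 = i)"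
    proof (rule triple_mono[OF triple_append[OF a, of _ "k * 12 + 3 + 5"]])
      fix s1 assume s1: "s1 = ?s1"
      show "triple (find_prog @ [Arith Times 24 0 23, Arith Plus 24 24 22, Load 24 24, Arith Plus 21 6 20, Store 21 24]) s1 (k * 12 + 3 + 5)
       (\<lambda>s'. locate_inv s0 us (Suc i) s' \<and> reg s' 20 = i)" unfolding s1
      proof (rule triple_append[OF b])
      fix s2 assume s2: "(\<forall>r<23. r \<noteq> 10 \<longrightarrow> reg s2 r = reg ?s1 r) \<and>
      (\<forall>a. a < RB \<or> RB + k \<le> a \<longrightarrow> mem s2 a = mem ?s1 a) \<and> reps_extend ?s1 s2 \<and> queries s2 \<le> queries ?s1 + k \<and>
      reg s2 23 < reg s2 10 \<and> (\<forall>c. consistent c s2 \<longrightarrow> c ?u = reg s2 23)"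
      define x where "x = reg s2 23"
      have ext: "reps_extend s s2" using s2 by (auto simp: reps_extend_def)
      have xk: "x < k" using s2 by (auto simp: x_def reps_extend_def reps_ok_def)
      have cl: "?u + n * x < NK" by (rule cell_lt[OF u xk])
      have [simp]: "(n * x) mod 2 ^ w = n * x" "(n * x + ?u) mod 2 ^ w = ?u + n * x"
        using cl by (auto simp: add.commute intro!: mod_w simp: addr_defs)
      have regs: "reg s2 0 = n" "reg s2 22 = ?u" "reg s2 20 = i" "reg s2 6 = LB" "reg s2 23 = x"
        using s2 cs r20 by (auto simp: regs_ok_def x_def)
      have memx: "mem s2 (?u + n * x) = cell s0 ?u x"
        using s2 inv cl by (auto simp: locate_inv_def addr_defs)
      define s3 where "s3 = exec_det [Arith Times 24 0 23, Arith Plus 24 24 22, Load 24 24, Arith Plus 21 6 20, Store 21 24] s2"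
      have m3: "mem s3 = (mem s2)(LB + i := cell s0 ?u x)" "\<And>r. r \<noteq> 24 \<Longrightarrow> r \<noteq> 21 \<Longrightarrow> reg s3 r = reg s2 r"
        "queries s3 = queries s2"
        unfolding s3_def using regs memx by auto
      have LR: "LB + i < SC" using i by (simp add: addr_defs)
      have RL: "RB + q \<noteq> LB + i" for q using i by (simp add: addr_defs)
      have ext3: "reps_extend s2 s3" using s2 RL m3 by (auto simp: reps_extend_def reps_ok_def)
      have cons3: "consistent c s2" "consistent c s" if "consistent c s3" for c
        using reps_extend_consistent[OF ext3 that] reps_extend_consistent[OF ext] by auto
      show "triple [Arith Times 24 0 23, Arith Plus 24 24 22, Load 24 24, Arith Plus 21 6 20, Store 21 24] s2 5
          (\<lambda>s'. locate_inv s0 us (Suc i) s' \<and> reg s' 20 = i)"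
      proof (rule triple_exec)
        have "locate_inv s0 us (Suc i) s3"
          unfolding locate_inv_def
        proof (intro conjI allI impI)
          fix r :: nat assume "r < 20" "r \<noteq> 10"
          then show "reg s3 r = reg s0 r" using m3 s2 inv by (auto simp: locate_inv_def)
        next
          fix a assume a: "a < LB \<or> SC \<le> a \<and> a < RB \<or> RB + k \<le> a"
          then have "a \<noteq> LB + i" using LR i by (auto simp: addr_defs)
          then show "mem s3 a = mem s0 a" using m3 s2 inv a by (auto simp: locate_inv_def addr_defs)
        next
          show "reps_extend s0 s3"
            using inv reps_extend_trans[OF reps_extend_trans[OF _ ext] ext3] by (simp add: locate_inv_def)
          show "queries s3 \<le> queries s0 + Suc i * k" using m3 s2 inv by (auto simp: locate_inv_def)
        next
          fix j assume "j < Suc i"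
          show "mem s3 (LB + j) < k"
          proof (cases "j = i")
            case True
            then show ?thesis unfolding m3 using cells u xk by simp
          next
            case False
            then have "j < i" using \<open>j < Suc i\<close> by simp
            then show ?thesis unfolding m3 using s2 inv i by (auto simp: locate_inv_def addr_defs)
          qed
          fix c assume c: "consistent c s3"
          show "mem s3 (LB + j) = cell s0 (us ! j) (c (us ! j))"
          proof (cases "j = i")
            case True
            then show ?thesis unfolding m3 using s2 cons3(1)[OF c] by (simp add: x_def)
          next
            case False
            then have "j < i" using \<open>j < Suc i\<close> by simp
            then show ?thesis unfolding m3 using s2 inv i cons3[OF c] by (auto simp: locate_inv_def addr_defs)
          qed
        qed
        then show "locate_inv s0 us (Suc i) (exec_det [Arith Times 24 0 23, Arith Plus 24 24 22, Load 24 24, Arith Plus 21 6 20, Store 21 24] s2) \<and> reg (exec_det [Arith Times 24 0 23, Arith Plus 24 24 22, Load 24 24, Arith Plus 21 6 20, Store 21 24] s2) 20 = i"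
          unfolding s3_def[symmetric] using m3(2)[of 20] regs by simp
      qed auto
      qed
    qed auto
  qed (auto simp: locate_inv_def reps_extend_def reps_ok_def consistent_def)
  then show ?thesis by (rule triple_mono) auto
qed

end

section \<open>Drawing samples, and the loops for scores, maximum and update\<close>

lemma set_pmf_of_lessThan: "0 < (l::nat) \<Longrightarrow> set_pmf (pmf_of_set {..<l}) = {..<l}"
  by (rule set_pmf_of_set) auto

definition draw_body :: "instr list" where
  "draw_body = [Rand 21 11, Arith Plus 21 4 21, Load 22 21, Arith Plus 21 5 20, Store 21 22]"

definition draw_prog :: "instr list" where
  "draw_prog = for_loop 20 2 25 draw_body"

definition init_scores_prog :: "instr list" where
  "init_scores_prog = for_loop 20 1 25 [Arith Plus 21 8 20, Load 22 21, Arith Plus 21 7 20, Store 21 22]"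

definition count_prog :: "instr list" where
  "count_prog = for_loop 20 2 25 [Arith Plus 21 6 20, Load 24 21, Arith Plus 24 7 24, Load 22 24,
     Arith Plus 22 22 16, Store 24 22]"

text \<open>Scores start at \<open>S + 1\<close> on open slots, so they stay positive and the truncated subtraction is exact.\<close>
definition score_prog :: "instr list" where
  "score_prog = for_loop 20 2 25 [Arith Plus 21 5 20, Load 22 21, Arith Plus 21 6 20, Load 24 21,
     Arith Less 27 22 17, Arith Less 28 17 22, Arith Plus 27 27 28, Label 28 22 17,
     Arith Plus 24 7 24, Load 29 24, Arith Plus 29 29 28, Arith Plus 29 29 28, Arith Minus 29 29 27, Store 24 29]"

definition argmax_prog :: "instr list" where
  "argmax_prog = [Const 31 0, Const 32 0, Const 33 0] @ for_loop 20 1 25 [Arith Plus 21 7 20, Load 22 21,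
     Arith Less 23 32 22, Cond 23 [Arith Plus 31 20 33, Arith Plus 32 22 33] []]"

definition update_prog :: "instr list" where
  "update_prog = [Arith Less 34 31 12, Arith Less 35 12 31, Arith Plus 34 34 35] @
     for_loop 20 1 25 [Arith Times 21 0 20, Arith Plus 21 21 17, Load 22 21, Arith Less 27 22 12,
       Arith Less 28 12 22, Arith Plus 27 27 28, Arith Times 27 27 34, Cond 27 [] [Store 21 31]]"

context algorithm
begin

definition frame :: "state \<Rightarrow> nat set \<Rightarrow> state \<Rightarrow> bool" where
  "frame s0 A s \<longleftrightarrow> (\<forall>r<20. reg s r = reg s0 r) \<and> (\<forall>a. a \<notin> A \<longrightarrow> mem s a = mem s0 a) \<and> queries s = queries s0"

lemma frame_refl: "frame s A s" by (simp add: frame_def)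

lemma frame_trans: "frame s A s' \<Longrightarrow> frame s' B s'' \<Longrightarrow> A \<subseteq> C \<Longrightarrow> B \<subseteq> C \<Longrightarrow> frame s C s''"
  unfolding frame_def by (metis subsetD)

lemma frame_set_reg: "frame s0 A s \<Longrightarrow> 20 \<le> r \<Longrightarrow> frame s0 A (set_reg r x s)"
  by (auto simp: frame_def)

lemma frame_regs_ok: "frame s A s' \<Longrightarrow> regs_ok s \<Longrightarrow> regs_ok s'"
  by (simp add: frame_def regs_ok_def)

lemma frame_reps_ok: "frame s A s' \<Longrightarrow> A \<inter> {RB..<RB + k} = {} \<Longrightarrow> reps_ok s \<Longrightarrow> reps_ok s'"
proof -
  assume a: "frame s A s'" "A \<inter> {RB..<RB + k} = {}" "reps_ok s"
  have "mem s' (RB + i) = mem s (RB + i)" if "i < k" for i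
  proof -
    have "RB + i \<in> {RB..<RB + k}" using that by simp
    then show ?thesis using a unfolding frame_def by blast
  qed
  then show ?thesis using a by (auto simp: frame_def reps_ok_def)
qed

abbreviation "score s i \<equiv> mem s (SC + i)"
abbreviation "base s i \<equiv> mem s (BB + i)"
abbreviation "scores_region \<equiv> {SC..<BB}"

definition todo :: "state \<Rightarrow> nat list" where
  "todo s = map (\<lambda>p. mem s (NK + p)) [0..<reg s 11]"

definition samples :: "state \<Rightarrow> nat list" where
  "samples s = map (\<lambda>j. mem s (SB + j)) [0..<S]"

definition draw_inv :: "state \<Rightarrow> nat \<Rightarrow> state \<Rightarrow> bool" where
  "draw_inv s0 i s \<longleftrightarrow> frame s0 {SB..<LB} s \<and> (\<forall>j<i. mem s (SB + j) \<in> set (todo s0)) \<and> reg s 20 = i \<and> reg s 25 = of_bool (i < S)"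

text \<open>Of the final distribution only the image under \<open>samples\<close> is described: the
  entries drawn so far are extended by independent uniform ones. A uniform position gives a uniform
  undecided vertex because the list has no repetitions.\<close>

lemma draw_loop:
  assumes s0: "regs_ok s0" "0 < reg s0 11" "reg s0 11 \<le> n" "distinct (todo s0)"
    and inv: "draw_inv s0 i s" "i \<le> S"
  shows "\<exists>D. terminates ([While 25 (draw_body @ [Arith Plus 20 20 16, Arith Less 25 20 2])], s) ((S - i) * 8 + 1) D \<and>
    (\<forall>s'\<in>set_pmf D. draw_inv s0 S s') \<and>
    map_pmf samples D = map_pmf (\<lambda>xs. map (\<lambda>j. mem s (SB + j)) [0..<i] @ xs) (replicate_pmf (S - i) (pmf_of_set (set (todo s0))))"
  using inv
proof (induction "S - i" arbitrary: i s)
  case 0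
  have "i = S" using 0 by simp
  moreover have "reg s 25 = 0" using 0(2) unfolding draw_inv_def \<open>i = S\<close> by simp
  moreover note calculation
  then show ?case
    using 0 terminates_step[of "([While 25 (draw_body @ [Arith Plus 20 20 16, Arith Less 25 20 2])], s)" 0 "\<lambda>_. return_pmf s"]
      terminates_Nil[of s 0]
    by (intro exI[of _ "return_pmf s"]) (auto simp: bind_return_pmf samples_def)
next
  case (Suc r)
  let ?loop = "[While 25 (draw_body @ [Arith Plus 20 20 16, Arith Less 25 20 2])]"
  let ?tail = "[Arith Plus 21 4 21, Load 22 21, Arith Plus 21 5 20, Store 21 22, Arith Plus 20 20 16, Arith Less 25 20 2]"
  define len where "len = reg s0 11"
  define U where "U = pmf_of_set {..<len}"
  have iS: "i < S" using Suc by simp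
  have inv: "frame s0 {SB..<LB} s" "\<forall>j<i. mem s (SB + j) \<in> set (todo s0)" "reg s 20 = i" "reg s 25 = 1"
    using Suc.prems iS by (auto simp: draw_inv_def)
  have regs: "reg s 4 = NK" "reg s 5 = SB" "reg s 11 = len" "reg s 16 = 1" "reg s 2 = S" "0 < len" "len \<le> n"
    using s0 inv(1) by (auto simp: frame_def regs_ok_def len_def)
  have Uset: "set_pmf U = {..<len}" unfolding U_def using regs by (intro set_pmf_of_lessThan)
  define st where "st x = exec_det ?tail (set_reg 21 x s)" for x
  have st: "draw_inv s0 (Suc i) (st x)" "map (\<lambda>j. mem (st x) (SB + j)) [0..<Suc i] = map (\<lambda>j. mem s (SB + j)) [0..<i] @ [todo s0 ! x]"
    if x: "x < len" for x
  proof -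
    have mods: "(NK + x) mod 2 ^ w = NK + x" "(SB + i) mod 2 ^ w = SB + i" "Suc i mod 2 ^ w = Suc i"
      "(of_bool (Suc i < S) :: nat) mod 2 ^ w = of_bool (Suc i < S)"
      using x regs(6,7) iS by (auto intro!: mod_w simp: addr_defs)
    have memx: "mem s (NK + x) = todo s0 ! x"
      using inv(1) x regs by (auto simp: frame_def todo_def len_def SB_def)
    have e: "mem (st x) = (mem s)(SB + i := todo s0 ! x)" "reg (st x) 20 = Suc i" "reg (st x) 25 = of_bool (Suc i < S)"
      "queries (st x) = queries s" "\<And>r. r < 20 \<Longrightarrow> reg (st x) r = reg s r"
      unfolding st_def using regs inv(3) mods memx by (simp_all del: of_bool_eq_iff of_bool_eq_0_iff)
    have LB: "LB = SB + S" by (simp add: LB_def)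
    have wlx: "todo s0 ! x \<in> set (todo s0)" using x by (simp add: todo_def len_def)
    show "draw_inv s0 (Suc i) (st x)"
      using inv e(2-5) iS wlx unfolding draw_inv_def frame_def e(1) LB by (auto simp: less_Suc_eq)
    show "map (\<lambda>j. mem (st x) (SB + j)) [0..<Suc i] = map (\<lambda>j. mem s (SB + j)) [0..<i] @ [todo s0 ! x]"
      unfolding e(1) by simp
  qed
  have tail: "terminates (?tail, set_reg 21 x s) 6 (return_pmf (st x))" for x
  proof -
    have "triple ?tail (set_reg 21 x s) 6 (\<lambda>s'. s' = st x)" by (rule triple_execI) (simp_all add: st_def)
    then show ?thesis by (auto simp: triple_def)
  qed
  have body: "terminates (draw_body @ [Arith Plus 20 20 16, Arith Less 25 20 2], s) 7 (map_pmf st U)"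
  proof -
    have "step w pos P (draw_body @ [Arith Plus 20 20 16, Arith Less 25 20 2], s) = map_pmf (\<lambda>x. (?tail, set_reg 21 x s)) U"
      using regs by (simp add: draw_body_def U_def)
    moreover have "terminates (draw_body @ [Arith Plus 20 20 16, Arith Less 25 20 2], s) (Suc 6)
      (bind_pmf (step w pos P (draw_body @ [Arith Plus 20 20 16, Arith Less 25 20 2], s)) (\<lambda>c. return_pmf (st (reg (snd c) 21))))"
      by (rule terminates_step) (use calculation tail in auto)
    moreover have "bind_pmf (map_pmf (\<lambda>x. (?tail, set_reg 21 x s)) U) (\<lambda>c. return_pmf (st (reg (snd c) 21))) = map_pmf st U"
      by (simp add: map_pmf_def bind_assoc_pmf bind_return_pmf)
    ultimately show ?thesis by simp
  qed
  have "\<forall>x. \<exists>D. x < len \<longrightarrow> terminates (?loop, st x) (r * 8 + 1) D \<and>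
    (\<forall>s'\<in>set_pmf D. draw_inv s0 S s') \<and>
    map_pmf samples D = map_pmf (\<lambda>xs. (map (\<lambda>j. mem s (SB + j)) [0..<i] @ [todo s0 ! x]) @ xs) (replicate_pmf r (pmf_of_set (set (todo s0))))"
  proof (intro allI)
    fix x
    show "\<exists>D. x < len \<longrightarrow> terminates (?loop, st x) (r * 8 + 1) D \<and>
    (\<forall>s'\<in>set_pmf D. draw_inv s0 S s') \<and>
    map_pmf samples D = map_pmf (\<lambda>xs. (map (\<lambda>j. mem s (SB + j)) [0..<i] @ [todo s0 ! x]) @ xs) (replicate_pmf r (pmf_of_set (set (todo s0))))"
    proof (cases "x < len")
      case True
      have r: "r = S - Suc i" "Suc i \<le> S" using Suc.hyps(2) by simp_all
      show ?thesis
        using Suc.hyps(1)[OF r(1) st(1)[OF True] r(2), unfolded st(2)[OF True] r(1)[symmetric]] by blast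
    qed auto
  qed
  then obtain D' where D': "\<And>x. x < len \<Longrightarrow> terminates (?loop, st x) (r * 8 + 1) (D' x) \<and>
    (\<forall>s'\<in>set_pmf (D' x). draw_inv s0 S s') \<and>
    map_pmf samples (D' x) = map_pmf (\<lambda>xs. (map (\<lambda>j. mem s (SB + j)) [0..<i] @ [todo s0 ! x]) @ xs) (replicate_pmf r (pmf_of_set (set (todo s0))))"
    by metis
  \<comment> \<open>\<open>terminates_append\<close> expects the continuation as a function of the
    state, whereas \<open>D'\<close> is indexed by the drawn position. The position can be read off
    the state because the list is distinct.\<close>
  have inj: "inj_on st {..<len}"
  proof (rule inj_onI)
    fix x y assume xy: "x \<in> {..<len}" "y \<in> {..<len}" "st x = st y"
    then have "todo s0 ! x = todo s0 ! y" using st(2)[of x] st(2)[of y] by auto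
    moreover have "length (todo s0) = len" by (simp add: todo_def len_def)
    ultimately show "x = y" using xy nth_eq_iff_index_eq[OF s0(4), of x y] by simp
  qed
  define D where "D = bind_pmf U D'"
  have "terminates ((draw_body @ [Arith Plus 20 20 16, Arith Less 25 20 2]) @ ?loop, s) (7 + (r * 8 + 1))
     (bind_pmf (map_pmf st U) (\<lambda>s1. D' (the_inv_into {..<len} st s1)))"
    by (rule terminates_append[OF body]) (use D' Uset the_inv_into_f_f[OF inj] in auto)
  also have "bind_pmf (map_pmf st U) (\<lambda>s1. D' (the_inv_into {..<len} st s1)) = D"
    unfolding D_def bind_map_pmf by (rule bind_pmf_cong) (use the_inv_into_f_f[OF inj] Uset in auto)
  finally have t1: "terminates ((draw_body @ [Arith Plus 20 20 16, Arith Less 25 20 2]) @ ?loop, s) (7 + (r * 8 + 1)) D" .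
  have "terminates (?loop, s) (Suc (7 + (r * 8 + 1))) (bind_pmf (step w pos P (?loop, s)) (\<lambda>_. D))"
    by (rule terminates_step) (use t1 inv(4) in simp)
  then have t: "terminates (?loop, s) ((S - i) * 8 + 1) D"
    using Suc.hyps(2)[symmetric] by simp
  have todo_set: "set (todo s0) = (!) (todo s0) ` {..<len}"
    by (auto simp: todo_def len_def)
  have "pmf_of_set (set (todo s0)) = map_pmf ((!) (todo s0)) U"
    unfolding todo_set U_def using s0(4) regs
    by (intro map_pmf_of_set_inj[symmetric] inj_on_nth) (auto simp: todo_def len_def)
  then have bU: "bind_pmf (pmf_of_set (set (todo s0))) f = bind_pmf U (\<lambda>x. f (todo s0 ! x))" for f :: "nat \<Rightarrow> nat list pmf"
    by (subst \<open>pmf_of_set (set (todo s0)) = map_pmf ((!) (todo s0)) U\<close>) (simp add: bind_map_pmf)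
  have repS: "replicate_pmf (Suc r) Q = bind_pmf Q (\<lambda>x. map_pmf (\<lambda>xs. x # xs) (replicate_pmf r Q))" for Q :: "nat pmf"
    by (simp add: map_pmf_def)
  have rep: "replicate_pmf (S - i) (pmf_of_set (set (todo s0))) =
     bind_pmf U (\<lambda>x. map_pmf (\<lambda>xs. (todo s0 ! x) # xs) (replicate_pmf r (pmf_of_set (set (todo s0)))))"
    unfolding Suc.hyps(2)[symmetric] repS bU ..
  have "map_pmf samples D = bind_pmf U (\<lambda>x. map_pmf samples (D' x))"
    by (simp add: D_def map_bind_pmf)
  also have "\<dots> = bind_pmf U (\<lambda>x. map_pmf (\<lambda>xs. (map (\<lambda>j. mem s (SB + j)) [0..<i] @ [todo s0 ! x]) @ xs) (replicate_pmf r (pmf_of_set (set (todo s0)))))"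
    by (rule bind_pmf_cong) (use D' Uset in auto)
  also have "\<dots> = map_pmf (\<lambda>xs. map (\<lambda>j. mem s (SB + j)) [0..<i] @ xs) (replicate_pmf (S - i) (pmf_of_set (set (todo s0))))"
    unfolding rep by (simp add: map_bind_pmf map_pmf_comp)
  finally show ?case using t D' Uset by (intro exI[of _ D]) (auto simp: D_def)
qed

lemma draw_ok:
  assumes s0: "regs_ok s0" "0 < reg s0 11" "reg s0 11 \<le> n" "distinct (todo s0)"
    and good: "measure_pmf.prob (replicate_pmf S (pmf_of_set (set (todo s0)))) {us. \<not> good us} \<le> p"
  shows "prob_triple draw_prog s0 (S * 8 + 3) (\<lambda>s. frame s0 {SB..<LB} s \<and> set (samples s) \<subseteq> set (todo s0)) g (\<lambda>s. good (samples s)) p"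
proof -
  let ?I = "[Const 20 0, Arith Less 25 20 2]"
  define s1 where "s1 = exec_det ?I s0"
  have d: "triple ?I s0 2 (\<lambda>s'. s' = s1)" by (rule triple_execI) (simp_all add: s1_def)
  then have t1: "terminates (?I, s0) 2 (return_pmf s1)" by (auto simp: triple_def)
  have b: "(of_bool (0 < S) :: nat) mod 2 ^ w = of_bool (0 < S)" by (rule mod_w) simp
  have "draw_inv s0 0 s1"
    using s0 b S0 unfolding s1_def by (auto simp: draw_inv_def frame_def regs_ok_def)
  from draw_loop[OF s0 this] obtain D where D: "terminates ([While 25 (draw_body @ [Arith Plus 20 20 16, Arith Less 25 20 2])], s1) (S * 8 + 1) D"
    "\<forall>s'\<in>set_pmf D. draw_inv s0 S s'"
    "map_pmf samples D = replicate_pmf S (pmf_of_set (set (todo s0)))"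
    by (auto simp: map_pmf_def bind_return_pmf')
  have "terminates (draw_prog, s0) (2 + (S * 8 + 1)) (bind_pmf (return_pmf s1) (\<lambda>_. D))"
    unfolding draw_prog_def for_loop_def by (rule terminates_append[OF t1]) (use D in auto)
  then have t: "terminates (draw_prog, s0) (S * 8 + 3) D"
    unfolding bind_return_pmf by (rule terminates_mono) simp
  have "measure_pmf.prob D {s. \<not> good (samples s)} = measure_pmf.prob (map_pmf samples D) {us. \<not> good us}"
    by (simp add: vimage_def)
  also have "\<dots> \<le> p" unfolding D(3) by (rule good)
  finally show ?thesis unfolding prob_triple_def using t D(2)
    by (intro exI[of _ D]) (auto simp: draw_inv_def samples_def)
qed


lemma init_scores_ok:
  assumes s0: "regs_ok s0" and b: "\<forall>i<k. base s0 i \<le> S + 1"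
  shows "triple init_scores_prog s0 (k * 7 + 3) (\<lambda>s. frame s0 scores_region s \<and> (\<forall>i<k. score s i = base s0 i))"
proof -
  define I where "I i s \<longleftrightarrow> frame s0 scores_region s \<and> (\<forall>j<i. score s j = base s0 j)" for i s
  have "triple init_scores_prog s0 (k * (4 + 3) + 3) (I k)"
    unfolding init_scores_prog_def
  proof (rule triple_for[where I = I and N = k])
    show "k < 2 ^ w" using word' by simp
    show "reg s 1 = k \<and> reg s 16 = 1" if "I i s" for i s
      using that s0 by (auto simp: I_def frame_def regs_ok_def)
    show "I 0 s0" by (simp add: I_def frame_refl)
    fix i and s :: state assume i: "i < k" and inv: "I i s" and r20: "reg s 20 = i"
    have regs: "reg s 8 = BB" "reg s 7 = SC" using inv s0 by (auto simp: I_def frame_def regs_ok_def)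
    have mods: "(BB + i) mod 2 ^ w = BB + i" "(SC + i) mod 2 ^ w = SC + i"
      using i by (auto intro!: mod_w simp: addr_defs)
    have memb: "mem s (BB + i) = base s0 i" using inv by (auto simp: I_def frame_def)
    show "triple [Arith Plus 21 8 20, Load 22 21, Arith Plus 21 7 20, Store 21 22] s 4 (\<lambda>s'. I (Suc i) s' \<and> reg s' 20 = i)"
    proof (rule triple_execI)
      fix s' assume s': "s' = exec_det [Arith Plus 21 8 20, Load 22 21, Arith Plus 21 7 20, Store 21 22] s"
      have e: "mem s' = (mem s)(SC + i := base s0 i)" "\<And>r. r \<le> 20 \<Longrightarrow> reg s' r = reg s r" "queries s' = queries s"
        unfolding s' using regs r20 mods memb by simp_all
      have "frame s0 scores_region s'" using inv e i by (auto simp: I_def frame_def BB_def)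
      moreover have "\<forall>j<Suc i. score s' j = base s0 j" using inv unfolding e(1) by (auto simp: I_def less_Suc_eq)
      ultimately show "I (Suc i) s' \<and> reg s' 20 = i" using e(2)[of 20] r20 by (simp add: I_def)
    qed simp_all
  qed (auto simp: I_def frame_set_reg)
  then show ?thesis by (rule triple_mono) (auto simp: I_def)
qed

lemma count_ok:
  assumes s0: "regs_ok s0" and t: "\<forall>j<S. mem s0 (LB + j) < k" and b: "\<forall>i<k. score s0 i \<le> S + 1"
  shows "triple count_prog s0 (S * 9 + 3) (\<lambda>s. frame s0 scores_region s \<and>
    (\<forall>i<k. score s i = score s0 i + card {j. j < S \<and> mem s0 (LB + j) = i}))"
proof -
  define I where "I l s \<longleftrightarrow> frame s0 scores_region s \<and>
    (\<forall>i<k. score s i = score s0 i + card {j. j < l \<and> mem s0 (LB + j) = i})" for l s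
  have "triple count_prog s0 (S * (6 + 3) + 3) (I S)"
    unfolding count_prog_def
  proof (rule triple_for[where I = I and N = S])
    show "S < 2 ^ w" using word' by (simp add: addr_defs)
    show "reg s 2 = S \<and> reg s 16 = 1" if "I i s" for i s
      using that s0 by (auto simp: I_def frame_def regs_ok_def)
    show "I 0 s0" by (simp add: I_def frame_refl)
    fix l and s :: state assume l: "l < S" and inv: "I l s" and r20: "reg s 20 = l"
    define t where "t = mem s0 (LB + l)"
    have tk: "t < k" using assms(2) l by (simp add: t_def)
    have regs: "reg s 6 = LB" "reg s 7 = SC" "reg s 16 = 1" using inv s0 by (auto simp: I_def frame_def regs_ok_def)
    have sc: "score s t = score s0 t + card {j. j < l \<and> mem s0 (LB + j) = t}" using inv tk by (simp add: I_def)
    have "card {j. j < l \<and> mem s0 (LB + j) = t} \<le> card {..<l}" by (rule card_mono) auto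
    then have sc': "score s t \<le> 2 * S" using sc b tk l by (auto dest!: spec[of _ t])
    have mods: "(LB + l) mod 2 ^ w = LB + l" "(SC + t) mod 2 ^ w = SC + t" "Suc (score s t) mod 2 ^ w = Suc (score s t)"
      using l tk sc' by (auto intro!: mod_w simp: addr_defs)
    have memb: "mem s (LB + l) = t" using inv l by (auto simp: I_def frame_def t_def addr_defs)
    show "triple [Arith Plus 21 6 20, Load 24 21, Arith Plus 24 7 24, Load 22 24, Arith Plus 22 22 16, Store 24 22] s 6
       (\<lambda>s'. I (Suc l) s' \<and> reg s' 20 = l)"
    proof (rule triple_execI)
      fix s' assume s': "s' = exec_det [Arith Plus 21 6 20, Load 24 21, Arith Plus 24 7 24, Load 22 24, Arith Plus 22 22 16, Store 24 22] s"
      have e: "mem s' = (mem s)(SC + t := Suc (score s t))" "\<And>r. r \<le> 20 \<Longrightarrow> reg s' r = reg s r" "queries s' = queries s"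
        unfolding s' using regs r20 mods memb by simp_all
      have "frame s0 scores_region s'" using inv e tk by (auto simp: I_def frame_def BB_def)
      moreover have "\<forall>i<k. score s' i = score s0 i + card {j. j < Suc l \<and> mem s0 (LB + j) = i}"
      proof (intro allI impI)
        fix i assume ik: "i < k"
        have "{j. j < Suc l \<and> mem s0 (LB + j) = i} =
          (if i = t then insert l {j. j < l \<and> mem s0 (LB + j) = i} else {j. j < l \<and> mem s0 (LB + j) = i})"
          by (auto simp: t_def less_Suc_eq)
        then show "score s' i = score s0 i + card {j. j < Suc l \<and> mem s0 (LB + j) = i}"
          unfolding e(1) using inv ik sc by (auto simp: I_def)
      qed
      ultimately show "I (Suc l) s' \<and> reg s' 20 = l" using e(2)[of 20] r20 by (simp add: I_def)
    qed simp_all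
  qed (auto simp: I_def frame_set_reg)
  then show ?thesis by (rule triple_mono) (auto simp: I_def)
qed

lemma score_ok:
  assumes s0: "regs_ok s0" and v: "reg s0 17 = v" and pos: "pos \<subseteq> edges n"
    and t: "\<forall>j<S. mem s0 (LB + j) < k" and b: "\<forall>j<S. score s0 (mem s0 (LB + j)) = S + 1"
  shows "triple score_prog s0 (S * 17 + 3) (\<lambda>s. frame s0 scores_region s \<and>
    (\<forall>i<k. int (score s i) = int (score s0 i) +
       (\<Sum>j<S. of_bool (mem s0 (LB + j) = i) * edge_sign v (mem s0 (SB + j)))))"
proof -
  define F where "F l i = (\<Sum>j<l. of_bool (mem s0 (LB + j) = i) * edge_sign v (mem s0 (SB + j)))" for l i
  have F: "\<bar>F l i\<bar> \<le> int l" for l i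
  proof (induction l)
    case (Suc l)
    have "\<bar>of_bool (mem s0 (LB + l) = i) * edge_sign v (mem s0 (SB + l))\<bar> \<le> 1" by (auto simp: abs_sg)
    then show ?case using Suc unfolding F_def by simp
  qed (simp add: F_def)
  define I where "I l s \<longleftrightarrow> frame s0 scores_region s \<and>
    (\<forall>i<k. int (score s i) = int (score s0 i) + F l i)" for l s
  let ?body = "[Arith Plus 21 5 20, Load 22 21, Arith Plus 21 6 20, Load 24 21,
     Arith Less 27 22 17, Arith Less 28 17 22, Arith Plus 27 27 28, Label 28 22 17,
     Arith Plus 24 7 24, Load 29 24, Arith Plus 29 29 28, Arith Plus 29 29 28, Arith Minus 29 29 27, Store 24 29]"
  have "triple score_prog s0 (S * (14 + 3) + 3) (I S)"
    unfolding score_prog_def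
  proof (rule triple_for[where I = I and N = S])
    show "S < 2 ^ w" using word' by (simp add: addr_defs)
    show "reg s 2 = S \<and> reg s 16 = 1" if "I i s" for i s
      using that s0 by (auto simp: I_def frame_def regs_ok_def)
    show "I 0 s0" by (simp add: I_def frame_refl F_def)
    fix l and s :: state assume l: "l < S" and inv: "I l s" and r20: "reg s 20 = l"
    define t where "t = mem s0 (LB + l)"
    define u where "u = mem s0 (SB + l)"
    define lab :: nat where "lab = of_bool ({u, v} \<in> pos)"
    define ne :: nat where "ne = of_bool (u \<noteq> v)"
    have tk: "t < k" using assms(4) l by (simp add: t_def)
    have regs: "reg s 5 = SB" "reg s 6 = LB" "reg s 7 = SC" "reg s 16 = 1" "reg s 17 = v"
      using inv s0 v by (auto simp: I_def frame_def regs_ok_def)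
    have sc: "int (score s t) = int S + 1 + F l t" using inv tk b l by (simp add: I_def t_def)
    then have sc': "score s t \<le> 2 * S + 1" "1 \<le> score s t" using F[of l t] l by linarith+
    have lab1: "lab \<le> 1" "ne \<le> 1" by (simp_all add: lab_def ne_def)
    have nesum: "(of_bool (u < v) + of_bool (v < u) :: nat) = ne" by (auto simp: ne_def)
    have memb: "mem s (LB + l) = t" "mem s (SB + l) = u" using inv l by (auto simp: I_def frame_def t_def u_def addr_defs)
    have vv: "{v} \<notin> pos" using pos by (auto simp: edges_def)
    \<comment> \<open>Adding the label twice and subtracting \<open>ne\<close> realises the values
      1, -1 and 0. On the diagonal the label is 0, since singletons are not edges.\<close>
    have sgv: "2 * int lab - int ne = edge_sign v u"
      using vv by (auto simp: lab_def ne_def edge_sign_def)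
    show "triple ?body s 14 (\<lambda>s'. I (Suc l) s' \<and> reg s' 20 = l)"
    proof (rule triple_execI)
      fix s' assume s': "s' = exec_det ?body s"
      define y1 where "y1 = score s t + lab"
      define y2 where "y2 = y1 + lab"
      define y3 where "y3 = y2 - ne"
      have mods: "(LB + l) mod 2 ^ w = LB + l" "(SB + l) mod 2 ^ w = SB + l" "(SC + t) mod 2 ^ w = SC + t"
        using l tk by (auto intro!: mod_w simp: addr_defs)
      have ymods: "(mem s (SC + t) + lab) mod 2 ^ w = y1" "(y1 + lab) mod 2 ^ w = y2" "(y2 - ne) mod 2 ^ w = y3"
        "(of_bool (u < v) + of_bool (v < u)) mod 2 ^ w = ne"
        using sc' lab1 unfolding nesum y3_def y2_def y1_def by (auto intro!: mod_w simp: addr_defs)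
      have e: "mem s' = (mem s)(SC + t := y3)" "\<And>r. r \<le> 20 \<Longrightarrow> reg s' r = reg s r" "queries s' = queries s"
        unfolding s' using regs r20 mods memb
        by (simp_all add: mod_of_bool ymods lab_def[symmetric] del: of_bool_eq_iff)
      have "frame s0 scores_region s'" using inv e tk by (auto simp: I_def frame_def BB_def)
      moreover have "\<forall>i<k. int (score s' i) = int (score s0 i) + F (Suc l) i"
      proof (intro allI impI)
        fix i assume ik: "i < k"
        have "F (Suc l) i = F l i + of_bool (t = i) * edge_sign v u" by (simp add: F_def t_def u_def)
        moreover have "int y3 = int (score s t) + edge_sign v u"
          unfolding y3_def y2_def y1_def using sgv sc' lab1 by linarith
        ultimately show "int (score s' i) = int (score s0 i) + F (Suc l) i"
          unfolding e(1) using inv ik by (auto simp: I_def)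
      qed
      ultimately show "I (Suc l) s' \<and> reg s' 20 = l" using e(2)[of 20] r20 by (simp add: I_def)
    qed simp_all
  qed (auto simp: I_def frame_set_reg)
  then show ?thesis by (rule triple_mono) (auto simp: I_def F_def)
qed

text \<open>The search starts from the value 0 and compares strictly, so a positive score is needed
  for a proper winner. In the applications closed slots have score 0, and positivity of the maximum
  then shows that the winner is open.\<close>

lemma argmax_ok:
  assumes s0: "regs_ok s0" and b: "\<forall>i<k. score s0 i \<le> 2 * S + 1" and p: "\<exists>i<k. score s0 i > 0"
  shows "triple argmax_prog s0 (k * 9 + 6) (\<lambda>s. frame s0 {} s \<and> reg s 31 < k \<and> 0 < score s0 (reg s 31) \<and>
    (\<forall>i<k. score s0 i \<le> score s0 (reg s 31)))"
proof -
  define I where "I l s \<longleftrightarrow> frame s0 {} s \<and> reg s 33 = 0 \<and> (reg s 32 = 0 \<or> reg s 31 < l \<and> score s0 (reg s 31) = reg s 32) \<and>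
    (\<forall>i<l. score s0 i \<le> reg s 32)" for l s
  let ?body = "[Arith Plus 21 7 20, Load 22 21,
     Arith Less 23 32 22, Cond 23 [Arith Plus 31 20 33, Arith Plus 32 22 33] []]"
  define s1 where "s1 = exec_det [Const 31 0, Const 32 0, Const 33 0] s0"
  have e1: "mem s1 = mem s0" "\<And>r. r < 20 \<Longrightarrow> reg s1 r = reg s0 r" "queries s1 = queries s0" "reg s1 32 = 0" "reg s1 33 = 0"
    unfolding s1_def by simp_all
  have a: "triple [Const 31 0, Const 32 0, Const 33 0] s0 3 (\<lambda>s. s = s1)" by (rule triple_execI) (simp_all add: s1_def)
  have I1: "I 0 s1" using e1 by (auto simp: I_def frame_def)
  have "triple argmax_prog s0 (3 + (k * (6 + 3) + 3)) (I k)"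
    unfolding argmax_prog_def
  proof (rule triple_append[OF a])
    fix s2 assume s2: "s2 = s1"
    show "triple (for_loop 20 1 25 ?body) s2 (k * (6 + 3) + 3) (I k)"
    proof (rule triple_for[where I = I and N = k])
      show "k < 2 ^ w" using word' by simp
      show "reg s 1 = k \<and> reg s 16 = 1" if "I i s" for i s
        using that s0 by (auto simp: I_def frame_def regs_ok_def)
      show "I 0 s2" using I1 s2 by simp
      fix l and s :: state assume l: "l < k" and inv: "I l s" and r20: "reg s 20 = l"
      define x where "x = score s0 l"
      have xb: "x \<le> 2 * S + 1" using b l by (simp add: x_def)
      have regs: "reg s 7 = SC" "reg s 33 = 0" using inv s0 by (auto simp: I_def frame_def regs_ok_def)
      have memx: "mem s (SC + l) = x" using inv by (auto simp: I_def frame_def x_def)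
      have mods: "(SC + l) mod 2 ^ w = SC + l" "x mod 2 ^ w = x" "l mod 2 ^ w = l"
        using l xb by (auto intro!: mod_w simp: addr_defs)
      show "triple ?body s 6 (\<lambda>s'. I (Suc l) s' \<and> reg s' 20 = l)"
      proof (rule triple_execI)
        fix s' assume s': "s' = exec_det ?body s"
        have e: "mem s' = mem s" "\<And>r. r \<le> 20 \<Longrightarrow> reg s' r = reg s r" "queries s' = queries s" "reg s' 33 = 0"
          "reg s' 31 = (if reg s 32 < x then l else reg s 31)" "reg s' 32 = (if reg s 32 < x then x else reg s 32)"
          unfolding s' using regs r20 mods memx by simp_all
        have "frame s0 {} s'" using inv e by (auto simp: I_def frame_def)
        moreover have "reg s' 32 = 0 \<or> reg s' 31 < Suc l \<and> score s0 (reg s' 31) = reg s' 32"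
          using inv unfolding e(5,6) by (auto simp: I_def x_def)
        moreover have "\<forall>i<Suc l. score s0 i \<le> reg s' 32"
        proof (intro allI impI)
          fix i assume "i < Suc l"
          then consider "i = l" | "i < l" by linarith
          then show "score s0 i \<le> reg s' 32"
          proof cases
            case 1 then show ?thesis unfolding e(6) by (simp add: x_def)
          next
            case 2
            then have "score s0 i \<le> reg s 32" using inv by (simp add: I_def)
            then show ?thesis unfolding e(6) by simp
          qed
        qed
        ultimately have "I (Suc l) s'" unfolding I_def using e(4) by blast
        then show "I (Suc l) s' \<and> reg s' 20 = l" using e(2)[of 20] r20 by simp
      qed simp_all
    qed (auto simp: I_def frame_set_reg)
  qed
  then show ?thesis
  proof (rule triple_mono)
    fix s assume "I k s"
    then show "frame s0 {} s \<and> reg s 31 < k \<and> 0 < score s0 (reg s 31) \<and> (\<forall>i<k. score s0 i \<le> score s0 (reg s 31))"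
      using p unfolding I_def by (metis leD not_gr0)
  qed simp
qed

definition cells :: "nat \<Rightarrow> nat set" where
  "cells v = (\<lambda>i. v + n * i) ` {..<k}"

lemma cells_subset: "v < n \<Longrightarrow> cells v \<subseteq> {..<NK}"
  using cell_lt by (auto simp: cells_def)

lemma cell_inj: "u < n \<Longrightarrow> v < n \<Longrightarrow> u + n * i = v + n * j \<longleftrightarrow> u = v \<and> i = j"
  by (metis add.commute add_left_cancel mod_less mod_mult_self2 mult_cancel1 n0 not_gr_zero)

text \<open>The same rule is applied to all \<open>k\<close> hypothetical positions of
  \<open>v\<close>, so the move is right under each naming without knowledge of the true one. The
  product of the two flags is 1 exactly if the cell has to be kept.\<close>

lemma update_ok:
  assumes s0: "regs_ok s0" and v: "reg s0 17 = v" "v < n" and L: "reg s0 12 = L" and g: "reg s0 31 = g" "g < k"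
    and t: "\<forall>i<k. cell s0 v i < k"
  shows "triple update_prog s0 (k * 12 + 6) (\<lambda>s. frame s0 (cells v) s \<and>
    (\<forall>i<k. cell s v i = (if g = L \<or> cell s0 v i = L then g else cell s0 v i)))"
proof -
  define I where "I l s \<longleftrightarrow> frame s0 (cells v) s \<and> reg s 31 = g \<and> reg s 34 = of_bool (g \<noteq> L) \<and>
    (\<forall>i<k. cell s v i = (if i < l \<and> (g = L \<or> cell s0 v i = L) then g else cell s0 v i))" for l s
  let ?body = "[Arith Times 21 0 20, Arith Plus 21 21 17, Load 22 21, Arith Less 27 22 12,
       Arith Less 28 12 22, Arith Plus 27 27 28, Arith Times 27 27 34, Cond 27 [] [Store 21 31]]"
  define s1 where "s1 = exec_det [Arith Less 34 31 12, Arith Less 35 12 31, Arith Plus 34 34 35] s0"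
  have e1: "mem s1 = mem s0" "\<And>r. r < 20 \<Longrightarrow> reg s1 r = reg s0 r" "queries s1 = queries s0" "reg s1 31 = g" "reg s1 34 = of_bool (g \<noteq> L)"
    unfolding s1_def using L g by (simp_all add: mod_of_bool of_bool_neq del: of_bool_eq_iff)
  have a: "triple [Arith Less 34 31 12, Arith Less 35 12 31, Arith Plus 34 34 35] s0 3 (\<lambda>s. s = s1)"
    by (rule triple_execI) (simp_all add: s1_def)
  have I1: "I 0 s1" using e1 by (auto simp: I_def frame_def)
  have "triple update_prog s0 (3 + (k * (9 + 3) + 3)) (I k)"
    unfolding update_prog_def
  proof (rule triple_append[OF a])
    fix s2 assume s2: "s2 = s1"
    show "triple (for_loop 20 1 25 ?body) s2 (k * (9 + 3) + 3) (I k)"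
    proof (rule triple_for[where I = I and N = k])
      show "k < 2 ^ w" using word' by simp
      show "reg s 1 = k \<and> reg s 16 = 1" if "I i s" for i s
        using that s0 by (auto simp: I_def frame_def regs_ok_def)
      show "I 0 s2" using I1 s2 by simp
      fix l and s :: state assume l: "l < k" and inv: "I l s" and r20: "reg s 20 = l"
      define t where "t = cell s0 v l"
      have regs: "reg s 0 = n" "reg s 17 = v" "reg s 12 = L" "reg s 31 = g" "reg s 34 = of_bool (g \<noteq> L)"
        using inv s0 v L by (auto simp: I_def frame_def regs_ok_def)
      have memx: "mem s (n * l + v) = t" using inv l by (simp add: I_def t_def add.commute)
      have mods: "(n * l) mod 2 ^ w = n * l" "(n * l + v) mod 2 ^ w = n * l + v"
        using cell_lt[OF v(2) l] by (auto intro!: mod_w simp: addr_defs)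
      have mu: "(of_bool x * of_bool y :: nat) = of_bool (x \<and> y)" for x y by simp
      show "triple ?body s 9 (\<lambda>s'. I (Suc l) s' \<and> reg s' 20 = l)"
      proof (rule triple_execI)
        fix s' assume s': "s' = exec_det ?body s"
        have e: "mem s' = (if g = L \<or> t = L then (mem s)(n * l + v := g) else mem s)" "\<And>r. r \<le> 20 \<Longrightarrow> reg s' r = reg s r"
           "queries s' = queries s" "reg s' 31 = g" "reg s' 34 = of_bool (g \<noteq> L)"
          unfolding s' using regs r20 mods memx by (simp_all add: mod_of_bool of_bool_neq mu del: of_bool_eq_iff)
        have cl: "n * l + v \<in> cells v" using l by (auto simp: cells_def)
        have "frame s0 (cells v) s'" using inv e(2,3) cl unfolding I_def frame_def e(1) by auto
        moreover have "\<forall>i<k. cell s' v i = (if i < Suc l \<and> (g = L \<or> cell s0 v i = L) then g else cell s0 v i)"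
        proof (intro allI impI)
          fix i assume ik: "i < k"
          have "v + n * i = n * l + v \<longleftrightarrow> i = l" using cell_inj[OF v(2) v(2), of i l] by (simp add: add.commute)
          then show "cell s' v i = (if i < Suc l \<and> (g = L \<or> cell s0 v i = L) then g else cell s0 v i)"
            using inv ik unfolding e(1) by (auto simp: I_def t_def less_Suc_eq)
        qed
        ultimately show "I (Suc l) s' \<and> reg s' 20 = l" using e(2)[of 20] e(4,5) r20 by (simp add: I_def)
      qed simp_all
    qed (auto simp: I_def frame_set_reg)
  qed
  then show ?thesis by (rule triple_mono) (auto simp: I_def)
qed

end

section \<open>Invariants of the state, good samples and the scan of one vertex\<close>

definition sample_prog :: "instr list" where
  "sample_prog = draw_prog @ locate_prog"

definition vertex_prog :: "instr list" where
  "vertex_prog = [Arith Plus 21 4 14, Load 17 21] @ init_scores_prog @ score_prog @ argmax_prog @ update_prog @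
     [Arith Plus 14 14 16]"

text \<open>The upper bound on \<gamma> keeps errors small compared with a slot of
  \<open>card W / (2 * k)\<close> vertices. With \<open>4 \<le> \<gamma> * real m\<close>, a
  \<open>1 / m\<close> share of the list disturbs a balance by at most a quarter of the permitted
  error.\<close>

locale sampling_algorithm = algorithm w pos P n k S m
  for w :: nat and pos :: "nat set set" and P :: "nat set set" and n k S m :: nat +
  fixes \<gamma> :: real
  assumes pos_edges: "pos \<subseteq> edges n"
    and \<gamma>: "0 < \<gamma>" "\<gamma> \<le> 1 / (32 * real k)" "4 \<le> \<gamma> * real m"
begin

definition opened :: "state \<Rightarrow> nat set" where
  "opened s = {i. i < k \<and> base s i \<noteq> 0}"

text \<open>Initially cell \<open>u + n * i\<close> holds \<open>i\<close>, and this is the optimal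
  clustering \<open>c\<close>; in the end all cells of \<open>u\<close> coincide, and it is the
  output. In between it mixes optimal positions with decisions of the algorithm.\<close>

definition hybrid :: "(nat \<Rightarrow> nat) \<Rightarrow> state \<Rightarrow> nat \<Rightarrow> nat" where
  "hybrid c s u = (if u < n then cell s u (c u) else 0)"

text \<open>The last two clauses speak about all cells: an undecided vertex may be in different open
  slots under different hypotheses, a decided one is in the same closed slot under all of
  them.\<close>

definition state_inv :: "state \<Rightarrow> bool" where
  "state_inv s \<longleftrightarrow> regs_ok s \<and> reps_ok s \<and> reg s 11 \<le> n \<and> distinct (todo s) \<and> set (todo s) \<subseteq> {..<n} \<and>
    (\<forall>i<k. base s i = 0 \<or> base s i = S + 1) \<and> (\<forall>v<n. \<forall>i<k. cell s v i < k) \<and>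
    (\<forall>v\<in>set (todo s). \<forall>i<k. cell s v i \<in> opened s) \<and>
    (\<forall>v<n. v \<notin> set (todo s) \<longrightarrow> (\<exists>j. j \<notin> opened s \<and> (\<forall>i<k. cell s v i = j)))"

lemma state_inv_cong:
  assumes "state_inv s" "regs_ok s'" "reps_ok s'" "reg s' 11 = reg s 11"
    and mem: "\<And>a. a < SB \<or> BB \<le> a \<and> a < RB \<Longrightarrow> mem s' a = mem s a"
  shows "state_inv s'" "todo s' = todo s" "opened s' = opened s" "\<And>u i. u < n \<Longrightarrow> i < k \<Longrightarrow> cell s' u i = cell s u i"
proof -
  show c: "cell s' u i = cell s u i" if "u < n" "i < k" for u i
    using cell_lt[OF that] by (intro mem) (simp add: SB_def)
  have b: "base s' i = base s i" if "i < k" for i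
    using that by (intro mem) (simp add: RB_def)
  show o: "opened s' = opened s" using b by (auto simp: opened_def)
  show l: "todo s' = todo s"
    using assms(1,4) by (auto simp: todo_def state_inv_def SB_def intro!: mem)
  show "state_inv s'"
    using assms(1-4) unfolding state_inv_def l o by (auto simp: c b subset_iff)
qed

lemma consistent_exists: "reps_ok s \<Longrightarrow> \<exists>c. consistent c s"
  using labeling_exists(2)[of "reg s 10" "\<lambda>i. mem s (RB + i)"] by (auto simp: reps_ok_def consistent_def)

text \<open>The junk vertex \<open>n\<close> stands for the test function that only counts the vertices of slot \<open>i\<close>.\<close>
definition sample_fun :: "state \<Rightarrow> (nat \<Rightarrow> nat) \<Rightarrow> nat \<Rightarrow> nat \<Rightarrow> nat \<Rightarrow> real" where
  "sample_fun s c i v u = of_bool (hybrid c s u = i) * (if v = n then 1 else real_of_int (edge_sign v u))"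

text \<open>All namings are tested, not only the consistent ones. Which of them remain consistent
  depends on the sample, whereas the union bound requires tests that are fixed before the
  draw.\<close>

definition good :: "state \<Rightarrow> nat list \<Rightarrow> bool" where
  "good s us \<longleftrightarrow> (\<forall>(c, i, v)\<in>labelings \<times> {..<k} \<times> {..n}.
     \<bar>sum_list (map (sample_fun s c i v) us) / real S - (\<Sum>u\<in>set (todo s). sample_fun s c i v u) / real (card (set (todo s)))\<bar> \<le> \<gamma> / 4)"

text \<open>A union bound over \<open>k ^ k\<close> namings, \<open>k\<close> slots and
  \<open>n + 1\<close> test functions, each with the two-sided tail at deviation
  \<open>\<gamma> / 4\<close>.\<close>

definition pfail :: real where
  "pfail = real (k ^ k * k * (n + 1)) * (2 * exp (- real S * (\<gamma> / 4)\<^sup>2 / 2))"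

lemma pfail_nonneg: "0 \<le> pfail"
  by (simp add: pfail_def)

lemma good_prob:
  assumes "todo s \<noteq> []"
  shows "measure_pmf.prob (replicate_pmf S (pmf_of_set (set (todo s)))) {us. \<not> good s us} \<le> pfail"
proof -
  let ?J = "labelings \<times> {..<k} \<times> {..n}"
  have "measure_pmf.prob (replicate_pmf S (pmf_of_set (set (todo s))))
     {us. \<not> (\<forall>j\<in>?J. \<bar>sum_list (map ((\<lambda>(c, i, v). sample_fun s c i v) j) us) / real S -
         (\<Sum>u\<in>set (todo s). (\<lambda>(c, i, v). sample_fun s c i v) j u) / real (card (set (todo s)))\<bar> \<le> \<gamma> / 4)}
    \<le> real (card ?J) * (2 * exp (- real S * (\<gamma> / 4)\<^sup>2 / 2))"
    by (rule replicate_pmf_of_set_union_tail)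
       (use assms finite_labelings \<gamma> S0 in \<open>auto simp: sample_fun_def edge_sign_def\<close>)
  also have "\<dots> \<le> pfail"
  proof -
    have "card ?J \<le> k ^ k * k * (n + 1)" using mult_le_mono1[OF card_labelings, of "k * (n + 1)"]
      by (simp add: card_cartesian_product algebra_simps)
    then have "real (card ?J) \<le> real (k ^ k * k * (n + 1))" by (rule of_nat_mono)
    then show ?thesis unfolding pfail_def by (intro mult_right_mono) auto
  qed
  finally show ?thesis by (simp add: good_def case_prod_unfold)
qed

definition sampled :: "state \<Rightarrow> state \<Rightarrow> bool" where
  "sampled s0 s \<longleftrightarrow> (\<forall>r<20. r \<noteq> 10 \<longrightarrow> reg s r = reg s0 r) \<and>
    (\<forall>a. a < SB \<or> SC \<le> a \<and> a < RB \<or> RB + k \<le> a \<longrightarrow> mem s a = mem s0 a) \<and>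
    reps_extend s0 s \<and> queries s \<le> queries s0 + S * k \<and> set (samples s) \<subseteq> set (todo s0) \<and>
    (\<forall>j<S. mem s (LB + j) < k \<and> (\<forall>c. consistent c s \<longrightarrow> mem s (LB + j) = hybrid c s0 (mem s (SB + j))))"

lemma samples_nth: "j < S \<Longrightarrow> samples s ! j = mem s (SB + j)" "length (samples s) = S"
  by (simp_all add: samples_def)

text \<open>Only the draw is random; locating the samples with the oracle is deterministic and adds
  no failure probability.\<close>

lemma sample_ok:
  assumes s0: "state_inv s0" "0 < reg s0 11"
  shows "prob_triple sample_prog s0 (S * (k * 12 + 21) + 6) (sampled s0) g (\<lambda>s. good s0 (samples s)) pfail"
proof -
  have todo: "todo s0 \<noteq> []" using s0 by (simp add: todo_def)
  have s0': "regs_ok s0" "reps_ok s0" "reg s0 11 \<le> n" "distinct (todo s0)" "set (todo s0) \<subseteq> {..<n}"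
    "\<forall>v<n. \<forall>i<k. cell s0 v i < k"
    using s0(1) unfolding state_inv_def by blast+
  have D: "prob_triple draw_prog s0 (S * 8 + 3) (\<lambda>s. frame s0 {SB..<LB} s \<and> set (samples s) \<subseteq> set (todo s0)) g (\<lambda>s. good s0 (samples s)) pfail"
    by (rule draw_ok[OF s0'(1) s0(2) s0'(3,4) good_prob[OF todo]])
  have "prob_triple (draw_prog @ locate_prog) s0 ((S * 8 + 3) + (S * (k * 12 + 13) + 3)) (sampled s0) g (\<lambda>s. good s0 (samples s)) (pfail + 0)"
  proof (rule prob_triple_append[OF D])
    fix s1 assume s1: "frame s0 {SB..<LB} s1 \<and> set (samples s1) \<subseteq> set (todo s0)"
    have c1: "cell s1 u i = cell s0 u i" if "u < n" "i < k" for u i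
      using s1 cell_lt[OF that] by (auto simp: frame_def SB_def)
    have "triple locate_prog s1 (S * (k * 12 + 13) + 3) (locate_inv s1 (samples s1) S)"
    proof (rule locate_ok)
      show "regs_ok s1" using frame_regs_ok s1 s0' by blast
      show "reps_ok s1" by (rule frame_reps_ok[OF conjunct1[OF s1] _ s0'(2)]) (auto simp: addr_defs)
      show "length (samples s1) = S" by (simp add: samples_nth)
      show "set (samples s1) \<subseteq> {..<n}" using s1 s0' by blast
      show "\<forall>j<S. mem s1 (SB + j) = samples s1 ! j" by (simp add: samples_nth)
      show "\<forall>u<n. \<forall>i<k. cell s1 u i < k" using c1 s0' by simp
    qed
    then show "prob_triple locate_prog s1 (S * (k * 12 + 13) + 3) (sampled s0) (good s0 (samples s1)) (\<lambda>s. good s0 (samples s)) 0"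
    proof (intro triple_imp_prob_triple, elim triple_mono)
      fix s assume li: "locate_inv s1 (samples s1) S s"
      have mSB: "mem s (SB + j) = mem s1 (SB + j)" if "j < S" for j
        using li that by (auto simp: locate_inv_def LB_def)
      have sm: "samples s = samples s1" unfolding samples_def using mSB by simp
      have ext: "reps_extend s0 s"
      proof -
        have "mem s1 (RB + i) = mem s0 (RB + i)" for i
          using s1 by (auto simp: frame_def addr_defs)
        moreover have "reg s1 10 = reg s0 10" using s1 by (simp add: frame_def)
        ultimately show ?thesis using li by (auto simp: locate_inv_def reps_extend_def)
      qed
      have "mem s (LB + j) = hybrid c s0 (mem s (SB + j))" if "j < S" "consistent c s" for j c
      proof -
        have "mem s (SB + j) \<in> set (samples s1)" using samples_nth that(1) sm by (metis nth_mem)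
        then have u: "mem s (SB + j) < n" using s1 s0' by blast
        have "c \<in> labelings" using that by (simp add: consistent_def)
        then have "c (mem s (SB + j)) < k" using labelings_lt u by blast
        moreover have "mem s (LB + j) = cell s1 (mem s (SB + j)) (c (mem s (SB + j)))"
          using li that samples_nth(1)[OF that(1), of s1] mSB[OF that(1)] by (simp add: locate_inv_def)
        ultimately show ?thesis using u c1 by (simp add: hybrid_def)
      qed
      moreover have "mem s a = mem s0 a" if "a < SB \<or> SC \<le> a \<and> a < RB \<or> RB + k \<le> a" for a
      proof -
        have "a < LB \<or> SC \<le> a \<and> a < RB \<or> RB + k \<le> a" "a \<notin> {SB..<LB}" using that by (auto simp: addr_defs)
        then show ?thesis using li s1 unfolding locate_inv_def frame_def by metis
      qed
      ultimately show "sampled s0 s \<and> (good s0 (samples s1) \<longrightarrow> good s0 (samples s))"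
        using li s1 ext unfolding sampled_def sm by (auto simp: locate_inv_def frame_def)
    qed simp
  qed simp
  then show ?thesis unfolding sample_prog_def
    by (rule prob_triple_mono) (auto simp: algebra_simps)
qed

lemma sampled_state_inv:
  assumes "state_inv s0" "sampled s0 s"
  shows "state_inv s" "todo s = todo s0" "opened s = opened s0" "\<And>u i. u < n \<Longrightarrow> i < k \<Longrightarrow> cell s u i = cell s0 u i"
    "\<And>j. j < S \<Longrightarrow> mem s (LB + j) \<in> opened s"
proof -
  have r: "regs_ok s" "reps_ok s" "reg s 11 = reg s0 11"
    using assms by (auto simp: state_inv_def sampled_def regs_ok_def reps_extend_def)
  have m: "mem s a = mem s0 a" if "a < SB \<or> BB \<le> a \<and> a < RB" for a
    using assms(2) that unfolding sampled_def BB_def by auto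
  note cg = state_inv_cong[OF assms(1) r m]
  show "state_inv s" by (rule cg(1))
  show todo: "todo s = todo s0" by (rule cg(2))
  show op: "opened s = opened s0" by (rule cg(3))
  show "\<And>u i. u < n \<Longrightarrow> i < k \<Longrightarrow> cell s u i = cell s0 u i" by (rule cg(4))
  fix j assume j: "j < S"
  \<comment> \<open>The claim about the stored slot mentions no naming, so any consistent one can
    witness that the slot is open.\<close>
  obtain c where c: "consistent c s" using consistent_exists r by blast
  have "mem s (SB + j) \<in> set (todo s0)" using assms(2) samples_nth(1)[of j s] samples_nth(2)[of s] j nth_mem unfolding sampled_def by (metis subsetD)
  then have u: "mem s (SB + j) \<in> set (todo s0)" "mem s (SB + j) < n" using assms(1) unfolding state_inv_def by blast+
  have "c (mem s (SB + j)) < k" using c u labelings_lt unfolding consistent_def by blast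
  then have "hybrid c s0 (mem s (SB + j)) \<in> opened s0" using u assms(1) unfolding state_inv_def hybrid_def by simp
  then show "mem s (LB + j) \<in> opened s" using assms(2) c j unfolding op sampled_def by metis
qed

definition estimate :: "state \<Rightarrow> nat \<Rightarrow> nat \<Rightarrow> int" where
  "estimate s v i = (\<Sum>j<S. of_bool (mem s (LB + j) = i) * edge_sign v (mem s (SB + j)))"

text \<open>The slot \<open>g\<close> is chosen from the estimates alone and is the same for all
  namings; only the effect on the cells depends on the hypothesis.\<close>

definition vertex_post :: "state \<Rightarrow> state \<Rightarrow> bool" where
  "vertex_post s s' \<longleftrightarrow> (\<forall>r<20. r \<noteq> 14 \<longrightarrow> r \<noteq> 17 \<longrightarrow> reg s' r = reg s r) \<and> reg s' 14 = Suc (reg s 14) \<and> queries s' = queries s \<and>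
    (let v = todo s ! reg s 14 in
      (\<forall>a. a \<notin> cells v \<longrightarrow> a \<notin> scores_region \<longrightarrow> mem s' a = mem s a) \<and>
      (\<exists>g\<in>opened s. (\<forall>i\<in>opened s. estimate s v i \<le> estimate s v g) \<and>
        (\<forall>i<k. cell s' v i = (if g = reg s 12 \<or> cell s v i = reg s 12 then g else cell s v i))))"

text \<open>Open slots start with score \<open>S + 1\<close> and estimates are at least
  \<open>- S\<close>, so open scores stay positive while closed ones are 0. Hence the maximum is
  attained at an open slot, and the common offset does not affect the comparison.\<close>

lemma vertex_ok:
  assumes s0: "state_inv s0" "reg s0 14 < reg s0 11"
    and loc: "\<And>j. j < S \<Longrightarrow> mem s0 (LB + j) \<in> opened s0"
  shows "triple vertex_prog s0 (S * 17 + k * 28 + 21) (vertex_post s0)"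
proof -
  define v where "v = todo s0 ! reg s0 14"
  have s0': "regs_ok s0" "reg s0 11 \<le> n" "set (todo s0) \<subseteq> {..<n}" "\<And>i. i < k \<Longrightarrow> base s0 i = 0 \<or> base s0 i = S + 1"
    "\<forall>v<n. \<forall>i<k. cell s0 v i < k"
    using s0(1) unfolding state_inv_def by blast+
  have "v \<in> set (todo s0)" using s0 unfolding v_def by (intro nth_mem) (simp add: todo_def)
  then have vn: "v < n" using s0' by auto
  have memv: "mem s0 (NK + reg s0 14) = v" using s0 by (simp add: v_def todo_def)
  have mods: "(NK + reg s0 14) mod 2 ^ w = NK + reg s0 14"
    using s0 s0' by (intro mod_w) (simp add: addr_defs)
  have op: "opened s0 \<noteq> {}" using loc S0 by blast
  have base_opn: "base s0 i = (if i \<in> opened s0 then S + 1 else 0)" if "i < k" for i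
    using s0'(4)[OF that] that by (auto simp: opened_def)
  have estimate_closed: "estimate s0 v i = 0" if "i \<notin> opened s0" for i
    unfolding estimate_def using loc that by (intro sum.neutral) auto
  have estimate_ge: "- int S \<le> estimate s0 v i" "estimate s0 v i \<le> int S" for i
  proof -
    have "\<bar>estimate s0 v i\<bar> \<le> (\<Sum>j<S. \<bar>of_bool (mem s0 (LB + j) = i) * edge_sign v (mem s0 (SB + j))\<bar>)"
      unfolding estimate_def by (rule sum_abs)
    also have "\<dots> \<le> (\<Sum>j<S. 1)" by (rule sum_mono) (auto simp: abs_sg)
    finally show "- int S \<le> estimate s0 v i" "estimate s0 v i \<le> int S" by auto
  qed
  define s1 where "s1 = exec_det [Arith Plus 21 4 14, Load 17 21] s0"
  have a1: "triple [Arith Plus 21 4 14, Load 17 21] s0 2 (\<lambda>s. s = s1)"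
    by (rule triple_execI) (simp_all add: s1_def)
  have e1: "mem s1 = mem s0" "\<And>r. r < 20 \<Longrightarrow> r \<noteq> 17 \<Longrightarrow> reg s1 r = reg s0 r" "reg s1 17 = v" "queries s1 = queries s0"
    unfolding s1_def using s0'(1) mods memv by (simp_all add: regs_ok_def)
  have r1: "regs_ok s1" using s0'(1) e1 by (simp add: regs_ok_def)
  have a2: "triple init_scores_prog s1 (k * 7 + 3) (\<lambda>s. frame s1 scores_region s \<and> (\<forall>i<k. score s i = base s1 i))"
  proof (rule init_scores_ok[OF r1], intro allI impI)
    fix i assume "i < k"
    then show "base s1 i \<le> S + 1" using s0'(4)[of i] by (auto simp: e1(1))
  qed
  have a3: "triple score_prog s2 (S * 17 + 3) (\<lambda>s. frame s1 scores_region s \<and> (\<forall>i<k. int (score s i) = int (base s0 i) + estimate s0 v i))"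
    if s2: "frame s1 scores_region s2 \<and> (\<forall>i<k. score s2 i = base s1 i)" for s2
  proof -
    have m2: "mem s2 (LB + j) = mem s0 (LB + j)" "mem s2 (SB + j) = mem s0 (SB + j)" if "j < S" for j
      using s2 that e1(1) by (auto simp: frame_def addr_defs)
    have est2: "(\<Sum>j<S. of_bool (mem s2 (LB + j) = i) * edge_sign v (mem s2 (SB + j))) = estimate s0 v i" for i
      unfolding estimate_def by (rule sum.cong) (use m2 in auto)
    have "triple score_prog s2 (S * 17 + 3) (\<lambda>s. frame s2 scores_region s \<and>
    (\<forall>i<k. int (score s i) = int (score s2 i) + (\<Sum>j<S. of_bool (mem s2 (LB + j) = i) * edge_sign v (mem s2 (SB + j)))))"
    proof (rule score_ok[OF _ _ pos_edges])
      show "regs_ok s2" using frame_regs_ok s2 r1 by blast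
      show "reg s2 17 = v" using s2 e1 by (simp add: frame_def)
      show "\<forall>j<S. mem s2 (LB + j) < k" using m2 loc by (simp add: opened_def)
      show "\<forall>j<S. score s2 (mem s2 (LB + j)) = S + 1"
      proof (intro allI impI)
        fix j assume j: "j < S"
        have "mem s0 (LB + j) < k" "base s0 (mem s0 (LB + j)) \<noteq> 0" using loc[OF j] by (auto simp: opened_def)
        then have "base s0 (mem s0 (LB + j)) = S + 1" using s0'(4)[of "mem s0 (LB + j)"] by simp
        then show "score s2 (mem s2 (LB + j)) = S + 1"
          using s2 \<open>mem s0 (LB + j) < k\<close> unfolding m2(1)[OF j] e1(1) by simp
      qed
    qed
    then show ?thesis
    proof (rule triple_mono)
      fix s assume s: "frame s2 scores_region s \<and>
    (\<forall>i<k. int (score s i) = int (score s2 i) + (\<Sum>j<S. of_bool (mem s2 (LB + j) = i) * edge_sign v (mem s2 (SB + j))))"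
      have "frame s1 scores_region s" using frame_trans s2 s by blast
      then show "frame s1 scores_region s \<and> (\<forall>i<k. int (score s i) = int (base s0 i) + estimate s0 v i)"
        using s s2 unfolding est2 e1(1) by simp
    qed simp
  qed
  have a4: "triple argmax_prog s3 (k * 9 + 6) (\<lambda>s. frame s1 scores_region s \<and> reg s 31 \<in> opened s0 \<and> (\<forall>i\<in>opened s0. estimate s0 v i \<le> estimate s0 v (reg s 31)))"
    if s3: "frame s1 scores_region s3 \<and> (\<forall>i<k. int (score s3 i) = int (base s0 i) + estimate s0 v i)" for s3
  proof -
    have sc: "int (score s3 i) = (if i \<in> opened s0 then int S + 1 + estimate s0 v i else 0)" if "i < k" for i
      using s3 that base_opn estimate_closed by simp
    have "triple argmax_prog s3 (k * 9 + 6) (\<lambda>s. frame s3 {} s \<and> reg s 31 < k \<and> 0 < score s3 (reg s 31) \<and>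
      (\<forall>i<k. score s3 i \<le> score s3 (reg s 31)))"
    proof (rule argmax_ok)
      show "regs_ok s3" using frame_regs_ok s3 r1 by blast
      show "\<forall>i<k. score s3 i \<le> 2 * S + 1"
      proof (intro allI impI)
        fix i assume "i < k"
        from sc[OF this] estimate_ge[of i] show "score s3 i \<le> 2 * S + 1" by (auto split: if_splits)
      qed
      obtain i where i: "i \<in> opened s0" using op by blast
      then have "i < k" by (simp add: opened_def)
      with sc[OF this] estimate_ge[of i] i show "\<exists>i<k. 0 < score s3 i" by auto
    qed
    then show ?thesis
    proof (rule triple_mono)
      fix s assume s: "frame s3 {} s \<and> reg s 31 < k \<and> 0 < score s3 (reg s 31) \<and> (\<forall>i<k. score s3 i \<le> score s3 (reg s 31))"
      define g where "g = reg s 31"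
      have g: "g < k" "0 < score s3 g" "\<And>i. i < k \<Longrightarrow> score s3 i \<le> score s3 g" using s by (auto simp: g_def)
      have go: "g \<in> opened s0" using sc[OF g(1)] g(2) by (auto split: if_splits)
      have "estimate s0 v i \<le> estimate s0 v g" if i: "i \<in> opened s0" for i
      proof -
        have ik: "i < k" using i by (simp add: opened_def)
        have "int (score s3 i) \<le> int (score s3 g)" using g(3)[OF ik] by simp
        then show ?thesis using sc[OF ik] sc[OF g(1)] i go by simp
      qed
      moreover have "frame s1 scores_region s" by (rule frame_trans[OF conjunct1[OF s3] conjunct1[OF s]]) auto
      ultimately show "frame s1 scores_region s \<and> reg s 31 \<in> opened s0 \<and> (\<forall>i\<in>opened s0. estimate s0 v i \<le> estimate s0 v (reg s 31))"
        using go unfolding g_def by blast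
    qed simp
  qed
  define Q where "Q s \<longleftrightarrow> frame s1 (scores_region \<union> cells v) s \<and> (\<exists>g\<in>opened s0. (\<forall>i\<in>opened s0. estimate s0 v i \<le> estimate s0 v g) \<and>
        (\<forall>i<k. cell s v i = (if g = reg s0 12 \<or> cell s0 v i = reg s0 12 then g else cell s0 v i)))" for s
  have a5: "triple update_prog s4 (k * 12 + 6) Q"
    if s4: "frame s1 scores_region s4 \<and> reg s4 31 \<in> opened s0 \<and> (\<forall>i\<in>opened s0. estimate s0 v i \<le> estimate s0 v (reg s4 31))" for s4
  proof -
    have c4: "cell s4 v i = cell s0 v i" if "i < k" for i
      using s4 cell_lt[OF vn that] e1(1) by (auto simp: frame_def addr_defs)
    have "triple update_prog s4 (k * 12 + 6) (\<lambda>s. frame s4 (cells v) s \<and>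
      (\<forall>i<k. cell s v i = (if reg s4 31 = reg s0 12 \<or> cell s4 v i = reg s0 12 then reg s4 31 else cell s4 v i)))"
    proof (rule update_ok)
      show "regs_ok s4" using frame_regs_ok s4 r1 by blast
      show "reg s4 17 = v" "reg s4 12 = reg s0 12" using s4 e1 by (auto simp: frame_def)
      show "reg s4 31 < k" using s4 by (simp add: opened_def)
      show "\<forall>i<k. cell s4 v i < k" using c4 s0'(5) vn by simp
    qed (use vn in auto)
    then show ?thesis
    proof (rule triple_mono)
      fix s assume s: "frame s4 (cells v) s \<and>
      (\<forall>i<k. cell s v i = (if reg s4 31 = reg s0 12 \<or> cell s4 v i = reg s0 12 then reg s4 31 else cell s4 v i))"
      have "frame s1 (scores_region \<union> cells v) s" by (rule frame_trans[OF conjunct1[OF s4] conjunct1[OF s]]) auto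
      then show "Q s" unfolding Q_def using s s4 c4 by (intro conjI bexI[of _ "reg s4 31"]) auto
    qed simp
  qed
  have a6: "triple [Arith Plus 14 14 16] s5 1 (vertex_post s0)" if s5: "Q s5" for s5
  proof (rule triple_execI)
    fix s' assume s': "s' = exec_det [Arith Plus 14 14 16] s5"
    have r5: "\<And>r. r < 20 \<Longrightarrow> r \<noteq> 17 \<Longrightarrow> reg s5 r = reg s0 r" using s5 e1 by (simp add: Q_def frame_def)
    have "Suc (reg s0 14) mod 2 ^ w = Suc (reg s0 14)"
      using s0 s0' by (intro mod_w) (simp add: addr_defs)
    then have e: "mem s' = mem s5" "\<And>r. r \<noteq> 14 \<Longrightarrow> reg s' r = reg s5 r" "reg s' 14 = Suc (reg s0 14)" "queries s' = queries s5"
      unfolding s' using r5 s0'(1) by (simp_all add: regs_ok_def)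
    have "\<forall>a. a \<notin> cells v \<longrightarrow> a \<notin> scores_region \<longrightarrow> mem s' a = mem s0 a"
      using s5 e1(1) unfolding Q_def frame_def e(1) by auto
    moreover have "queries s' = queries s0" using s5 e1(4) unfolding Q_def frame_def e(4) by simp
    ultimately show "vertex_post s0 s'"
      unfolding vertex_post_def Let_def v_def[symmetric] using e(2,3) r5 s5 unfolding Q_def e(1) by auto
  qed simp_all
  have "triple vertex_prog s0 (2 + ((k * 7 + 3) + ((S * 17 + 3) + ((k * 9 + 6) + ((k * 12 + 6) + 1))))) (vertex_post s0)"
    unfolding vertex_prog_def
    by (rule triple_append[OF a1], hypsubst, rule triple_append[OF a2], rule triple_append[OF a3], assumption,
        rule triple_append[OF a4], assumption, rule triple_append[OF a5], assumption, rule a6)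
  then show ?thesis by (rule triple_mono) auto
qed

end

section \<open>Batches and rounds\<close>

definition batch_prog :: "instr list" where
  "batch_prog = sample_prog @ [Arith Plus 15 14 13, Arith Less 20 11 15,
     Cond 20 [Const 33 0, Arith Plus 15 11 33] [], Arith Less 18 14 15] @
     [While 18 (vertex_prog @ [Arith Less 18 14 15])]"

context sampling_algorithm
begin

abbreviation "len s \<equiv> reg s 11"

text \<open>\<open>s0\<close> is the state at the start of the batches of the round.\<close>
definition round_inv :: "state \<Rightarrow> state \<Rightarrow> bool" where
  "round_inv s0 s \<longleftrightarrow> state_inv s \<and> reg s 12 = reg s0 12 \<and> reg s 13 = reg s0 13 \<and> len s = len s0 \<and> todo s = todo s0 \<and> opened s = opened s0 \<and>
    reps_extend s0 s \<and> reg s 14 \<le> len s0 \<and>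
    (\<forall>q<len s0. reg s 14 \<le> q \<longrightarrow> (\<forall>i<k. cell s (todo s0 ! q) i = cell s0 (todo s0 ! q) i)) \<and>
    (\<forall>u<n. u \<notin> set (todo s0) \<longrightarrow> (\<forall>i<k. cell s u i = cell s0 u i)) \<and>
    (\<forall>q<reg s 14. (\<forall>i<k. cell s (todo s0 ! q) i = reg s0 12) \<or> (\<forall>i<k. cell s (todo s0 ! q) i \<noteq> reg s0 12))"

definition round_good :: "state \<Rightarrow> state \<Rightarrow> bool" where
  "round_good s0 s \<longleftrightarrow> (\<forall>c. consistent c s \<longrightarrow> move_inv k \<gamma> (set (todo s0)) (hybrid c s0) (hybrid c s))"

definition large_slot :: "state \<Rightarrow> bool" where
  "large_slot s \<longleftrightarrow> (\<forall>c. consistent c s \<longrightarrow>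
     card (set (todo s)) \<le> 2 * k * card {u \<in> set (todo s). hybrid c s u = reg s 12})"

text \<open>The link between the state \<open>sx\<close> in which a batch was sampled and a later state \<open>s\<close> of the batch
  that starts at position \<open>p0\<close>.\<close>
definition batch_link :: "state \<Rightarrow> nat \<Rightarrow> state \<Rightarrow> bool" where
  "batch_link sx p0 s \<longleftrightarrow> todo s = todo sx \<and> p0 \<le> reg s 14 \<and> reg s 14 \<le> len sx \<and> set (samples s) \<subseteq> {..<n} \<and>
    (\<forall>j<S. mem s (LB + j) \<in> opened s \<and> (\<forall>c. consistent c s \<longrightarrow> mem s (LB + j) = hybrid c sx (mem s (SB + j)))) \<and>
    (\<forall>q<len sx. q < p0 \<or> reg s 14 \<le> q \<longrightarrow> (\<forall>i<k. cell s (todo sx ! q) i = cell sx (todo sx ! q) i)) \<and>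
    (\<forall>u<n. u \<notin> set (todo sx) \<longrightarrow> (\<forall>i<k. cell s u i = cell sx u i))"

lemma todo_length: "length (todo s) = len s"
  by (simp add: todo_def)

text \<open>Scanning a vertex asks no queries, so the representatives, and with them the consistent
  namings, do not change.\<close>

lemma vertex_post_facts:
  assumes w: "state_inv s" "reg s 14 < len s" and vp: "vertex_post s s'"
  defines "v \<equiv> todo s ! reg s 14"
  shows "v \<in> set (todo s)" "v < n" "state_inv s'" "todo s' = todo s" "opened s' = opened s" "reps_extend s s'" "\<And>c. consistent c s' \<longleftrightarrow> consistent c s"
    "\<And>u i. u < n \<Longrightarrow> i < k \<Longrightarrow> u \<noteq> v \<Longrightarrow> cell s' u i = cell s u i"
    "\<And>a. NK \<le> a \<Longrightarrow> a \<notin> scores_region \<Longrightarrow> mem s' a = mem s a"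
proof -
  show vw: "v \<in> set (todo s)" unfolding v_def using w(2) by (intro nth_mem) (simp add: todo_length)
  then show vn: "v < n" using w(1) unfolding state_inv_def by blast
  have m: "mem s' a = mem s a" if "a \<notin> cells v" "a \<notin> scores_region" for a
    using vp that unfolding vertex_post_def Let_def v_def by blast
  show mNK: "mem s' a = mem s a" if "NK \<le> a" "a \<notin> scores_region" for a
    using m[of a] cells_subset[OF vn] that by fastforce
  show cu: "cell s' u i = cell s u i" if "u < n" "i < k" "u \<noteq> v" for u i
  proof (rule m)
    show "u + n * i \<notin> cells v" using that cell_inj[OF that(1) vn] by (auto simp: cells_def)
    show "u + n * i \<notin> scores_region" using cell_lt[OF that(1,2)] by (simp add: addr_defs)
  qed
  have rg: "reg s' r = reg s r" if "r < 20" "r \<noteq> 14" "r \<noteq> 17" for r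
    using vp that unfolding vertex_post_def by blast
  have ro: "regs_ok s'" using w(1) rg unfolding state_inv_def regs_ok_def by simp
  have b: "base s' i = base s i" for i by (rule mNK) (auto simp: addr_defs)
  show op: "opened s' = opened s" by (simp add: opened_def b)
  show todo: "todo s' = todo s" unfolding todo_def using rg[of 11] w
    by (auto simp: state_inv_def addr_defs intro!: mNK)
  have rp: "mem s' (RB + i) = mem s (RB + i)" for i by (rule mNK) (auto simp: addr_defs)
  have r10: "reg s' 10 = reg s 10" by (rule rg) auto
  show "consistent c s' \<longleftrightarrow> consistent c s" for c unfolding consistent_def r10 rp ..
  have rok: "reps_ok s'" using w(1) unfolding state_inv_def reps_ok_def r10 rp by blast
  then show "reps_extend s s'" unfolding reps_extend_def r10 rp by simp
  obtain g where g: "g \<in> opened s"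
    "\<forall>i<k. cell s' v i = (if g = reg s 12 \<or> cell s v i = reg s 12 then g else cell s v i)"
    using vp unfolding vertex_post_def Let_def v_def[symmetric] by blast
  have cv: "cell s' v i \<in> opened s" if "i < k" for i
    using g that w(1) vw unfolding state_inv_def by auto
  have opk: "x < k" if "x \<in> opened s" for x using that by (simp add: opened_def)
  have "\<forall>x<n. \<forall>i<k. cell s' x i < k"
    using cv cu opk w(1) unfolding state_inv_def by (metis (no_types))
  moreover have "\<forall>x\<in>set (todo s). \<forall>i<k. cell s' x i \<in> opened s"
    using cv cu w(1) unfolding state_inv_def by (metis (no_types) lessThan_iff subsetD)
  moreover have "\<forall>x<n. x \<notin> set (todo s) \<longrightarrow> (\<exists>j. j \<notin> opened s \<and> (\<forall>i<k. cell s' x i = j))"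
  proof (intro allI impI)
    fix x assume x: "x < n" "x \<notin> set (todo s)"
    then have "x \<noteq> v" using vw by blast
    with x w(1) cu show "\<exists>j. j \<notin> opened s \<and> (\<forall>i<k. cell s' x i = j)" unfolding state_inv_def by simp
  qed
  ultimately show "state_inv s'" using w(1) ro rok rg[of 11] unfolding state_inv_def op todo b by simp
qed

lemma round_inv_vertex:
  assumes round_inv: "round_inv s0 s" and p: "reg s 14 < len s" and vp: "vertex_post s s'"
  shows "round_inv s0 s'"
proof -
  have w: "state_inv s" using round_inv by (simp add: round_inv_def)
  note f = vertex_post_facts[OF w p vp]
  let ?v = "todo s ! reg s 14"
  have eq: "todo s = todo s0" "len s = len s0" "opened s = opened s0" "reg s 12 = reg s0 12" using round_inv by (auto simp: round_inv_def)
  have rg: "reg s' r = reg s r" if "r < 20" "r \<noteq> 14" "r \<noteq> 17" for r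
    using vp that unfolding vertex_post_def by blast
  have r14: "reg s' 14 = Suc (reg s 14)" using vp unfolding vertex_post_def by blast
  have nth_ne: "todo s ! q \<noteq> ?v" "todo s ! q < n" if "q < len s" "q \<noteq> reg s 14" for q
  proof -
    show "todo s ! q \<noteq> ?v" using that p w by (simp add: state_inv_def nth_eq_iff_index_eq todo_length)
    have "todo s ! q \<in> set (todo s)" using that by (intro nth_mem) (simp add: todo_length)
    then show "todo s ! q < n" using w unfolding state_inv_def by blast
  qed
  obtain g where g: "\<forall>i<k. cell s' ?v i = (if g = reg s 12 \<or> cell s ?v i = reg s 12 then g else cell s ?v i)"
    using vp unfolding vertex_post_def Let_def by blast
  \<comment> \<open>If \<open>g\<close> is the slot of the round, all cells become equal to it;
    otherwise the cells equal to it are overwritten by \<open>g\<close>. Either way the decision for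
    this slot no longer depends on the naming.\<close>
  have pv: "(\<forall>i<k. cell s' ?v i = reg s0 12) \<or> (\<forall>i<k. cell s' ?v i \<noteq> reg s0 12)"
    using g eq(4) by auto
  have "\<forall>q<len s0. reg s' 14 \<le> q \<longrightarrow> (\<forall>i<k. cell s' (todo s0 ! q) i = cell s0 (todo s0 ! q) i)"
  proof (intro allI impI)
    fix q i assume q: "q < len s0" "reg s' 14 \<le> q" "i < k"
    have "cell s' (todo s ! q) i = cell s (todo s ! q) i"
      using f(8)[OF nth_ne(2) q(3) nth_ne(1)] q r14 eq by simp
    then show "cell s' (todo s0 ! q) i = cell s0 (todo s0 ! q) i" using round_inv q r14 unfolding round_inv_def eq(1) by simp
  qed
  moreover have "\<forall>u<n. u \<notin> set (todo s0) \<longrightarrow> (\<forall>i<k. cell s' u i = cell s0 u i)"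
  proof (intro allI impI)
    fix u i assume u: "u < n" "u \<notin> set (todo s0)" "i < k"
    then have "u \<noteq> ?v" using f(1) eq by metis
    then show "cell s' u i = cell s0 u i" using f(8)[OF u(1,3)] round_inv u unfolding round_inv_def by simp
  qed
  moreover have "\<forall>q<reg s' 14. (\<forall>i<k. cell s' (todo s0 ! q) i = reg s0 12) \<or> (\<forall>i<k. cell s' (todo s0 ! q) i \<noteq> reg s0 12)"
  proof (intro allI impI)
    fix q assume "q < reg s' 14"
    then consider "q = reg s 14" | "q < reg s 14" using r14 by linarith
    then show "(\<forall>i<k. cell s' (todo s0 ! q) i = reg s0 12) \<or> (\<forall>i<k. cell s' (todo s0 ! q) i \<noteq> reg s0 12)"
    proof cases
      case 1 then show ?thesis using pv eq by simp
    next
      case 2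
      then have "\<And>i. i < k \<Longrightarrow> cell s' (todo s ! q) i = cell s (todo s ! q) i" using f(8)[OF nth_ne(2) _ nth_ne(1)] p by simp
      then show ?thesis using round_inv 2 unfolding round_inv_def eq(1) by auto
    qed
  qed
  moreover have "reps_extend s0 s'" using round_inv f(6) reps_extend_trans unfolding round_inv_def by blast
  ultimately show ?thesis
    using f(3-5) rg eq p r14 round_inv unfolding round_inv_def by simp
qed

lemma batch_link_vertex:
  assumes batch_link: "batch_link sx p0 s" and w: "state_inv s" and p: "reg s 14 < len s" and vp: "vertex_post s s'"
  shows "batch_link sx p0 s'" "samples s' = samples s"
proof -
  note f = vertex_post_facts[OF w p vp]
  let ?v = "todo s ! reg s 14"
  have r14: "reg s' 14 = Suc (reg s 14)" using vp unfolding vertex_post_def by blast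
  have mS: "mem s' (SB + j) = mem s (SB + j)" "mem s' (LB + j) = mem s (LB + j)" if "j < S" for j
    using that by (auto intro!: f(9) simp: addr_defs)
  show sm: "samples s' = samples s" unfolding samples_def using mS by simp
  have eq: "todo s = todo sx" using batch_link by (simp add: batch_link_def)
  then have len: "len s = len sx" using todo_length by metis
  have c1: "cell s' (todo sx ! q) i = cell sx (todo sx ! q) i" if q: "q < len sx" "q < p0 \<or> reg s' 14 \<le> q" "i < k" for q i
  proof -
    have ne: "q \<noteq> reg s 14" using batch_link q r14 unfolding batch_link_def by auto
    have "todo s ! q \<noteq> ?v" using q ne p w len by (simp add: state_inv_def nth_eq_iff_index_eq todo_length)
    moreover have "todo s ! q \<in> set (todo s)" using q len by (intro nth_mem) (simp add: todo_length)
    then have "todo s ! q < n" using w unfolding state_inv_def by blast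
    ultimately have "cell s' (todo s ! q) i = cell s (todo s ! q) i" using f(8) q(3) by blast
    then show ?thesis using batch_link q r14 unfolding batch_link_def eq by auto
  qed
  have c2: "cell s' u i = cell sx u i" if u: "u < n" "u \<notin> set (todo sx)" "i < k" for u i
  proof -
    have "u \<noteq> ?v" using f(1) u eq by metis
    then show ?thesis using f(8)[OF u(1,3)] batch_link u unfolding batch_link_def by simp
  qed
  show "batch_link sx p0 s'"
    using batch_link c1 c2 p r14 len mS f(4,5,7) unfolding batch_link_def sm by (simp add: less_Suc_eq_le)
qed

text \<open>For a consistent naming the stored slots are the true slots of the samples at the time
  \<open>sx\<close> of the draw, so \<open>estimate\<close> is one of the sample sums controlled by
  \<open>good\<close>. The comparison is with the balance at \<open>sx\<close>, not with the current
  one.\<close>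

lemma estimate_close:
  assumes batch_link: "batch_link sx p0 s" and gd: "good sx (samples s)" and c: "consistent c s" and v: "v < n" and i: "i < k"
  shows "\<bar>real_of_int (estimate s v i) / real S - real_of_int (balance (hybrid c sx) (set (todo sx)) v i) / real (card (set (todo sx)))\<bar> \<le> \<gamma> / 4"
proof -
  have "sum_list (map (sample_fun sx c i v) (samples s)) = (\<Sum>j<S. sample_fun sx c i v (mem s (SB + j)))"
    by (simp add: samples_def comp_def interv_sum_list_conv_sum_set_nat atLeast0LessThan)
  also have "\<dots> = real_of_int (estimate s v i)"
    unfolding estimate_def of_int_sum by (rule sum.cong) (use batch_link c v in \<open>auto simp: sample_fun_def batch_link_def\<close>)
  finally have a: "sum_list (map (sample_fun sx c i v) (samples s)) = real_of_int (estimate s v i)" .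
  have b: "(\<Sum>u\<in>set (todo sx). sample_fun sx c i v u) = real_of_int (balance (hybrid c sx) (set (todo sx)) v i)"
    unfolding balance_def of_int_sum by (rule sum.cong) (use v in \<open>auto simp: sample_fun_def\<close>)
  have "c \<in> labelings" using c by (simp add: consistent_def)
  then have "(c, i, v) \<in> labelings \<times> {..<k} \<times> {..n}" using v i by simp
  with gd have "(\<lambda>(c, i, v). \<bar>sum_list (map (sample_fun sx c i v) (samples s)) / real S - (\<Sum>u\<in>set (todo sx). sample_fun sx c i v u) / real (card (set (todo sx)))\<bar> \<le> \<gamma> / 4) (c, i, v)"
    unfolding good_def by (rule bspec)
  then show ?thesis by (simp add: a b)
qed

text \<open>The estimates of the old slot and of \<open>g\<close> are each off by a quarter of
  \<open>\<gamma> * card W\<close>, and each of the two balances has drifted by at most another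
  quarter since the sample was taken.\<close>

lemma round_good_vertex:
  assumes round_inv: "round_inv s0 s" and p: "reg s 14 < len s" and vp: "vertex_post s s'" and batch_link: "batch_link sx p0 s" and gd: "good sx (samples s)"
    and batch: "(reg s 14 - p0) * m \<le> len s" and lg: "large_slot s0" and L: "reg s0 12 \<in> opened s0" and round_good: "round_good s0 s" and w0: "state_inv s0"
  shows "round_good s0 s'"
  unfolding round_good_def
proof (intro allI impI)
  fix c assume c': "consistent c s'"
  have w: "state_inv s" using round_inv by (simp add: round_inv_def)
  note f = vertex_post_facts[OF w p vp]
  define v where "v = todo s ! reg s 14"
  let ?W = "set (todo s0)"
  have eq: "todo s = todo s0" "len s = len s0" "opened s = opened s0" "reg s 12 = reg s0 12" "todo sx = todo s0"
    using round_inv batch_link by (auto simp: round_inv_def batch_link_def)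
  have c: "consistent c s" using c' f(7) by blast
  have c0: "consistent c s0" using c round_inv reps_extend_consistent unfolding round_inv_def by blast
  have cl: "c u < k" if "u < n" for u using c labelings_lt that unfolding consistent_def by blast
  have Wn: "?W \<subseteq> {..<n}" using w unfolding state_inv_def eq by blast
  have vW: "v \<in> ?W" "v < n" using f(1,2) unfolding v_def eq by auto
  obtain g where g: "g \<in> opened s" "\<forall>i\<in>opened s. estimate s v i \<le> estimate s v g"
    "\<forall>i<k. cell s' v i = (if g = reg s 12 \<or> cell s v i = reg s 12 then g else cell s v i)"
    using vp unfolding vertex_post_def Let_def v_def[symmetric] by blast
  have wpos: "0 < card ?W" using vW by (auto simp: card_gt_0_iff)
  have cW: "card ?W = len s0" using w eq todo_length[of s] by (simp add: state_inv_def distinct_card)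
  show "move_inv k \<gamma> ?W (hybrid c s0) (hybrid c s')"
  proof (rule move_inv_step[where v = v and f = "hybrid c s" and g = g and L = "reg s0 12" and Op = "opened s0"])
    show "?W \<subseteq> {..<n}" "v \<in> ?W" by (rule Wn, rule vW(1))
    show "hybrid c s v = hybrid c s0 v"
      using round_inv p cl[OF vW(2)] vW(2) unfolding hybrid_def v_def round_inv_def by auto
    show "move_inv k \<gamma> ?W (hybrid c s0) (hybrid c s)" using round_good c unfolding round_good_def by blast
    show "k \<ge> 1" by (rule k1)
    show "0 < \<gamma>" "\<gamma> \<le> 1 / (32 * real k)" using \<gamma> by simp_all
    show "hybrid c s u = hybrid c s0 u \<and> hybrid c s u \<notin> opened s0" if u: "u < n" "u \<notin> ?W" for u
    proof -
      have "cell s u (c u) = cell s0 u (c u)" using round_inv u cl[OF u(1)] unfolding round_inv_def by blast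
      moreover have "cell s u (c u) \<notin> opened s" using w u cl[OF u(1)] eq unfolding state_inv_def by (metis (no_types))
      ultimately show ?thesis using u eq by (simp add: hybrid_def)
    qed
    show op: "hybrid c s v \<in> opened s0" using w vW cl[OF vW(2)] unfolding state_inv_def eq hybrid_def by simp
    show "g \<in> opened s0" using g eq by simp
    show "card ?W \<le> 2 * k * card {u \<in> ?W. hybrid c s0 u = reg s0 12}" using lg c0 unfolding large_slot_def by blast
    show "real_of_int (balance (hybrid c s) ?W v (hybrid c s v)) - \<gamma> * real (card ?W) \<le> real_of_int (balance (hybrid c s) ?W v g)"
    proof -
      define i where "i = hybrid c s v"
      have io: "i \<in> opened s" using op eq by (simp add: i_def)
      have ik: "i < k" "g < k" using io g by (auto simp: opened_def)
      let ?b = "\<lambda>i. real_of_int (balance (hybrid c sx) ?W v i) / real (card ?W)"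
      have "real_of_int (estimate s v i) / real S \<le> real_of_int (estimate s v g) / real S"
        using g(2) io by (intro divide_right_mono) auto
      then have "?b i - ?b g \<le> \<gamma> / 2"
        using estimate_close[OF batch_link gd c vW(2) ik(1)] estimate_close[OF batch_link gd c vW(2) ik(2)] unfolding eq by linarith
      then have b1: "real_of_int (balance (hybrid c sx) ?W v i) - real_of_int (balance (hybrid c sx) ?W v g) \<le> \<gamma> / 2 * real (card ?W)"
      proof -
        have "?b i - ?b g = (real_of_int (balance (hybrid c sx) ?W v i) - real_of_int (balance (hybrid c sx) ?W v g)) / real (card ?W)"
          by (simp add: diff_divide_distrib)
        with \<open>?b i - ?b g \<le> \<gamma> / 2\<close> show ?thesis using wpos by (simp only: pos_divide_le_eq of_nat_0_less_iff)
      qed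
      \<comment> \<open>Only vertices already scanned in this batch can have moved since the
        draw.\<close>
      define D where "D = (!) (todo s) ` {p0..<reg s 14}"
      have D: "D \<subseteq> ?W" "card D \<le> reg s 14 - p0"
        using p unfolding D_def eq(1)[symmetric] by (auto simp: todo_length intro!: card_image_le[THEN order_trans])
      have "hybrid c sx u = hybrid c s u" if u: "u \<in> ?W" "u \<notin> D" for u
      proof -
        have un: "u < n" using u Wn by auto
        obtain q where q: "q < len s" "u = todo s ! q" using u eq todo_length by (metis in_set_conv_nth)
        have "q < p0 \<or> reg s 14 \<le> q" using u(2) q unfolding D_def by (metis atLeastLessThan_iff image_eqI not_le)
        then have "cell s u (c u) = cell sx u (c u)" using batch_link q cl[OF un] todo_length eq unfolding batch_link_def by metis
        then show ?thesis by (simp add: hybrid_def)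
      qed
      then have bd: "\<bar>balance (hybrid c sx) ?W v x - balance (hybrid c s) ?W v x\<bar> \<le> int (card D)" for x
        using D(1) by (intro balance_diff) auto
      have "real (card D) * 4 \<le> \<gamma> * real (card ?W)"
      proof -
        have "card D * m \<le> len s" using D(2) batch mult_le_mono1 order_trans by blast
        then have "real (card D) * real m \<le> real (card ?W)" using cW eq by (metis of_nat_le_iff of_nat_mult)
        then have "\<gamma> * (real (card D) * real m) \<le> \<gamma> * real (card ?W)" using \<gamma> by (intro mult_left_mono) auto
        moreover have "real (card D) * 4 \<le> real (card D) * (\<gamma> * real m)" using \<gamma> by (intro mult_left_mono) auto
        ultimately show ?thesis by (simp add: mult_ac)
      qed
      then show ?thesis using b1 bd[of i] bd[of g] unfolding i_def[symmetric] by linarith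
    qed
    show "hybrid c s' = (hybrid c s)(v := if g = reg s0 12 \<or> hybrid c s v = reg s0 12 then g else hybrid c s v)"
    proof
      fix u show "hybrid c s' u = ((hybrid c s)(v := if g = reg s0 12 \<or> hybrid c s v = reg s0 12 then g else hybrid c s v)) u"
      proof (cases "u = v")
        case True
        then show ?thesis using g(3) vW(2) cl[OF vW(2)] eq by (simp add: hybrid_def)
      next
        case False
        then show ?thesis using f(8)[of u "c u"] cl[of u] by (simp add: hybrid_def v_def)
      qed
    qed
  qed
qed


text \<open>The flag concerns the start only, so it may be assumed inside the final property and
  carried along through a composition whose intermediate flags are different.\<close>

lemma prob_triple_cond: "prob_triple is s T R g (\<lambda>s'. g \<longrightarrow> Q s') p \<Longrightarrow> prob_triple is s T R g Q p"
  by (cases g) (auto simp: prob_triple_def)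

text \<open>Register 15 and those from 17 on are bookkeeping that no invariant reads; agreement of
  the memory and the other registers transfers all invariants.\<close>

definition same_core :: "state \<Rightarrow> state \<Rightarrow> bool" where
  "same_core s s' \<longleftrightarrow> mem s' = mem s \<and> (\<forall>r<15. reg s' r = reg s r) \<and> reg s' 16 = reg s 16"

lemma same_core_facts:
  assumes "same_core s s'"
  shows "todo s' = todo s" "opened s' = opened s" "consistent c s' \<longleftrightarrow> consistent c s" "hybrid c s' = hybrid c s" "samples s' = samples s"
    "state_inv s' \<longleftrightarrow> state_inv s" "round_inv s0 s' \<longleftrightarrow> round_inv s0 s" "round_good s0 s' \<longleftrightarrow> round_good s0 s" "batch_link sx p0 s' \<longleftrightarrow> batch_link sx p0 s"
proof -
  have m: "mem s' = mem s" and r: "\<And>r. r < 15 \<Longrightarrow> reg s' r = reg s r" and r16: "reg s' 16 = reg s 16"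
    using assms by (auto simp: same_core_def)
  show todo: "todo s' = todo s" by (simp add: todo_def m r)
  show op: "opened s' = opened s" by (simp add: opened_def m)
  show co: "consistent c s' \<longleftrightarrow> consistent c s" for c by (simp add: consistent_def m r)
  show h: "hybrid c s' = hybrid c s" for c by (simp add: hybrid_def m fun_eq_iff)
  show sm: "samples s' = samples s" by (simp add: samples_def m)
  show wi: "state_inv s' \<longleftrightarrow> state_inv s" by (simp add: state_inv_def todo op m r r16 regs_ok_def reps_ok_def)
  show "round_inv s0 s' \<longleftrightarrow> round_inv s0 s" by (simp add: round_inv_def todo op m r wi reps_extend_def reps_ok_def)
  show "round_good s0 s' \<longleftrightarrow> round_good s0 s" by (simp add: round_good_def co h)
  show "batch_link sx p0 s' \<longleftrightarrow> batch_link sx p0 s" by (simp add: batch_link_def todo op m r sm co)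
qed

text \<open>Sampling moves no vertex. It may discover representatives, which only shrinks the set of
  consistent namings.\<close>

lemma sampled_start:
  assumes w: "state_inv sx" and sm: "sampled sx s"
  shows "batch_link sx (reg sx 14) s \<or> reg sx 14 > len sx" "\<And>c. consistent c s \<Longrightarrow> hybrid c s = hybrid c sx"
    "round_inv s0 sx \<Longrightarrow> round_inv s0 s" "round_good s0 sx \<Longrightarrow> round_good s0 s"
proof -
  note f = sampled_state_inv[OF w sm]
  have rg: "reg s r = reg sx r" if "r < 20" "r \<noteq> 10" for r using sm that unfolding sampled_def by blast
  have ext: "reps_extend sx s" using sm unfolding sampled_def by blast
  show "batch_link sx (reg sx 14) s \<or> reg sx 14 > len sx"
  proof (cases "reg sx 14 \<le> len sx")
    case True
    have n1: "todo sx ! q < n" if "q < len sx" for q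
      using that w nth_mem[of q "todo sx"] unfolding state_inv_def todo_length by blast
    have "set (samples s) \<subseteq> {..<n}" using sm w unfolding sampled_def state_inv_def by blast
    then show ?thesis using True f rg[of 14] n1 sm unfolding batch_link_def sampled_def by simp
  qed auto
  show h: "hybrid c s = hybrid c sx" if "consistent c s" for c
  proof
    fix u
    have "c u < k" if "u < n" using \<open>consistent c s\<close> labelings_lt that unfolding consistent_def by blast
    then show "hybrid c s u = hybrid c sx u" using f(4) by (simp add: hybrid_def)
  qed
  show "round_good s0 s" if "round_good s0 sx"
    using that h reps_extend_consistent[OF ext] unfolding round_good_def by simp
  show "round_inv s0 s" if round_inv: "round_inv s0 sx"
  proof -
    have wn: "todo s0 ! q < n" if "q < len s0" for q
    proof -
      have "todo s0 ! q \<in> set (todo s0)" using that by (simp add: todo_length)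
      then show ?thesis using round_inv unfolding round_inv_def state_inv_def by auto
    qed
    have "reps_extend s0 s" using round_inv ext reps_extend_trans unfolding round_inv_def by blast
    moreover have "\<forall>q<reg s 14. (\<forall>i<k. cell s (todo s0 ! q) i = reg s0 12) \<or> (\<forall>i<k. cell s (todo s0 ! q) i \<noteq> reg s0 12)"
    proof (intro allI impI)
      fix q assume "q < reg s 14"
      then have q: "q < reg sx 14" "q < len s0" using rg[of 14] round_inv unfolding round_inv_def by auto
      then show "(\<forall>i<k. cell s (todo s0 ! q) i = reg s0 12) \<or> (\<forall>i<k. cell s (todo s0 ! q) i \<noteq> reg s0 12)"
        using round_inv f(4)[OF wn[OF q(2)]] unfolding round_inv_def by auto
    qed
    ultimately show ?thesis
      using round_inv f rg wn unfolding round_inv_def by simp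
  qed
qed

lemma batch_ok:
  assumes w0: "state_inv s0" and round_inv: "round_inv s0 sx" and p: "reg sx 14 < len sx" and bs: "reg s0 13 = len s0 div m + 1"
    and L: "reg s0 12 \<in> opened s0"
  shows "prob_triple batch_prog sx (S * (k * 12 + 21) + 13 + (len s0 div m + 1) * (S * 17 + k * 28 + 23))
     (\<lambda>s. round_inv s0 s \<and> reg s 14 = min (reg sx 14 + reg s0 13) (len s0) \<and> queries s \<le> queries sx + S * k)
     (large_slot s0 \<and> round_good s0 sx) (round_good s0) pfail"
proof -
  define e where "e = min (reg sx 14 + reg s0 13) (len s0)"
  define p0 where "p0 = reg sx 14"
  define g where "g \<longleftrightarrow> large_slot s0 \<and> round_good s0 sx"
  let ?C = "[Arith Plus 15 14 13, Arith Less 20 11 15, Cond 20 [Const 33 0, Arith Plus 15 11 33] [], Arith Less 18 14 15]"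
  let ?loop = "[While 18 (vertex_prog @ [Arith Less 18 14 15])]"
  have w: "state_inv sx" and len: "len sx = len s0" "reg sx 13 = reg s0 13" "todo sx = todo s0" using round_inv by (auto simp: round_inv_def)
  have lenn: "len s0 \<le> n" using w len unfolding state_inv_def by simp
  have bs0: "0 < reg s0 13" using bs by simp
  have divn: "len s0 div m \<le> n" using lenn div_le_dividend le_trans by blast
  have p0e: "p0 < e" "e \<le> len s0" "e - p0 \<le> len s0 div m + 1" using p len bs by (auto simp: p0_def e_def)
  have rest: "triple (?C @ ?loop) s1 (6 + ((e - p0 - 0) * Suc (S * 17 + k * 28 + 22) + 1)) (\<lambda>s. round_inv s0 s \<and> reg s 14 = e \<and> queries s \<le> queries sx + S * k \<and>
      (good sx (samples s1) \<and> g \<longrightarrow> round_good s0 s))" if sm: "sampled sx s1" for s1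
  proof -
    define I where "I t s \<longleftrightarrow> round_inv s0 s \<and> batch_link sx p0 s \<and> reg s 14 = p0 + t \<and> reg s 15 = e \<and> reg s 18 = of_bool (p0 + t < e) \<and>
      queries s \<le> queries sx + S * k \<and> samples s = samples s1 \<and> (good sx (samples s1) \<and> g \<longrightarrow> round_good s0 s)" for t s
    note st = sampled_start[OF w sm]
    have rg: "reg s1 r = reg sx r" if "r < 20" "r \<noteq> 10" for r using sm that unfolding sampled_def by blast
    have C: "triple ?C s1 6 (I 0)"
    proof (rule triple_execI)
      fix s2 assume s2: "s2 = exec_det ?C s1"
      have md: "(p0 + reg s0 13) mod 2 ^ w = p0 + reg s0 13" "len s0 mod 2 ^ w = len s0"
        using p0e lenn divn bs by (auto intro!: mod_w simp: addr_defs)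
      have r1: "reg s1 14 = p0" "reg s1 13 = reg s0 13" "reg s1 11 = len s0" using rg len by (auto simp: p0_def)
      have e2: "mem s2 = mem s1" "\<And>r. r < 15 \<Longrightarrow> reg s2 r = reg s1 r" "reg s2 16 = reg s1 16" "queries s2 = queries s1"
        unfolding s2 by (auto simp: r1 md mod_of_bool)
      have e3: "reg s2 15 = e" "reg s2 18 = of_bool (p0 < e)"
        unfolding s2 using p0e(1,2) bs0 by (auto simp: r1 md mod_of_bool e_def p0_def[symmetric] min_def)
      have ev: "same_core s1 s2" unfolding same_core_def using e2(1-3) by simp
      note ef = same_core_facts[OF ev]
      have "batch_link sx p0 s1" using st(1) p unfolding p0_def by linarith
      moreover have "queries s2 \<le> queries sx + S * k" using sm e2(4) unfolding sampled_def by simp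
      moreover have "reg s2 14 = p0" using e2(2)[of 14] r1 by simp
      ultimately show "I 0 s2" unfolding I_def using ef st(3)[OF round_inv] st(4) e3 by (simp add: g_def)
    qed simp_all
    have "triple (?C @ ?loop) s1 (6 + ((e - p0 - 0) * Suc (S * 17 + k * 28 + 22) + 1)) (\<lambda>s. \<exists>j\<le>e - p0. I j s \<and> reg s 18 = 0)"
    proof (rule triple_append[OF C], rule triple_while[where I = I])
      show "reg s 18 = 0" if "I (e - p0) s" for s using that p0e by (simp add: I_def)
      fix t s assume t: "t < e - p0" and inv: "I t s" and "reg s 18 \<noteq> 0"
      have inv': "round_inv s0 s" "batch_link sx p0 s" "reg s 14 = p0 + t" "state_inv s" "len s = len s0" using inv by (auto simp: I_def round_inv_def)
      have lt: "reg s 14 < len s" using t p0e inv' by simp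
      have v: "triple vertex_prog s (S * 17 + k * 28 + 21) (vertex_post s)"
        by (rule vertex_ok[OF inv'(4) lt]) (use inv'(2) in \<open>auto simp: batch_link_def\<close>)
      have "triple (vertex_prog @ [Arith Less 18 14 15]) s (S * 17 + k * 28 + 21 + 1) (I (Suc t))"
      proof (rule triple_append[OF v], rule triple_execI)
        fix s3 s4 assume vp: "vertex_post s s3" and s4: "s4 = exec_det [Arith Less 18 14 15] s3"
        have r3: "reg s3 14 = Suc (p0 + t)" "reg s3 15 = e" "queries s3 = queries s"
          using vp inv unfolding vertex_post_def I_def by auto
        have e4: "same_core s3 s4" "reg s4 18 = of_bool (Suc (p0 + t) < e)" "queries s4 = queries s3" "reg s4 15 = e" "reg s4 14 = Suc (p0 + t)"
          unfolding s4 same_core_def using r3 by (auto simp: mod_of_bool)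
        note ef = same_core_facts[OF e4(1)]
        \<comment> \<open>At offset \<open>t\<close> only the \<open>t\<close> earlier vertices of
          the batch can have moved. The current one is excluded, so the batch size
          \<open>len s0 div m + 1\<close> still gives \<open>t \<le> len s0 div m\<close>.\<close>
        have "(p0 + t - p0) * m \<le> len s"
        proof -
          have "t \<le> len s0 div m" using t p0e(3) by simp
          then have "t * m \<le> len s0 div m * m" by (rule mult_le_mono1)
          also have "\<dots> \<le> len s0" by simp
          finally show ?thesis using inv' by simp
        qed
        then have "round_good s0 s3" if "good sx (samples s1)" g
          using round_good_vertex[OF inv'(1) lt vp inv'(2), unfolded inv'(3)] that inv L w0 by (simp add: I_def g_def)
        then show "I (Suc t) s4"
          using round_inv_vertex[OF inv'(1) lt vp] batch_link_vertex[OF inv'(2,4) lt vp] e4 r3 inv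
          unfolding I_def ef by auto
      qed simp_all
      then show "triple (vertex_prog @ [Arith Less 18 14 15]) s (S * 17 + k * 28 + 22) (I (Suc t))"
        by (rule triple_mono) auto
    qed (use p0e in auto)
    then show ?thesis
      by (rule triple_mono) (use p0e in \<open>auto simp: I_def split: if_splits\<close>)
  qed
  have "prob_triple (sample_prog @ (?C @ ?loop)) sx ((S * (k * 12 + 21) + 6) + (6 + ((e - p0 - 0) * Suc (S * 17 + k * 28 + 22) + 1)))
     (\<lambda>s. round_inv s0 s \<and> reg s 14 = e \<and> queries s \<le> queries sx + S * k) g (\<lambda>s. g \<longrightarrow> round_good s0 s) (pfail + 0)"
  proof (rule prob_triple_append[OF sample_ok[OF w]])
    fix s1 assume sm: "sampled sx s1"
    show "prob_triple (?C @ ?loop) s1 (6 + ((e - p0 - 0) * Suc (S * 17 + k * 28 + 22) + 1))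
        (\<lambda>s. round_inv s0 s \<and> reg s 14 = e \<and> queries s \<le> queries sx + S * k) (good sx (samples s1)) (\<lambda>s. g \<longrightarrow> round_good s0 s) 0"
      by (rule triple_imp_prob_triple, rule triple_mono[OF rest[OF sm]]) auto
  qed (use p in auto)
  then have "prob_triple batch_prog sx ((S * (k * 12 + 21) + 6) + (6 + ((e - p0 - 0) * Suc (S * 17 + k * 28 + 22) + 1)))
     (\<lambda>s. round_inv s0 s \<and> reg s 14 = e \<and> queries s \<le> queries sx + S * k) g (round_good s0) (pfail + 0)"
    unfolding batch_prog_def by (rule prob_triple_cond)
  moreover have "(S * (k * 12 + 21) + 6) + (6 + ((e - p0 - 0) * Suc (S * 17 + k * 28 + 22) + 1)) \<le>
    S * (k * 12 + 21) + 13 + (len s0 div m + 1) * (S * 17 + k * 28 + 23)"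
  proof -
    have "(e - p0) * Suc (S * 17 + k * 28 + 22) \<le> (len s0 div m + 1) * Suc (S * 17 + k * 28 + 22)"
      by (rule mult_le_mono1[OF p0e(3)])
    moreover have "Suc (S * 17 + k * 28 + 22) = S * 17 + k * 28 + 23" by simp
    ultimately have "(e - p0) * Suc (S * 17 + k * 28 + 22) \<le> (len s0 div m + 1) * (S * 17 + k * 28 + 23)"
      by (simp only:)
    then show ?thesis unfolding diff_zero by linarith
  qed
  ultimately show ?thesis
    by (elim prob_triple_mono) (simp_all add: g_def e_def)
qed

end

section \<open>Choosing the slot of a round and closing it\<close>

definition compact_body :: "instr list" where
  "compact_body = [Arith Plus 21 4 20, Load 17 21, Load 23 17, Arith Less 27 23 12, Arith Less 28 12 23, Arith Plus 27 27 28,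
     Cond 27 [Arith Plus 21 4 15, Store 21 17, Arith Plus 15 15 16] []]"

definition close_prog :: "instr list" where
  "close_prog = [Arith Plus 21 8 12, Const 22 0, Store 21 22, Const 15 0] @ for_loop 20 11 25 compact_body @
     [Const 33 0, Arith Plus 11 15 33]"

definition choose_prog :: "instr list" where
  "choose_prog = init_scores_prog @ count_prog @ argmax_prog @
     [Const 33 0, Arith Plus 12 31 33, Arith Div 13 11 3, Arith Plus 13 13 16, Const 14 0, Arith Less 19 14 11]"

definition round_prog :: "instr list" where
  "round_prog = sample_prog @ choose_prog @ [While 19 (batch_prog @ [Arith Less 19 14 11])] @ close_prog"

context sampling_algorithm
begin

text \<open>Looking at cell 0 is enough: after the scan a vertex is in the slot of the round under
  every hypothesis or under none.\<close>

definition kept :: "state \<Rightarrow> nat \<Rightarrow> nat list" where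
  "kept s i = filter (\<lambda>v. cell s v 0 \<noteq> reg s 12) (take i (todo s))"

definition compact_inv :: "state \<Rightarrow> nat \<Rightarrow> state \<Rightarrow> bool" where
  "compact_inv s0 i s \<longleftrightarrow> (\<forall>r<20. r \<noteq> 15 \<longrightarrow> r \<noteq> 17 \<longrightarrow> reg s r = reg s0 r) \<and> reg s 15 = length (kept s0 i) \<and> queries s = queries s0 \<and>
    (\<forall>a. a < NK \<or> SB \<le> a \<longrightarrow> mem s a = (if a = BB + reg s0 12 then 0 else mem s0 a)) \<and>
    (\<forall>j<length (kept s0 i). mem s (NK + j) = kept s0 i ! j) \<and>
    (\<forall>q. i \<le> q \<longrightarrow> q < len s0 \<longrightarrow> mem s (NK + q) = todo s0 ! q)"

lemma kept_length: "length (kept s i) \<le> i"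
  unfolding kept_def by (rule order_trans[OF length_filter_le]) simp

lemma kept_Suc: "i < len s \<Longrightarrow> kept s (Suc i) = kept s i @ (if cell s (todo s ! i) 0 \<noteq> reg s 12 then [todo s ! i] else [])"
  by (simp add: kept_def take_Suc_conv_app_nth todo_length)

text \<open>The list is filtered in place. The write position \<open>d\<close> never passes the read
  position \<open>i\<close>, so unread entries are intact.\<close>

lemma compact_step:
  assumes w: "state_inv s0" and L: "reg s0 12 < k" and i: "i < len s0" and inv: "compact_inv s0 i s" and r20: "reg s 20 = i"
  shows "triple compact_body s 10 (\<lambda>s'. compact_inv s0 (Suc i) s' \<and> reg s' 20 = i)"
proof -
  define v where "v = todo s0 ! i"
  define d where "d = length (kept s0 i)"
  have di: "d \<le> i" unfolding d_def by (rule kept_length)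
  have lenn: "len s0 \<le> n" using w by (simp add: state_inv_def)
  have "v \<in> set (todo s0)" unfolding v_def using i by (intro nth_mem) (simp add: todo_length)
  then have vn: "v < n" using w unfolding state_inv_def by blast
  have regs: "reg s 4 = NK" "reg s 12 = reg s0 12" "reg s 15 = d" "reg s 16 = 1"
    using inv w unfolding compact_inv_def state_inv_def regs_ok_def d_def by auto
  have mv: "mem s (NK + i) = v" using inv i unfolding compact_inv_def v_def by simp
  have BL: "NK \<le> BB + reg s0 12" by (simp add: addr_defs)
  have vNK: "v < NK" using vn n_le_NK by simp
  have mc: "mem s v = cell s0 v 0" using inv vNK BL unfolding compact_inv_def by simp
  have md: "(NK + i) mod 2 ^ w = NK + i" "(NK + d) mod 2 ^ w = NK + d" "Suc d mod 2 ^ w = Suc d"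
    using i di lenn n_le_NK by (auto intro!: mod_w simp: addr_defs)
  define b where "b \<longleftrightarrow> cell s0 v 0 \<noteq> reg s0 12"
  show ?thesis
  proof (rule triple_execI)
    fix s' assume s': "s' = exec_det compact_body s"
    have e: "mem s' = (if b then (mem s)(NK + d := v) else mem s)" "\<And>r. r < 21 \<Longrightarrow> r \<noteq> 15 \<Longrightarrow> r \<noteq> 17 \<Longrightarrow> reg s' r = reg s r"
      "queries s' = queries s" "reg s' 15 = (if b then Suc d else d)"
      unfolding s' compact_body_def using r20 regs mv mc md by (simp_all add: mod_of_bool of_bool_neq b_def del: of_bool_eq_iff)
    have kS: "kept s0 (Suc i) = kept s0 i @ (if b then [v] else [])" using kept_Suc[OF i] by (simp add: b_def v_def)
    have "NK + d < SB" using di i lenn by (simp add: SB_def)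
    then have "\<forall>a. a < NK \<or> SB \<le> a \<longrightarrow> mem s' a = (if a = BB + reg s0 12 then 0 else mem s0 a)"
      using inv unfolding compact_inv_def e(1) by auto
    moreover have "\<forall>j<length (kept s0 (Suc i)). mem s' (NK + j) = kept s0 (Suc i) ! j"
      using inv unfolding compact_inv_def e(1) kS by (auto simp: nth_append d_def less_Suc_eq)
    moreover have "\<forall>q. Suc i \<le> q \<longrightarrow> q < len s0 \<longrightarrow> mem s' (NK + q) = todo s0 ! q"
      using inv di unfolding compact_inv_def e(1) by auto
    moreover have "reg s' 15 = length (kept s0 (Suc i))" unfolding e(4) kS d_def by simp
    moreover have "\<forall>r<20. r \<noteq> 15 \<longrightarrow> r \<noteq> 17 \<longrightarrow> reg s' r = reg s0 r" using inv e(2) unfolding compact_inv_def by simp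
    moreover have "queries s' = queries s0" using inv e(3) unfolding compact_inv_def by simp
    ultimately show "compact_inv s0 (Suc i) s' \<and> reg s' 20 = i" using e(2)[of 20] r20 unfolding compact_inv_def by simp
  qed (simp_all add: compact_body_def)
qed

lemma close_ok:
  assumes w: "state_inv s0" and L: "reg s0 12 \<in> opened s0"
    and pr: "\<And>v. v \<in> set (todo s0) \<Longrightarrow> (\<forall>i<k. cell s0 v i = reg s0 12) \<or> (\<forall>i<k. cell s0 v i \<noteq> reg s0 12)"
  shows "triple close_prog s0 (len s0 * 13 + 9) (\<lambda>s. state_inv s \<and> opened s = opened s0 - {reg s0 12} \<and> queries s = queries s0 \<and>
     reps_extend s0 s \<and> (\<forall>c. consistent c s \<longleftrightarrow> consistent c s0) \<and> (\<forall>c. consistent c s0 \<longrightarrow> hybrid c s = hybrid c s0))"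
proof -
  define L' where "L' = reg s0 12"
  have Lk: "L' < k" using L by (simp add: opened_def L'_def)
  have lenn: "len s0 \<le> n" using w by (simp add: state_inv_def)
  let ?A = "[Arith Plus 21 8 12, Const 22 0, Store 21 22, Const 15 0]"
  define s1 where "s1 = exec_det ?A s0"
  have a: "triple ?A s0 4 (\<lambda>s. s = s1)" by (rule triple_execI) (simp_all add: s1_def)
  have md: "(BB + L') mod 2 ^ w = BB + L'" using Lk by (intro mod_w) (simp add: addr_defs)
  have e1: "mem s1 = (mem s0)(BB + L' := 0)" "\<And>r. r < 20 \<Longrightarrow> r \<noteq> 15 \<Longrightarrow> reg s1 r = reg s0 r" "reg s1 15 = 0" "queries s1 = queries s0"
    unfolding s1_def using w md by (simp_all add: state_inv_def regs_ok_def L'_def)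
  have BL: "SB \<le> BB + L'" by (simp add: addr_defs)
  have c0: "compact_inv s0 0 s1"
  proof -
    have "NK + q \<noteq> BB + L'" if "q < len s0" for q using that lenn by (simp add: addr_defs)
    then show ?thesis unfolding compact_inv_def e1(1) using e1(2-4) L'_def by (auto simp: kept_def todo_def)
  qed
  have "triple (?A @ (for_loop 20 11 25 compact_body @ [Const 33 0, Arith Plus 11 15 33])) s0 (4 + ((len s0 * (10 + 3) + 3) + 2))
    (\<lambda>s. \<exists>s2. compact_inv s0 (len s0) s2 \<and> mem s = mem s2 \<and> queries s = queries s2 \<and> reg s 11 = reg s2 15 \<and> (\<forall>r<20. r \<noteq> 11 \<longrightarrow> reg s r = reg s2 r))"
  proof (rule triple_append[OF a], hypsubst, rule triple_append)
    show "triple (for_loop 20 11 25 compact_body) s1 (len s0 * (10 + 3) + 3) (compact_inv s0 (len s0))"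
    proof (rule triple_for[where I = "compact_inv s0" and N = "len s0"])
      show "len s0 < 2 ^ w" using lenn word' by (simp add: addr_defs)
      show "reg s 11 = len s0 \<and> reg s 16 = 1" if "compact_inv s0 i s" for i and s :: state
        using that w unfolding compact_inv_def state_inv_def regs_ok_def by auto
      show "triple compact_body s 10 (\<lambda>s'. compact_inv s0 (Suc i) s' \<and> reg s' 20 = i)"
        if "i < len s0" "compact_inv s0 i s" "reg s 20 = i" for i and s :: state
        by (rule compact_step[OF w Lk[unfolded L'_def] that])
    qed (use c0 in \<open>auto simp: compact_inv_def\<close>)
    fix s2 assume c2: "compact_inv s0 (len s0) s2"
    show "triple [Const 33 0, Arith Plus 11 15 33] s2 2 (\<lambda>s. \<exists>s2. compact_inv s0 (len s0) s2 \<and> mem s = mem s2 \<and> queries s = queries s2 \<and> reg s 11 = reg s2 15 \<and> (\<forall>r<20. r \<noteq> 11 \<longrightarrow> reg s r = reg s2 r))"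
    proof (rule triple_execI)
      fix s assume s: "s = exec_det [Const 33 0, Arith Plus 11 15 33] s2"
      have "reg s2 15 \<le> n" using c2 kept_length[of s0 "len s0"] lenn unfolding compact_inv_def by linarith
      then have "reg s2 15 mod 2 ^ w = reg s2 15" by (intro mod_w) (simp add: addr_defs)
      then show "\<exists>s2. compact_inv s0 (len s0) s2 \<and> mem s = mem s2 \<and> queries s = queries s2 \<and> reg s 11 = reg s2 15 \<and> (\<forall>r<20. r \<noteq> 11 \<longrightarrow> reg s r = reg s2 r)"
        unfolding s using c2 by (intro exI[of _ s2]) simp
    qed simp_all
  qed
  then show ?thesis unfolding close_prog_def append_assoc
  proof (rule triple_mono)
    fix s :: state assume "\<exists>s2. compact_inv s0 (len s0) s2 \<and> mem s = mem s2 \<and> queries s = queries s2 \<and> reg s 11 = reg s2 15 \<and> (\<forall>r<20. r \<noteq> 11 \<longrightarrow> reg s r = reg s2 r)"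
    then obtain s2 where c2: "compact_inv s0 (len s0) s2" and s: "mem s = mem s2" "queries s = queries s2" "reg s 11 = reg s2 15"
      "\<forall>r<20. r \<noteq> 11 \<longrightarrow> reg s r = reg s2 r" by blast
    define K where "K = filter (\<lambda>v. cell s0 v 0 \<noteq> L') (todo s0)"
    have K: "kept s0 (len s0) = K" by (simp add: kept_def K_def L'_def todo_length[symmetric])
    have rg: "reg s r = reg s0 r" if "r < 20" "r \<noteq> 11" "r \<noteq> 15" "r \<noteq> 17" for r
      using s(4) c2 that unfolding compact_inv_def by simp
    have m: "mem s a = (if a = BB + L' then 0 else mem s0 a)" if "a < NK \<or> SB \<le> a" for a
      using c2 that unfolding compact_inv_def s(1) L'_def by blast
    have len: "len s = length K" using c2 unfolding compact_inv_def s(3) K by simp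
    have todo: "todo s = K" unfolding todo_def len using c2 unfolding compact_inv_def s(1) K by (intro nth_equalityI) auto
    have ce: "cell s u i = cell s0 u i" if "u < n" "i < k" for u i
      using m[of "u + n * i"] cell_lt[OF that] BL by (simp add: SB_def)
    have b: "base s i = (if i = L' then 0 else base s0 i)" for i
      using m[of "BB + i"] by (simp add: addr_defs)
    have op: "opened s = opened s0 - {L'}" by (auto simp: opened_def b)
    have rp: "mem s (RB + i) = mem s0 (RB + i)" for i
      using m[of "RB + i"] Lk by (simp add: addr_defs)
    have r10: "reg s 10 = reg s0 10" by (rule rg) auto
    have rok: "reps_ok s" using w unfolding state_inv_def reps_ok_def r10 rp by blast
    have co: "consistent c s \<longleftrightarrow> consistent c s0" for c by (simp add: consistent_def r10 rp)
    have hy: "hybrid c s = hybrid c s0" if "consistent c s0" for c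
    proof
      fix u
      have "c u < k" if "u < n" using \<open>consistent c s0\<close> labelings_lt that unfolding consistent_def by blast
      then show "hybrid c s u = hybrid c s0 u" using ce by (simp add: hybrid_def)
    qed
    have "length K \<le> n" using lenn unfolding K_def using length_filter_le[of _ "todo s0"] todo_length le_trans by metis
    have wv: "state_inv s"
      unfolding state_inv_def todo op len
    proof (intro conjI)
      show "regs_ok s" using w rg unfolding state_inv_def regs_ok_def by simp
      show "reps_ok s" by (rule rok)
      show "length K \<le> n" by fact
      show "distinct K" using w unfolding K_def state_inv_def by simp
      show "set K \<subseteq> {..<n}" using w unfolding K_def state_inv_def by auto
      show "\<forall>i<k. base s i = 0 \<or> base s i = S + 1" using w unfolding state_inv_def b by auto
      show "\<forall>v<n. \<forall>i<k. cell s v i < k" using w ce unfolding state_inv_def by simp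
      show "\<forall>v\<in>set K. \<forall>i<k. cell s v i \<in> opened s0 - {L'}"
      proof (intro ballI allI impI)
        fix v i assume v: "v \<in> set K" and i: "i < k"
        have v': "v \<in> set (todo s0)" "v < n" "cell s0 v 0 \<noteq> L'" using v w unfolding K_def state_inv_def by auto
        then have "cell s0 v i \<noteq> L'" using pr[OF v'(1)] i k1 L'_def by auto
        then show "cell s v i \<in> opened s0 - {L'}" using ce[OF v'(2) i] w v' i unfolding state_inv_def by simp
      qed
      show "\<forall>v<n. v \<notin> set K \<longrightarrow> (\<exists>j. j \<notin> opened s0 - {L'} \<and> (\<forall>i<k. cell s v i = j))"
      proof (intro allI impI)
        fix v assume v: "v < n" "v \<notin> set K"
        show "\<exists>j. j \<notin> opened s0 - {L'} \<and> (\<forall>i<k. cell s v i = j)"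
        proof (cases "v \<in> set (todo s0)")
          case True
          then have "cell s0 v 0 = L'" using v by (simp add: K_def)
          then have "\<forall>i<k. cell s0 v i = L'" using pr[OF True] k1 L'_def by auto
          then show ?thesis using ce[OF v(1)] by auto
        next
          case False
          then obtain j where "j \<notin> opened s0" "\<forall>i<k. cell s0 v i = j" using w v unfolding state_inv_def by blast
          then show ?thesis using ce[OF v(1)] by auto
        qed
      qed
    qed
    have "queries s = queries s0" using s(2) c2 unfolding compact_inv_def by simp
    then show "state_inv s \<and> opened s = opened s0 - {reg s0 12} \<and> queries s = queries s0 \<and>
     reps_extend s0 s \<and> (\<forall>c. consistent c s \<longleftrightarrow> consistent c s0) \<and> (\<forall>c. consistent c s0 \<longrightarrow> hybrid c s = hybrid c s0)"
      using wv op rok rp r10 co hy unfolding reps_extend_def L'_def by simp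
  qed simp
qed

definition choose_post :: "state \<Rightarrow> state \<Rightarrow> bool" where
  "choose_post sx s \<longleftrightarrow> round_inv s s \<and> reg s 12 \<in> opened s \<and> reg s 13 = len s div m + 1 \<and> reg s 14 = 0 \<and> reg s 19 = of_bool (0 < len s) \<and>
    opened s = opened sx \<and> len s = len sx \<and> reps_extend sx s \<and> queries s \<le> queries sx + S * k \<and>
    (\<forall>c. consistent c s \<longrightarrow> hybrid c s = hybrid c sx)"

text \<open>By the pigeonhole principle the most frequent slot has at least \<open>S / k\<close>
  samples. The sampling error \<open>\<gamma> / 4\<close> is at most \<open>1 / (2 * k)\<close>, so
  the true share of this slot is at least \<open>1 / (2 * k)\<close>.\<close>

lemma choose_ok:
  assumes w: "state_inv sx" and ne: "0 < len sx" and sm: "sampled sx s1"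
  shows "triple choose_prog s1 (k * 16 + S * 9 + 18) (\<lambda>s. choose_post sx s \<and> (good sx (samples s1) \<longrightarrow> large_slot s))"
proof -
  note f = sampled_state_inv[OF w sm]
  note st = sampled_start[OF w sm]
  have rg: "reg s1 r = reg sx r" if "r < 20" "r \<noteq> 10" for r using sm that unfolding sampled_def by blast
  have r1: "regs_ok s1" "reps_ok s1" using f(1) unfolding state_inv_def by blast+
  have b1: "base s1 i = 0 \<or> base s1 i = S + 1" if "i < k" for i using f(1) that unfolding state_inv_def by blast
  define cnt where "cnt i = card {j. j < S \<and> mem s1 (LB + j) = i}" for i
  have cntS: "cnt i \<le> S" for i
  proof -
    have "cnt i \<le> card {..<S}" unfolding cnt_def by (rule card_mono) auto
    then show ?thesis by simp
  qed
  have cnt0: "cnt i = 0" if "i \<notin> opened s1" for i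
    using f(5) that unfolding cnt_def by (auto simp: card_eq_0_iff)
  have a2: "triple init_scores_prog s1 (k * 7 + 3) (\<lambda>s. frame s1 scores_region s \<and> (\<forall>i<k. score s i = base s1 i))"
  proof (rule init_scores_ok[OF r1(1)], intro allI impI)
    fix i assume "i < k"
    then show "base s1 i \<le> S + 1" using b1[of i] by auto
  qed
  have a3: "triple count_prog s2 (S * 9 + 3) (\<lambda>s. frame s1 scores_region s \<and> (\<forall>i<k. score s i = base s1 i + cnt i))"
    if s2: "frame s1 scores_region s2 \<and> (\<forall>i<k. score s2 i = base s1 i)" for s2
  proof -
    have m2: "mem s2 (LB + j) = mem s1 (LB + j)" if "j < S" for j
      using s2 that by (auto simp: frame_def addr_defs)
    have c2: "{j. j < S \<and> mem s2 (LB + j) = i} = {j. j < S \<and> mem s1 (LB + j) = i}" for i using m2 by auto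
    have "triple count_prog s2 (S * 9 + 3) (\<lambda>s. frame s2 scores_region s \<and>
      (\<forall>i<k. score s i = score s2 i + card {j. j < S \<and> mem s2 (LB + j) = i}))"
    proof (rule count_ok)
      show "regs_ok s2" using frame_regs_ok s2 r1 by blast
      show "\<forall>j<S. mem s2 (LB + j) < k" using m2 sm unfolding sampled_def by simp
      show "\<forall>i<k. score s2 i \<le> S + 1"
      proof (intro allI impI)
        fix i assume "i < k"
        then show "score s2 i \<le> S + 1" using s2 b1[of i] by auto
      qed
    qed
    then show ?thesis
    proof (rule triple_mono)
      fix s assume s: "frame s2 scores_region s \<and> (\<forall>i<k. score s i = score s2 i + card {j. j < S \<and> mem s2 (LB + j) = i})"
      have "frame s1 scores_region s" using frame_trans s2 s by blast
      then show "frame s1 scores_region s \<and> (\<forall>i<k. score s i = base s1 i + cnt i)" using s s2 unfolding c2 cnt_def by simp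
    qed simp
  qed
  obtain j0 where j0: "j0 \<in> opened s1" using f(5)[of 0] S0 by blast
  then have j0k: "j0 < k" "base s1 j0 = S + 1" using b1[of j0] by (auto simp: opened_def)
  have a4: "triple argmax_prog s3 (k * 9 + 6) (\<lambda>s. frame s1 scores_region s \<and> reg s 31 \<in> opened s1 \<and> (\<forall>i<k. cnt i \<le> cnt (reg s 31)))"
    if s3: "frame s1 scores_region s3 \<and> (\<forall>i<k. score s3 i = base s1 i + cnt i)" for s3
  proof -
    have "triple argmax_prog s3 (k * 9 + 6) (\<lambda>s. frame s3 {} s \<and> reg s 31 < k \<and> 0 < score s3 (reg s 31) \<and>
      (\<forall>i<k. score s3 i \<le> score s3 (reg s 31)))"
    proof (rule argmax_ok)
      show "regs_ok s3" using frame_regs_ok s3 r1 by blast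
      show "\<forall>i<k. score s3 i \<le> 2 * S + 1"
      proof (intro allI impI)
        fix i assume "i < k"
        then show "score s3 i \<le> 2 * S + 1" using s3 b1[of i] cntS[of i] by auto
      qed
      show "\<exists>i<k. 0 < score s3 i" using j0k s3 by (intro exI[of _ j0]) simp
    qed
    then show ?thesis
    proof (rule triple_mono)
      fix s assume s: "frame s3 {} s \<and> reg s 31 < k \<and> 0 < score s3 (reg s 31) \<and> (\<forall>i<k. score s3 i \<le> score s3 (reg s 31))"
      define g where "g = reg s 31"
      have g: "g < k" "0 < score s3 g" "\<And>i. i < k \<Longrightarrow> score s3 i \<le> score s3 g" using s by (auto simp: g_def)
      have go: "g \<in> opened s1"
      proof (rule ccontr)
        assume c: "g \<notin> opened s1"
        then have "base s1 g = 0" using g(1) by (simp add: opened_def)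
        then show False using g s3 cnt0[OF c] by simp
      qed
      then have bg: "base s1 g = S + 1" using b1[OF g(1)] by (auto simp: opened_def)
      have "cnt i \<le> cnt g" if i: "i < k" for i
      proof (cases "i \<in> opened s1")
        case True
        then have "base s1 i = S + 1" using b1[OF i] by (auto simp: opened_def)
        then show ?thesis using g(3)[OF i] s3 i g(1) bg by simp
      next
        case False then show ?thesis using cnt0 by simp
      qed
      moreover have "frame s1 scores_region s" by (rule frame_trans[OF conjunct1[OF s3] conjunct1[OF s]]) auto
      ultimately show "frame s1 scores_region s \<and> reg s 31 \<in> opened s1 \<and> (\<forall>i<k. cnt i \<le> cnt (reg s 31))"
        using go unfolding g_def by blast
    qed simp
  qed
  let ?C = "[Const 33 0, Arith Plus 12 31 33, Arith Div 13 11 3, Arith Plus 13 13 16, Const 14 0, Arith Less 19 14 11]"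
  have a5: "triple ?C s4 6 (\<lambda>s. choose_post sx s \<and> (good sx (samples s1) \<longrightarrow> large_slot s))"
    if s4: "frame s1 scores_region s4 \<and> reg s4 31 \<in> opened s1 \<and> (\<forall>i<k. cnt i \<le> cnt (reg s4 31))" for s4
  proof (rule triple_execI)
    fix s assume s: "s = exec_det ?C s4"
    define L where "L = reg s4 31"
    have Lk: "L < k" using s4 by (simp add: opened_def L_def)
    have r4: "reg s4 r = reg s1 r" if "r < 20" for r using s4 that by (simp add: frame_def)
    have l4: "len s4 = len sx" "reg s4 3 = m" "reg s4 16 = 1" using r4[of 11] r4[of 3] r4[of 16] rg[of 11] r1(1) by (auto simp: regs_ok_def)
    have lenn: "len sx \<le> n" using w by (simp add: state_inv_def)
    have "len sx div m \<le> n" using lenn div_le_dividend le_trans by blast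
    then have md: "L mod 2 ^ w = L" "(len sx div m) mod 2 ^ w = len sx div m" "Suc (len sx div m) mod 2 ^ w = Suc (len sx div m)"
      using Lk n_le_NK by (auto intro!: mod_w simp: addr_defs)
    have e: "mem s = mem s4" "\<And>r. r < 20 \<Longrightarrow> r \<notin> {12, 13, 14, 19} \<Longrightarrow> reg s r = reg s4 r" "queries s = queries s4"
      "reg s 12 = L" "reg s 13 = len sx div m + 1" "reg s 14 = 0" "reg s 19 = of_bool (0 < len sx)"
      unfolding s using l4 md by (simp_all add: mod_of_bool L_def[symmetric] del: of_bool_eq_iff)
    have e1: "reg s r = reg s1 r" if "r < 20" "r \<notin> {12, 13, 14, 19}" for r using e(2)[OF that] r4 that by simp
    have m1: "mem s a = mem s1 a" if "a \<notin> scores_region" for a using s4 that unfolding e(1) frame_def by blast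
    have ro: "regs_ok s" using r1(1) e1 by (simp add: regs_ok_def)
    have rp: "mem s (RB + i) = mem s1 (RB + i)" for i by (rule m1) (auto simp: addr_defs)
    have r10: "reg s 10 = reg s1 10" by (rule e1) auto
    have rok: "reps_ok s" using r1(2) unfolding reps_ok_def r10 rp .
    have m1': "mem s a = mem s1 a" if "a < SB \<or> BB \<le> a \<and> a < RB" for a using that by (intro m1) (auto simp: addr_defs)
    have r11: "reg s 11 = reg s1 11" by (rule e1) auto
    note cg = state_inv_cong[OF f(1) ro rok r11 m1']
    have co: "consistent c s \<longleftrightarrow> consistent c s1" for c by (simp add: consistent_def r10 rp)
    have hy: "hybrid c s = hybrid c sx" if c: "consistent c s" for c
    proof -
      have "hybrid c s = hybrid c s1"
      proof
        fix u
        have "c u < k" if "u < n" using c labelings_lt that unfolding consistent_def by blast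
        then show "hybrid c s u = hybrid c s1 u" using cg(4) by (simp add: hybrid_def)
      qed
      then show ?thesis using st(2) c co by simp
    qed
    have irs: "round_inv s s" unfolding round_inv_def using cg(1) rok e(6) by (simp add: reps_extend_def)
    have ext: "reps_extend sx s" using sm rok unfolding sampled_def reps_extend_def r10 rp by blast
    have lens: "len s = len sx" using r11 rg[of 11] by simp
    have ops: "opened s = opened sx" using cg(3) f(3) by simp
    have qs: "queries s \<le> queries sx + S * k" using sm s4 unfolding e(3) sampled_def frame_def by simp
    have "choose_post sx s"
      unfolding choose_post_def using irs ext lens ops qs e(4-7) hy s4 f(3) by (simp add: L_def)
    moreover have "large_slot s" if gd: "good sx (samples s1)"
      unfolding large_slot_def
    proof (intro allI impI)
      fix c assume c: "consistent c s"
      have c1: "consistent c s1" using c co by simp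
      let ?W = "set (todo sx)"
      have Wc: "card ?W = len sx" using w todo_length[of sx] by (simp add: state_inv_def distinct_card)
      have hfn: "(\<Sum>u\<in>?W. sample_fun sx c i n u) = real (card {u \<in> ?W. hybrid c sx u = i})" for i
        by (simp add: sample_fun_def flip: sum.inter_filter) (simp add: Collect_conj_eq Int_commute)
      have cn: "sum_list (map (sample_fun sx c i n) (samples s1)) = real (cnt i)" for i
      proof -
        have "sum_list (map (sample_fun sx c i n) (samples s1)) = (\<Sum>j<S. sample_fun sx c i n (mem s1 (SB + j)))"
          by (simp add: samples_def comp_def interv_sum_list_conv_sum_set_nat atLeast0LessThan)
        also have "\<dots> = (\<Sum>j<S. if mem s1 (LB + j) = i then 1 else 0)"
          by (rule sum.cong) (use sm c1 in \<open>auto simp: sample_fun_def sampled_def\<close>)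
        also have "\<dots> = real (cnt i)" unfolding cnt_def by (simp flip: sum.inter_filter)
        finally show ?thesis .
      qed
      have cl: "c \<in> labelings" using c by (simp add: consistent_def)
      have "(\<lambda>(c, i, v). \<bar>sum_list (map (sample_fun sx c i v) (samples s1)) / real S - (\<Sum>u\<in>?W. sample_fun sx c i v u) / real (card ?W)\<bar> \<le> \<gamma> / 4) (c, L, n)"
        using gd unfolding good_def by (rule bspec) (use cl Lk in simp)
      then have "\<bar>real (cnt L) / real S - real (card {u \<in> ?W. hybrid c sx u = L}) / real (card ?W)\<bar> \<le> \<gamma> / 4"
        by (simp only: case_prod_conv cn hfn)
      then have close: "real (cnt L) / real S - real (card {u \<in> ?W. hybrid c sx u = L}) / real (card ?W) \<le> \<gamma> / 4"
        by linarith
      have "S = card (\<Union>i<k. {j. j < S \<and> mem s1 (LB + j) = i})"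
      proof -
        have "(\<Union>i<k. {j. j < S \<and> mem s1 (LB + j) = i}) = {..<S}" using sm unfolding sampled_def by auto
        then show ?thesis by simp
      qed
      also have "\<dots> \<le> (\<Sum>i<k. cnt i)" unfolding cnt_def by (rule card_UN_le) simp
      also have "\<dots> \<le> (\<Sum>i<k. cnt L)" by (rule sum_mono) (use s4 L_def in auto)
      finally have "real S \<le> real (k * cnt L)" by (simp only: sum_constant card_lessThan of_nat_le_iff of_nat_id)
      then have "1 / real k \<le> real (cnt L) / real S" using k1 S0 by (simp add: field_simps)
      moreover have "\<gamma> / 4 \<le> 1 / (2 * real k)"
      proof -
        have "1 / (32 * real k) \<le> 1 / (2 * real k)" using k1 by (simp add: field_simps)
        then show ?thesis using \<gamma>(1,2) by linarith
      qed
      moreover have "1 / real k - 1 / (2 * real k) = 1 / (2 * real k)" using k1 by (simp add: field_simps)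
      ultimately have "1 / (2 * real k) \<le> real (card {u \<in> ?W. hybrid c sx u = L}) / real (card ?W)" using close by linarith
      then have "real (card ?W) \<le> 2 * real k * real (card {u \<in> ?W. hybrid c sx u = L})"
        using k1 ne Wc by (simp add: field_simps)
      then have "card ?W \<le> 2 * k * card {u \<in> ?W. hybrid c sx u = L}"
        by (metis of_nat_le_iff of_nat_mult of_nat_numeral)
      then show "card (set (todo s)) \<le> 2 * k * card {u \<in> set (todo s). hybrid c s u = reg s 12}"
        using hy[OF c] cg(2) f(2) e(4) by simp
    qed
    ultimately show "choose_post sx s \<and> (good sx (samples s1) \<longrightarrow> large_slot s)" by blast
  qed simp_all
  have "triple choose_prog s1 ((k * 7 + 3) + ((S * 9 + 3) + ((k * 9 + 6) + 6))) (\<lambda>s. choose_post sx s \<and> (good sx (samples s1) \<longrightarrow> large_slot s))"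
    unfolding choose_prog_def
    by (rule triple_append[OF a2], rule triple_append[OF a3], assumption, rule triple_append[OF a4], assumption, rule a5)
  then show ?thesis by (rule triple_mono) auto
qed

end

section \<open>Rounds, initialisation and the complete program\<close>

definition bits :: "nat \<Rightarrow> nat" where
  "bits n = (LEAST t. n < 2 ^ t)"

lemma bits: "n < 2 ^ bits n" "t < bits n \<Longrightarrow> 2 ^ t \<le> n"
proof -
  have "\<exists>t. n < 2 ^ t" using less_exp by blast
  then show "n < 2 ^ bits n" unfolding bits_def by (rule LeastI_ex)
  show "t < bits n \<Longrightarrow> 2 ^ t \<le> n" unfolding bits_def using not_less_Least by fastforce
qed

text \<open>One program has to serve all \<open>n\<close>, so the number of samples is computed at
  run time: halving \<open>n\<close> down to 0 takes \<open>bits n\<close> steps, and the result is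
  multiplied by the constant \<open>A\<close>. The cell \<open>a = v + n * i\<close> starts with
  \<open>a div n = i\<close>.\<close>

definition init_prog :: "nat \<Rightarrow> nat \<Rightarrow> nat \<Rightarrow> instr list" where
  "init_prog k m A =
     [Const 1 k, Const 16 1, Const 22 2, Const 23 0, Arith Plus 20 0 23, Const 2 0] @
     [While 20 [Arith Div 20 20 22, Arith Plus 2 2 16]] @
     [Const 21 A, Arith Times 2 2 21, Const 3 m, Arith Times 4 0 1, Arith Plus 5 4 0, Arith Plus 6 5 2,
      Arith Plus 7 6 2, Arith Plus 8 7 1, Arith Plus 9 8 1, Arith Plus 11 0 23] @
     for_loop 20 0 25 [Arith Plus 21 4 20, Store 21 20] @
     for_loop 20 4 25 [Arith Div 21 20 0, Store 20 21] @
     for_loop 20 1 25 [Arith Plus 21 8 20, Arith Plus 22 2 16, Store 21 22]"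

definition main_prog :: "nat \<Rightarrow> nat \<Rightarrow> nat \<Rightarrow> instr list" where
  "main_prog k m A = init_prog k m A @ [While 11 round_prog]"

context sampling_algorithm
begin

definition growth :: real where
  "growth = 1 + 256 * (real k)\<^sup>2 * \<gamma>"

definition round_time :: nat where
  "round_time = S * (k * 21 + 30) + k * 16 + 34 + m * (S * (k * 12 + 21) + 15) + (n + m) * (S * 17 + k * 28 + 23) + n * 13"

text \<open>A round samples once to choose its slot and at most once in each of its at most
  \<open>m\<close> batches. The flag \<open>g\<close> is arbitrary because the guarantee is relative
  to the clustering at the start of the round and needs no earlier success.\<close>

lemma round_ok:
  assumes w: "state_inv sx" and ne: "0 < len sx"
  shows "prob_triple round_prog sx round_time
    (\<lambda>s. state_inv s \<and> card (opened s) < card (opened sx) \<and> reps_extend sx s \<and> queries s \<le> queries sx + (m + 1) * (S * k)) g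
    (\<lambda>s. \<forall>c. consistent c s \<longrightarrow> cost (hybrid c s) \<le> cost (hybrid c sx) * growth) (real (m + 1) * pfail)"
proof -
  let ?R = "\<lambda>s. state_inv s \<and> card (opened s) < card (opened sx) \<and> reps_extend sx s \<and> queries s \<le> queries sx + (m + 1) * (S * k)"
  let ?Q = "\<lambda>s. \<forall>c. consistent c s \<longrightarrow> cost (hybrid c s) \<le> cost (hybrid c sx) * growth"
  define l where "l = len sx"
  define Tb where "Tb = S * (k * 12 + 21) + 13 + (l div m + 1) * (S * 17 + k * 28 + 23)"
  have ln: "l \<le> n" using w by (simp add: state_inv_def l_def)
  have main: "prob_triple ([While 19 (batch_prog @ [Arith Less 19 14 11])] @ close_prog) s2
      ((m * Suc (Tb + 1) + 1) + (l * 13 + 9)) ?R (large_slot s2) ?Q (real m * pfail + 0)"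
    if c2: "choose_post sx s2" for s2
  proof -
    have ir2: "round_inv s2 s2" and L: "reg s2 12 \<in> opened s2" and bs: "reg s2 13 = len s2 div m + 1" and r14: "reg s2 14 = 0"
      and r19: "reg s2 19 = of_bool (0 < len s2)" and op: "opened s2 = opened sx" and len: "len s2 = l" and ext: "reps_extend sx s2"
      and q: "queries s2 \<le> queries sx + S * k" and hy: "\<And>c. consistent c s2 \<Longrightarrow> hybrid c s2 = hybrid c sx"
      using c2 unfolding choose_post_def l_def by blast+
    have w2: "state_inv s2" using ir2 unfolding round_inv_def by blast
    define b where "b = l div m + 1"
    \<comment> \<open>Batches of \<open>l div m + 1\<close> vertices exhaust the list after at most
      \<open>m\<close> of them, even if \<open>m\<close> does not divide \<open>l\<close>.\<close>
    have mb: "l \<le> m * b"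
    proof -
      have "l = l div m * m + l mod m" by simp
      moreover have "l mod m < m" using m0 by simp
      ultimately have "l \<le> l div m * m + m" by linarith
      then show ?thesis by (simp add: b_def algebra_simps)
    qed
    define I where "I j s \<longleftrightarrow> round_inv s2 s \<and> reg s 14 = min (j * b) l \<and> reg s 19 = of_bool (min (j * b) l < l) \<and>
      queries s \<le> queries s2 + j * (S * k)" for j s
    have loop: "prob_triple [While 19 (batch_prog @ [Arith Less 19 14 11])] s2 ((m - 0) * Suc (Tb + 1) + 1)
      (\<lambda>s'. \<exists>j\<le>m. I j s' \<and> reg s' 19 = 0) (large_slot s2 \<and> round_good s2 s2)
      (\<lambda>s'. \<exists>j\<le>m. I j s' \<and> (large_slot s2 \<and> round_good s2 s') \<and> reg s' 19 = 0) (real (m - 0) * pfail)"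
    proof (rule prob_triple_while[where I = I and G = "\<lambda>_ s. large_slot s2 \<and> round_good s2 s" and i = 0])
      show "I m s \<Longrightarrow> reg s 19 = 0" for s using mb by (simp add: I_def)
      show "I 0 s2" using ir2 r14 r19 len by (simp add: I_def)
      show "0 \<le> pfail" by (rule pfail_nonneg)
      fix j s assume j: "j < m" and inv: "I j s" and r: "reg s 19 \<noteq> 0"
      have irs: "round_inv s2 s" "reg s 14 = j * b" "j * b < l" "len s = l" using inv r len by (auto simp: I_def round_inv_def)
      have p: "reg s 14 < len s" using irs by simp
      have B: "prob_triple batch_prog s Tb
       (\<lambda>s'. round_inv s2 s' \<and> reg s' 14 = min (reg s 14 + reg s2 13) (len s2) \<and> queries s' \<le> queries s + S * k)
       (large_slot s2 \<and> round_good s2 s) (round_good s2) pfail"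
        using batch_ok[OF w2 irs(1) p bs L] unfolding Tb_def len .
      have "prob_triple (batch_prog @ [Arith Less 19 14 11]) s (Tb + 1) (I (Suc j)) (large_slot s2 \<and> round_good s2 s) (\<lambda>s'. round_good s2 s') (pfail + 0)"
      proof (rule prob_triple_append[OF B], rule triple_imp_prob_triple, rule triple_execI)
        fix s3 s4 assume s3: "round_inv s2 s3 \<and> reg s3 14 = min (reg s 14 + reg s2 13) (len s2) \<and> queries s3 \<le> queries s + S * k"
          and s4: "s4 = exec_det [Arith Less 19 14 11] s3"
        have m3: "reg s3 14 = min (Suc j * b) l" using s3 irs bs len by (simp add: b_def algebra_simps)
        have l3: "len s3 = l" using s3 len by (simp add: round_inv_def)
        have e: "same_core s3 s4" "reg s4 19 = of_bool (min (Suc j * b) l < l)" "queries s4 = queries s3" "reg s4 14 = reg s3 14"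
          unfolding s4 same_core_def using m3 l3 by (auto simp: mod_of_bool)
        have "queries s \<le> queries s2 + j * (S * k)" using inv by (simp add: I_def)
        then have "queries s4 \<le> queries s2 + Suc j * (S * k)" using s3 e(3) by simp
        then show "I (Suc j) s4 \<and> (round_good s2 s3 \<longrightarrow> round_good s2 s4)"
          unfolding I_def using same_core_facts[OF e(1)] s3 e m3 by simp
      qed simp_all
      then have "prob_triple (batch_prog @ [Arith Less 19 14 11]) s (Tb + 1) (I (Suc j)) (large_slot s2 \<and> round_good s2 s)
         (\<lambda>s'. (large_slot s2 \<and> round_good s2 s) \<longrightarrow> large_slot s2 \<and> round_good s2 s') (pfail + 0)"
        by (rule prob_triple_mono) auto
      from prob_triple_cond[OF this] show "prob_triple (batch_prog @ [Arith Less 19 14 11]) s (Tb + 1) (I (Suc j)) (large_slot s2 \<and> round_good s2 s)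
         (\<lambda>s. large_slot s2 \<and> round_good s2 s) pfail" by simp
    qed simp
    have "prob_triple ([While 19 (batch_prog @ [Arith Less 19 14 11])] @ close_prog) s2
      (((m - 0) * Suc (Tb + 1) + 1) + (l * 13 + 9)) ?R (large_slot s2 \<and> round_good s2 s2) ?Q (real (m - 0) * pfail + 0)"
    proof (rule prob_triple_append[OF loop], rule triple_imp_prob_triple)
      fix s3 assume "\<exists>j\<le>m. I j s3 \<and> reg s3 19 = 0"
      then obtain j where j: "j \<le> m" "I j s3" "reg s3 19 = 0" by blast
      have ir3: "round_inv s2 s3" and q3: "queries s3 \<le> queries s2 + j * (S * k)" using j by (auto simp: I_def)
      have p3: "reg s3 14 = l" using j(2,3) by (auto simp: I_def split: if_splits)
      have w3: "state_inv s3" "todo s3 = todo s2" "opened s3 = opened s2" "reg s3 12 = reg s2 12" "reps_extend s2 s3" "len s3 = l"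
        using ir3 len by (auto simp: round_inv_def)
      have pr: "(\<forall>i<k. cell s3 v i = reg s3 12) \<or> (\<forall>i<k. cell s3 v i \<noteq> reg s3 12)" if v: "v \<in> set (todo s3)" for v
      proof -
        obtain x where "x < l" "v = todo s2 ! x" using v w3(2) todo_length[of s2] len by (metis in_set_conv_nth)
        then show ?thesis using ir3 p3 w3(4) unfolding round_inv_def by simp
      qed
      have "triple close_prog s3 (len s3 * 13 + 9) (\<lambda>s. state_inv s \<and> opened s = opened s3 - {reg s3 12} \<and> queries s = queries s3 \<and>
         reps_extend s3 s \<and> (\<forall>c. consistent c s \<longleftrightarrow> consistent c s3) \<and> (\<forall>c. consistent c s3 \<longrightarrow> hybrid c s = hybrid c s3))"
        by (rule close_ok[OF w3(1) _ pr]) (use L w3 in simp_all)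
      then show "triple close_prog s3 (l * 13 + 9) (\<lambda>s. ?R s \<and> ((\<exists>j\<le>m. I j s3 \<and> (large_slot s2 \<and> round_good s2 s3) \<and> reg s3 19 = 0) \<longrightarrow> ?Q s))"
      proof (rule triple_mono)
        fix s assume s: "state_inv s \<and> opened s = opened s3 - {reg s3 12} \<and> queries s = queries s3 \<and>
         reps_extend s3 s \<and> (\<forall>c. consistent c s \<longleftrightarrow> consistent c s3) \<and> (\<forall>c. consistent c s3 \<longrightarrow> hybrid c s = hybrid c s3)"
        have "finite (opened sx)" by (simp add: opened_def)
        then have "card (opened s) < card (opened sx)"
          using s w3(3,4) op L by (intro psubset_card_mono) auto
        moreover have "reps_extend sx s" using reps_extend_trans[OF reps_extend_trans[OF ext w3(5)]] s by blast
        moreover have "queries s \<le> queries sx + (m + 1) * (S * k)"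
        proof -
          have "j * (S * k) \<le> m * (S * k)" using j(1) by (rule mult_le_mono1)
          moreover have "(m + 1) * (S * k) = m * (S * k) + S * k" by simp
          moreover have "queries s = queries s3" using s by blast
          ultimately show ?thesis using q q3 by linarith
        qed
        moreover have "cost (hybrid c s) \<le> cost (hybrid c sx) * growth" if g3: "round_good s2 s3" and c: "consistent c s" for c
        proof -
          have c3: "consistent c s3" using s c by blast
          then have c2': "consistent c s2" using reps_extend_consistent w3(5) by blast
          have "set (todo s2) \<subseteq> {..<n}" using w2 unfolding state_inv_def by blast
          from move_inv_cost[OF _ k1 \<gamma>(1) this] g3 c3
          have "cost (hybrid c s3) \<le> cost (hybrid c s2) * (1 + 256 * (real k)\<^sup>2 * \<gamma>)" unfolding round_good_def by blast
          then show ?thesis using hy[OF c2'] s c3 by (simp add: growth_def)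
        qed
        ultimately show "?R s \<and> ((\<exists>j\<le>m. I j s3 \<and> (large_slot s2 \<and> round_good s2 s3) \<and> reg s3 19 = 0) \<longrightarrow> ?Q s)"
          using s by blast
      qed (simp add: w3)
    qed simp
    then show ?thesis
      by (rule prob_triple_mono) (simp_all add: round_good_def move_inv_refl)
  qed
  have choose: "prob_triple (choose_prog @ ([While 19 (batch_prog @ [Arith Less 19 14 11])] @ close_prog)) s1
      ((k * 16 + S * 9 + 18) + ((m * Suc (Tb + 1) + 1) + (l * 13 + 9))) ?R (good sx (samples s1)) ?Q (0 + (real m * pfail + 0))"
    if sm: "sampled sx s1" for s1
    by (rule prob_triple_append[OF triple_imp_prob_triple[OF choose_ok[OF w ne sm]] main])
       (use pfail_nonneg in auto)
  have "prob_triple round_prog sx ((S * (k * 12 + 21) + 6) + ((k * 16 + S * 9 + 18) + ((m * Suc (Tb + 1) + 1) + (l * 13 + 9)))) ?R g ?Q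
      (pfail + (0 + (real m * pfail + 0)))"
    unfolding round_prog_def by (rule prob_triple_append[OF sample_ok[OF w ne] choose]) (use pfail_nonneg in auto)
  moreover have "(S * (k * 12 + 21) + 6) + ((k * 16 + S * 9 + 18) + ((m * Suc (Tb + 1) + 1) + (l * 13 + 9))) \<le> round_time"
  proof -
    have "m * (l div m + 1) \<le> n + m"
    proof -
      have "m * (l div m) \<le> n" by (rule order_trans[OF times_div_less_eq_dividend ln])
      then show ?thesis by simp
    qed
    then have "m * (l div m + 1) * (S * 17 + k * 28 + 23) \<le> (n + m) * (S * 17 + k * 28 + 23)" by (rule mult_le_mono1)
    moreover have "m * Suc (Tb + 1) = m * (S * (k * 12 + 21) + 15) + m * (l div m + 1) * (S * 17 + k * 28 + 23)"
      unfolding Tb_def by (simp add: algebra_simps)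
    moreover have "S * (k * 12 + 21) + S * 9 \<le> S * (k * 21 + 30)" by (simp add: algebra_simps)
    ultimately show ?thesis unfolding round_time_def using ln by linarith
  qed
  moreover have "pfail + (0 + (real m * pfail + 0)) = real (m + 1) * pfail" by (simp add: algebra_simps)
  ultimately show ?thesis by (elim prob_triple_mono) auto
qed

text \<open>Every round closes a slot and undecided vertices lie in open slots, so the list is empty
  after \<open>k\<close> rounds. The factors multiply because a naming that is consistent at the end
  was consistent in every round.\<close>

lemma rounds_ok:
  assumes w: "state_inv sx" and q: "queries sx = 0"
  shows "prob_triple [While 11 round_prog] sx (k * Suc round_time + 1)
    (\<lambda>s. state_inv s \<and> len s = 0 \<and> queries s \<le> k * ((m + 1) * (S * k))) True
    (\<lambda>s. \<forall>c. consistent c s \<longrightarrow> cost (hybrid c s) \<le> cost (hybrid c sx) * growth ^ k) (real k * (real (m + 1) * pfail))"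
proof -
  define I where "I r s \<longleftrightarrow> state_inv s \<and> card (opened s) + r \<le> k \<and> reps_extend sx s \<and> queries s \<le> r * ((m + 1) * (S * k))" for r s
  define G where "G r s \<longleftrightarrow> (\<forall>c. consistent c s \<longrightarrow> real_of_int (cost (hybrid c s)) \<le> cost (hybrid c sx) * growth ^ r)" for r s
  have g1: "1 \<le> growth" using \<gamma> by (simp add: growth_def)
  have len0: "len s = 0" if "I k s" for s
  proof (rule ccontr)
    assume "len s \<noteq> 0"
    then have "todo s ! 0 \<in> set (todo s)" by (intro nth_mem) (simp add: todo_length)
    moreover have "finite (opened s)" by (simp add: opened_def)
    then have "opened s = {}" using that by (simp add: I_def)
    ultimately show False using that k1 unfolding I_def state_inv_def by force
  qed
  have "card (opened sx) \<le> card {..<k}" by (rule card_mono) (auto simp: opened_def)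
  then have I0: "I 0 sx" using w q by (simp add: I_def reps_extend_def state_inv_def)
  have "prob_triple [While 11 round_prog] sx ((k - 0) * Suc round_time + 1) (\<lambda>s'. \<exists>j\<le>k. I j s' \<and> reg s' 11 = 0) (G 0 sx)
     (\<lambda>s'. \<exists>j\<le>k. I j s' \<and> G j s' \<and> reg s' 11 = 0) (real (k - 0) * (real (m + 1) * pfail))"
  proof (rule prob_triple_while[where I = I and G = G and i = 0])
    show "0 \<le> real (m + 1) * pfail" using pfail_nonneg by simp
    fix r s assume r: "r < k" and inv: "I r s" and ne: "len s \<noteq> 0"
    have ws: "state_inv s" "0 < len s" using inv ne by (auto simp: I_def)
    have "prob_triple round_prog s round_time
      (\<lambda>s'. state_inv s' \<and> card (opened s') < card (opened s) \<and> reps_extend s s' \<and> queries s' \<le> queries s + (m + 1) * (S * k)) (G r s)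
      (\<lambda>s'. \<forall>c. consistent c s' \<longrightarrow> cost (hybrid c s') \<le> cost (hybrid c s) * growth) (real (m + 1) * pfail)"
      by (rule round_ok[OF ws])
    then have "prob_triple round_prog s round_time (I (Suc r)) (G r s) (\<lambda>s'. G r s \<longrightarrow> G (Suc r) s') (real (m + 1) * pfail)"
    proof (rule prob_triple_mono)
      fix s' assume s': "state_inv s' \<and> card (opened s') < card (opened s) \<and> reps_extend s s' \<and> queries s' \<le> queries s + (m + 1) * (S * k)"
      then show "I (Suc r) s'" using inv reps_extend_trans unfolding I_def by auto
      assume b: "\<forall>c. consistent c s' \<longrightarrow> cost (hybrid c s') \<le> cost (hybrid c s) * growth"
      show "G r s \<longrightarrow> G (Suc r) s'"
        unfolding G_def
      proof (intro impI allI)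
        fix c assume gs: "\<forall>c. consistent c s \<longrightarrow> real_of_int (cost (hybrid c s)) \<le> cost (hybrid c sx) * growth ^ r" and c: "consistent c s'"
        have "consistent c s" using reps_extend_consistent s' c by blast
        then have "real_of_int (cost (hybrid c s)) * growth \<le> cost (hybrid c sx) * growth ^ r * growth"
          using gs g1 by (intro mult_right_mono) auto
        then show "real_of_int (cost (hybrid c s')) \<le> cost (hybrid c sx) * growth ^ Suc r"
          using b c by (auto simp: mult_ac intro: order_trans)
      qed
    qed auto
    then show "prob_triple round_prog s round_time (I (Suc r)) (G r s) (G (Suc r)) (real (m + 1) * pfail)"
      by (rule prob_triple_cond)
  qed (use I0 len0 in auto)
  then show ?thesis
  proof (rule prob_triple_mono)
    fix s assume "\<exists>j\<le>k. I j s \<and> len s = 0"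
    then obtain j where j: "j \<le> k" "I j s" "len s = 0" by blast
    have "j * ((m + 1) * (S * k)) \<le> k * ((m + 1) * (S * k))" using j(1) by (rule mult_le_mono1)
    then show "state_inv s \<and> len s = 0 \<and> queries s \<le> k * ((m + 1) * (S * k))" using j unfolding I_def by linarith
  next
    fix s assume "\<exists>j\<le>k. I j s \<and> G j s \<and> len s = 0"
    then obtain j where j: "j \<le> k" "G j s" by blast
    show "\<forall>c. consistent c s \<longrightarrow> cost (hybrid c s) \<le> cost (hybrid c sx) * growth ^ k"
    proof (intro allI impI)
      fix c assume "consistent c s"
      then have "real_of_int (cost (hybrid c s)) \<le> cost (hybrid c sx) * growth ^ j" using j by (simp add: G_def)
      also have "\<dots> \<le> cost (hybrid c sx) * growth ^ k"
      proof (rule mult_left_mono)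
        show "growth ^ j \<le> growth ^ k" using g1 j(1) by (rule power_increasing[rotated])
        show "0 \<le> real_of_int (cost (hybrid c sx))" unfolding cost_def by (simp add: sum_nonneg vcost_nonneg)
      qed
      finally show "cost (hybrid c s) \<le> cost (hybrid c sx) * growth ^ k" .
    qed
  qed (auto simp: G_def)
qed

definition start :: state where
  "start = \<lparr>reg = (\<lambda>_. 0)(0 := n), mem = (\<lambda>_. 0), queries = 0\<rparr>"

lemma init_ok:
  assumes S: "S = A * bits n" and A0: "0 < A"
  shows "triple (init_prog k m A) start (bits n * 3 + n * 5 + NK * 5 + k * 6 + 26)
    (\<lambda>s. state_inv s \<and> queries s = 0 \<and> (\<forall>c u. u < n \<longrightarrow> c \<in> labelings \<longrightarrow> hybrid c s u = c u))"
proof -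
  have bits0: "0 < bits n"
  proof (rule ccontr)
    assume "\<not> 0 < bits n"
    then show False using S S0 by simp
  qed
  have "A * 1 \<le> A * bits n" "1 * bits n \<le> A * bits n" using A0 bits0 by (intro mult_le_mono; simp)+
  then have AS: "A \<le> S" "bits n \<le> S" using S by simp_all
  let ?A = "[Const 1 k, Const 16 1, Const 22 2, Const 23 0, Arith Plus 20 0 23, Const 2 0]"
  let ?C = "[Const 21 A, Arith Times 2 2 21, Const 3 m, Arith Times 4 0 1, Arith Plus 5 4 0, Arith Plus 6 5 2,
      Arith Plus 7 6 2, Arith Plus 8 7 1, Arith Plus 9 8 1, Arith Plus 11 0 23]"
  have md: "x mod 2 ^ w = x" if "x \<le> RB + k + m" for x using that by (intro mod_w) simp
  have mk: "k mod 2 ^ w = k" "n mod 2 ^ w = n" "m mod 2 ^ w = m" "A mod 2 ^ w = A" "Suc 0 mod 2 ^ w = Suc 0" "2 mod 2 ^ w = (2::nat)"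
    using n_le_NK AS S0 by (auto intro!: mod_w simp: addr_defs)
  define I where "I t s \<longleftrightarrow> reg s 0 = n \<and> reg s 1 = k \<and> reg s 16 = 1 \<and> reg s 22 = 2 \<and> reg s 23 = 0 \<and> reg s 10 = 0 \<and>
    reg s 20 = n div 2 ^ t \<and> reg s 2 = t \<and> queries s = 0" for t and s :: state
  have a: "triple ?A start 6 (I 0)"
    by (rule triple_execI) (simp_all add: I_def start_def mk)
  have b: "triple [While 20 [Arith Div 20 20 22, Arith Plus 2 2 16]] s ((bits n - 0) * Suc 2 + 1) (I (bits n))"
    if s: "I 0 s" for s
  proof -
    have "triple [While 20 [Arith Div 20 20 22, Arith Plus 2 2 16]] s ((bits n - 0) * Suc 2 + 1) (\<lambda>s'. \<exists>j\<le>bits n. I j s' \<and> reg s' 20 = 0)"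
    proof (rule triple_while[where I = I])
      show "reg s 20 = 0" if "I (bits n) s" for s using that bits(1)[of n] by (simp add: I_def)
      fix t s assume t: "t < bits n" and inv: "I t s"
      have dq: "n div (2 * 2 ^ t) = n div 2 ^ t div 2" by (metis div_mult2_eq mult.commute)
      have "n div 2 ^ t \<le> n" by simp
      then have "n div 2 ^ t div 2 \<le> n" using div_le_dividend le_trans by blast
      then have "(n div 2 ^ t div 2) mod 2 ^ w = n div 2 ^ t div 2" "Suc t mod 2 ^ w = Suc t"
        using t AS n_le_NK by (auto intro!: mod_w simp: addr_defs)
      then show "triple [Arith Div 20 20 22, Arith Plus 2 2 16] s 2 (I (Suc t))"
        by (intro triple_execI) (use inv in \<open>simp_all add: I_def dq\<close>)
    qed (use s in auto)
    then show ?thesis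
    proof (rule triple_mono)
      fix s' assume "\<exists>j\<le>bits n. I j s' \<and> reg s' 20 = 0"
      then obtain j where j: "j \<le> bits n" "I j s'" "n div 2 ^ j = 0" by (auto simp: I_def)
      have "j = bits n"
      proof (rule ccontr)
        assume "j \<noteq> bits n"
        then have "2 ^ j \<le> n" using j(1) bits(2) by simp
        then have "0 < n div 2 ^ j" by (simp add: div_greater_zero_iff)
        then show False using j(3) by simp
      qed
      then show "I (bits n) s'" using j by simp
    qed simp
  qed
  define base_regs where "base_regs s \<longleftrightarrow> regs_ok s \<and> len s = n \<and> reg s 10 = 0 \<and> queries s = 0" for s :: state
  have c: "triple ?C s 10 base_regs" if s: "I (bits n) s" for s
  proof (rule triple_execI)
    fix s' assume s': "s' = exec_det ?C s"
    have m2: "(bits n * A) mod 2 ^ w = S" "(n * k) mod 2 ^ w = NK" "(NK + n) mod 2 ^ w = SB" "(SB + S) mod 2 ^ w = LB"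
      "(LB + S) mod 2 ^ w = SC" "(SC + k) mod 2 ^ w = BB" "(BB + k) mod 2 ^ w = RB"
    proof -
      have SA: "bits n * A = S" using S by (simp only: mult.commute)
      have eqs: "n * k = NK" "NK + n = SB" "SB + S = LB" "LB + S = SC" "SC + k = BB" "BB + k = RB"
        by (rule NK_def[symmetric] SB_def[symmetric] LB_def[symmetric] SC_def[symmetric] BB_def[symmetric] RB_def[symmetric])+
      show "(bits n * A) mod 2 ^ w = S" "(n * k) mod 2 ^ w = NK" "(NK + n) mod 2 ^ w = SB" "(SB + S) mod 2 ^ w = LB"
      "(LB + S) mod 2 ^ w = SC" "(SC + k) mod 2 ^ w = BB" "(BB + k) mod 2 ^ w = RB"
        unfolding SA eqs by (auto intro!: md simp: addr_defs)
    qed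
    show "base_regs s'"
      unfolding s' base_regs_def regs_ok_def using s by (simp add: I_def m2 mk)
  qed simp_all
  define I1 where "I1 l s \<longleftrightarrow> base_regs s \<and> (\<forall>p<l. mem s (NK + p) = p)" for l s
  have d: "triple (for_loop 20 0 25 [Arith Plus 21 4 20, Store 21 20]) s (n * (2 + 3) + 3) (I1 n)" if s: "base_regs s" for s
  proof (rule triple_for[where I = I1 and N = n])
    show "n < 2 ^ w" using word' n_le_NK by (simp add: addr_defs)
    fix l and s :: state assume l: "l < n" and inv: "I1 l s" and r: "reg s 20 = l"
    have "(NK + l) mod 2 ^ w = NK + l" using l by (intro md) (simp add: addr_defs)
    then show "triple [Arith Plus 21 4 20, Store 21 20] s 2 (\<lambda>s'. I1 (Suc l) s' \<and> reg s' 20 = l)"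
      by (intro triple_execI) (use inv r in \<open>simp_all add: I1_def base_regs_def regs_ok_def less_Suc_eq\<close>)
  qed (use s in \<open>auto simp: I1_def base_regs_def regs_ok_def\<close>)
  define I2 where "I2 l s \<longleftrightarrow> base_regs s \<and> (\<forall>p<n. mem s (NK + p) = p) \<and> (\<forall>a<l. mem s a = a div n)" for l s
  have e: "triple (for_loop 20 4 25 [Arith Div 21 20 0, Store 20 21]) s (NK * (2 + 3) + 3) (I2 NK)" if s: "I1 n s" for s
  proof (rule triple_for[where I = I2 and N = NK])
    show "NK < 2 ^ w" using word' by (simp add: addr_defs)
    fix l and s :: state assume l: "l < NK" and inv: "I2 l s" and r: "reg s 20 = l"
    have "l div n \<le> NK" using l div_le_dividend[of l n] by linarith
    then have "(l div n) mod 2 ^ w = l div n" using l by (intro md) (simp add: addr_defs)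
    then show "triple [Arith Div 21 20 0, Store 20 21] s 2 (\<lambda>s'. I2 (Suc l) s' \<and> reg s' 20 = l)"
      by (intro triple_execI) (use inv r l in \<open>auto simp: I2_def base_regs_def regs_ok_def less_Suc_eq\<close>)
  qed (use s in \<open>auto simp: I1_def I2_def base_regs_def regs_ok_def\<close>)
  define I3 where "I3 l s \<longleftrightarrow> I2 NK s \<and> (\<forall>i<l. base s i = S + 1)" for l s
  have f: "triple (for_loop 20 1 25 [Arith Plus 21 8 20, Arith Plus 22 2 16, Store 21 22]) s (k * (3 + 3) + 3) (I3 k)" if s: "I2 NK s" for s
  proof (rule triple_for[where I = I3 and N = k])
    show "k < 2 ^ w" using word' by simp
    fix l and s :: state assume l: "l < k" and inv: "I3 l s" and r: "reg s 20 = l"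
    have m2: "(BB + l) mod 2 ^ w = BB + l" "Suc S mod 2 ^ w = Suc S" using l S0 by (auto intro!: md simp: addr_defs)
    show "triple [Arith Plus 21 8 20, Arith Plus 22 2 16, Store 21 22] s 3 (\<lambda>s'. I3 (Suc l) s' \<and> reg s' 20 = l)"
    proof (rule triple_execI)
      fix s' assume s': "s' = exec_det [Arith Plus 21 8 20, Arith Plus 22 2 16, Store 21 22] s"
      have e: "mem s' = (mem s)(BB + l := S + 1)" "\<And>r. r < 21 \<Longrightarrow> reg s' r = reg s r" "queries s' = queries s"
        unfolding s' using inv r m2 by (simp_all add: I3_def I2_def base_regs_def regs_ok_def)
      show "I3 (Suc l) s' \<and> reg s' 20 = l"
        using inv r e(2,3) unfolding I3_def I2_def base_regs_def regs_ok_def e(1)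
        by (auto simp: less_Suc_eq addr_defs)
    qed simp_all
  qed (use s in \<open>auto simp: I3_def I2_def base_regs_def regs_ok_def\<close>)
  have "triple (init_prog k m A) start (6 + (((bits n - 0) * Suc 2 + 1) + (10 + ((n * (2 + 3) + 3) + ((NK * (2 + 3) + 3) + (k * (3 + 3) + 3)))))) (I3 k)"
    unfolding init_prog_def
    by (rule triple_append[OF a], rule triple_append[OF b], assumption, rule triple_append[OF c], assumption,
        rule triple_append[OF d], assumption, rule triple_append[OF e], assumption, rule f)
  then show ?thesis
  proof (rule triple_mono)
    fix s assume s: "I3 k s"
    have br: "regs_ok s" "len s = n" "reg s 10 = 0" "queries s = 0" using s by (auto simp: I3_def I2_def base_regs_def)
    have todo: "todo s = [0..<n]" unfolding todo_def br(2)
      using s by (intro nth_equalityI) (auto simp: I3_def I2_def)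
    have ce: "cell s v i = i" if "v < n" "i < k" for v i
      using s cell_lt[OF that] that by (simp add: I3_def I2_def)
    have op: "opened s = {..<k}" using s by (auto simp: opened_def I3_def)
    have "state_inv s"
      unfolding state_inv_def todo op using br s ce by (auto simp: reps_ok_def I3_def)
    moreover have "hybrid c s u = c u" if "u < n" "c \<in> labelings" for c u
      using that labelings_lt ce by (simp add: hybrid_def)
    ultimately show "state_inv s \<and> queries s = 0 \<and> (\<forall>c u. u < n \<longrightarrow> c \<in> labelings \<longrightarrow> hybrid c s u = c u)"
      using br by blast
  qed simp
qed

lemma cost_cong: "(\<And>u. u < n \<Longrightarrow> f u = f' u) \<Longrightarrow> cost f = cost f'"
  unfolding cost_def vcost_def by (intro sum.cong) auto

lemma main_ok:
  assumes S: "S = A * bits n" and A0: "0 < A"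
  shows "prob_triple (main_prog k m A) start ((bits n * 3 + n * 5 + NK * 5 + k * 6 + 26) + (k * Suc round_time + 1))
    (\<lambda>s. state_inv s \<and> len s = 0 \<and> queries s \<le> k * ((m + 1) * (S * k))) True
    (\<lambda>s. \<forall>c. consistent c s \<longrightarrow> cost (hybrid c s) \<le> cost c * growth ^ k) (real k * (real (m + 1) * pfail))"
proof -
  let ?R = "\<lambda>s. state_inv s \<and> queries s = 0 \<and> (\<forall>c u. u < n \<longrightarrow> c \<in> labelings \<longrightarrow> hybrid c s u = c u)"
  have a: "prob_triple (init_prog k m A) start (bits n * 3 + n * 5 + NK * 5 + k * 6 + 26) ?R True (\<lambda>_. True) 0"
    by (rule triple_imp_prob_triple, rule triple_mono[OF init_ok[OF S A0]]) auto
  have "prob_triple (main_prog k m A) start ((bits n * 3 + n * 5 + NK * 5 + k * 6 + 26) + (k * Suc round_time + 1))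
    (\<lambda>s. state_inv s \<and> len s = 0 \<and> queries s \<le> k * ((m + 1) * (S * k))) True
    (\<lambda>s. \<forall>c. consistent c s \<longrightarrow> cost (hybrid c s) \<le> cost c * growth ^ k) (0 + real k * (real (m + 1) * pfail))"
    unfolding main_prog_def
  proof (rule prob_triple_append[OF a])
    fix s1 assume s1: "?R s1"
    have "prob_triple [While 11 round_prog] s1 (k * Suc round_time + 1)
    (\<lambda>s. state_inv s \<and> len s = 0 \<and> queries s \<le> k * ((m + 1) * (S * k))) True
    (\<lambda>s. \<forall>c. consistent c s \<longrightarrow> cost (hybrid c s) \<le> cost (hybrid c s1) * growth ^ k) (real k * (real (m + 1) * pfail))"
      using s1 by (intro rounds_ok) auto
    then show "prob_triple [While 11 round_prog] s1 (k * Suc round_time + 1)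
    (\<lambda>s. state_inv s \<and> len s = 0 \<and> queries s \<le> k * ((m + 1) * (S * k))) True
    (\<lambda>s. \<forall>c. consistent c s \<longrightarrow> cost (hybrid c s) \<le> cost c * growth ^ k) (real k * (real (m + 1) * pfail))"
    proof (rule prob_triple_mono)
      fix s assume b: "\<forall>c. consistent c s \<longrightarrow> cost (hybrid c s) \<le> cost (hybrid c s1) * growth ^ k"
      show "\<forall>c. consistent c s \<longrightarrow> cost (hybrid c s) \<le> cost c * growth ^ k"
      proof (intro allI impI)
        fix c assume c: "consistent c s"
        then have "c \<in> labelings" by (simp add: consistent_def)
        then have "cost (hybrid c s1) = cost c" using s1 by (intro cost_cong) blast
        then show "cost (hybrid c s) \<le> cost c * growth ^ k" using b c by metis
      qed
    qed auto
  qed (use pfail_nonneg in auto)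
  then show ?thesis by simp
qed

end

section \<open>Parameters\<close>

context sampling_algorithm
begin

text \<open>With nothing undecided the cells of a vertex coincide, so cell \<open>u\<close> shows
  its slot under every naming. Any consistent naming \<open>c\<close> can serve for the comparison,
  since its cost is twice the number of disagreements of \<open>P\<close>.\<close>

lemma output_ok:
  fixes \<epsilon> :: real
  assumes w: "state_inv s" and l: "len s = 0"
    and gd: "\<forall>c. consistent c s \<longrightarrow> cost (hybrid c s) \<le> cost c * (1 + \<epsilon>)"
    and opt: "disagreements n pos P = min_disagreements k n pos"
  shows "approx_solution \<epsilon> k n pos (output_clustering n ([], s))"
proof -
  let ?O = "output_clustering n ([], s)"
  have O: "?O = (\<lambda>v. {u \<in> {..<n}. mem s u = mem s v}) ` {..<n}" by (simp add: output_clustering_def)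
  have todo: "todo s = []" using l by (simp add: todo_def)
  have "reps_ok s" using w by (simp add: state_inv_def)
  then obtain c where c: "consistent c s" using consistent_exists by blast
  then have cl: "c \<in> labelings" by (simp add: consistent_def)
  have h: "hybrid c s u = mem s u" if "u < n" for u
  proof -
    have "\<forall>v<n. v \<notin> set (todo s) \<longrightarrow> (\<exists>j. j \<notin> opened s \<and> (\<forall>i<k. cell s v i = j))"
      using w by (simp add: state_inv_def)
    then have "\<exists>j. j \<notin> opened s \<and> (\<forall>i<k. cell s u i = j)" using todo that by simp
    then obtain j where j: "\<forall>i<k. cell s u i = j" by blast
    have "cell s u (c u) = j" "cell s u 0 = j"
      using j[rule_format, OF labelings_lt[OF cl that]] j[rule_format, of 0] k1 by simp_all
    then have "cell s u (c u) = cell s u 0" by simp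
    then show ?thesis using that by (simp add: hybrid_def)
  qed
  have lt: "mem s u < k" if "u < n" for u
  proof -
    have "\<forall>v<n. \<forall>i<k. cell s v i < k" using w by (simp add: state_inv_def)
    from this[rule_format, OF that, of 0] show ?thesis using k1 by simp
  qed
  have "partition_on {..<n} ?O"
    unfolding O by (auto simp: partition_on_def disjoint_def)
  moreover have "card ?O \<le> k"
  proof -
    have "?O = (\<lambda>x. {u \<in> {..<n}. mem s u = x}) ` (mem s ` {..<n})" unfolding O by (simp add: image_image)
    then have "card ?O \<le> card (mem s ` {..<n})" by (simp add: card_image_le)
    also have "\<dots> \<le> card {..<k}" by (rule card_mono) (use lt in auto)
    finally show ?thesis by simp
  qed
  ultimately have "?O \<in> clusterings k n" by (simp add: clusterings_def)
  moreover have "real (disagreements n pos ?O) \<le> (1 + \<epsilon>) * real (min_disagreements k n pos)"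
  proof -
    have "cost (hybrid c s) = 2 * int (disagreements n pos ?O)"
      by (rule cost_disagreements[OF pos_edges]) (auto simp: O h)
    moreover have "cost c = 2 * int (disagreements n pos P)"
      by (rule cost_disagreements[OF pos_edges]) (use labelings_same[OF cl] in \<open>auto simp: same_def\<close>)
    moreover have "real_of_int (cost (hybrid c s)) \<le> real_of_int (cost c) * (1 + \<epsilon>)" using gd c by blast
    ultimately show ?thesis unfolding opt[symmetric] by (simp add: algebra_simps)
  qed
  ultimately show ?thesis by (simp add: approx_solution_def)
qed

end

section \<open>Numerical estimates for the parameters\<close>

lemma bits_le: "bits n \<le> n"
  unfolding bits_def by (rule Least_le) (rule less_exp)

text \<open>\<open>bits n - 1\<close> is at most the binary logarithm of \<open>n\<close>. For
  \<open>n \<ge> 2\<close> the missing 1 costs at most a factor 2, and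
  \<open>ln 2 \<ge> 2 / 3\<close> turns this into 3.\<close>

lemma bits_le_ln:
  assumes "2 \<le> n"
  shows "real (bits n) \<le> 3 * ln (real n)" "1 \<le> bits n" "real n \<le> exp (real (bits n))"
proof -
  show b1: "1 \<le> bits n" using bits(1)[of n] assms by (cases "bits n") auto
  have l2: "2 / 3 \<le> ln (2 :: real)" using ln2_ge_two_thirds .
  have "2 ^ (bits n - 1) \<le> n" using bits(2)[of "bits n - 1" n] b1 by simp
  then have "real (2 ^ (bits n - 1)) \<le> real n" by (rule of_nat_mono)
  then have "ln (2 ^ (bits n - 1)) \<le> ln (real n)" using assms by (subst ln_le_cancel_iff) auto
  then have "(real (bits n) - 1) * ln 2 \<le> ln (real n)" using b1 by (simp add: ln_realpow of_nat_diff)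
  moreover have "ln 2 \<le> ln (real n)" using assms by simp
  ultimately have "real (bits n) * ln 2 \<le> 2 * ln (real n)" by (simp add: algebra_simps)
  moreover have "real (bits n) * (2 / 3) \<le> real (bits n) * ln 2" using l2 by (intro mult_left_mono) auto
  ultimately show "real (bits n) \<le> 3 * ln (real n)" by simp
  have "real n \<le> 2 ^ bits n" using bits(1)[of n] by (metis less_imp_le of_nat_le_iff of_nat_numeral of_nat_power)
  also have "\<dots> = exp (ln 2 * real (bits n))" by (simp add: exp_of_nat2_mult)
  also have "\<dots> \<le> exp (1 * real (bits n))"
    using ln_2_less_1 by (intro exp_le_cancel_iff[THEN iffD2] mult_right_mono) auto
  finally show "real n \<le> exp (real (bits n))" by simp
qed

text \<open>Four times the inverse of \<open>accuracy\<close>, as the drift within a batch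
  demands.\<close>

definition batches :: "nat \<Rightarrow> nat \<Rightarrow> nat" where
  "batches k q = 2048 * k ^ 3 * q"

text \<open>The factor \<open>2 ^ 23 * k ^ 6 * q\<^sup>2\<close> cancels against the square of
  \<open>accuracy\<close> and the 32 of the tail exponent. What remains,
  \<open>30 * k\<^sup>2 * q\<close> per bit of \<open>n\<close>, has to beat the union
  bound.\<close>

definition rate :: "nat \<Rightarrow> nat \<Rightarrow> nat" where
  "rate k q = 30 * 2 ^ 23 * k ^ 8 * q ^ 3"

text \<open>Chosen so that \<open>256 * k\<^sup>2 * \<gamma>\<close> is
  \<open>1 / (2 * k * q)\<close>: the exponents of the \<open>k\<close> rounds then add up to
  \<open>1 / (2 * q)\<close>. \<open>q\<close> is an integer because the program constants are
  derived from it.\<close>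

definition accuracy :: "nat \<Rightarrow> nat \<Rightarrow> real" where
  "accuracy k q = 1 / (512 * real k ^ 3 * real q)"

lemma le_exp: "x \<le> exp (x :: real)"
  using exp_ge_add_one_self[of x] by linarith

text \<open>Each factor is compared with an exponential. Besides \<open>k ^ k\<close> there are five
  factors \<open>k\<close>: one for the rounds, one for the slots and three for the batches. The
  constants multiply to at most \<open>2 ^ 14\<close>. Of two factors \<open>exp b\<close> set aside
  in the exponent, one absorbs the vertices of the union bound, and the other yields
  \<open>1 / n\<close>.\<close>

lemma failure_bound:
  assumes k: "1 \<le> k" and q: "1 \<le> q" and n: "2 \<le> n"
  shows "real k * (real (batches k q + 1) * (real (k ^ k * k * (n + 1)) *
     (2 * exp (- real (rate k q * bits n) * (accuracy k q / 4)\<^sup>2 / 2)))) \<le> 1 / real n"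
proof -
  define b where "b = real (bits n)"
  have b: "1 \<le> b" "real n \<le> exp b" using bits_le_ln[OF n] by (auto simp: b_def)
  define K Q where "K = real k" and "Q = real q"
  have K: "1 \<le> K" and Q: "1 \<le> Q" using k q by (auto simp: K_def Q_def)
  have ex: "real (rate k q * bits n) * (accuracy k q / 4)\<^sup>2 / 2 = 30 * K\<^sup>2 * Q * b"
  proof -
    define Z where "Z = K ^ 6 * Q ^ 2"
    have Z: "Z \<noteq> 0" using K Q by (simp add: Z_def)
    have a: "(accuracy k q / 4)\<^sup>2 / 2 = 1 / (2 ^ 23 * Z)"
      by (simp add: accuracy_def K_def[symmetric] Q_def[symmetric] Z_def power_divide power_mult_distrib flip: power_mult)
    have "K ^ 8 * Q ^ 3 = Z * (K\<^sup>2 * Q)" by (simp add: Z_def eval_nat_numeral)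
    then have r: "real (rate k q * bits n) = 30 * 2 ^ 23 * (Z * (K\<^sup>2 * Q)) * b"
      by (simp add: rate_def b_def K_def Q_def)
    have "real (rate k q * bits n) * (accuracy k q / 4)\<^sup>2 / 2 = 30 * 2 ^ 23 * (Z * (K\<^sup>2 * Q)) * b * (1 / (2 ^ 23 * Z))"
      unfolding r[symmetric] a[symmetric] by simp
    also have "\<dots> = 30 * K\<^sup>2 * Q * b" using Z by simp
    finally show ?thesis .
  qed
  have KK: "K \<le> K\<^sup>2" "1 \<le> K\<^sup>2" using K by (auto simp: self_le_power)
  have KQ: "K\<^sup>2 \<le> K\<^sup>2 * Q" "Q \<le> K\<^sup>2 * Q"
    using KK Q by (auto intro: mult_left_mono[of 1 Q "K\<^sup>2", simplified] mult_right_mono[of 1 "K\<^sup>2" Q, simplified])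
  have "2 * b + (14 + (K + 5) * K + Q) \<le> 30 * K\<^sup>2 * Q * b"
  proof -
    have "14 + (K + 5) * K + Q \<le> 28 * (K\<^sup>2 * Q)"
      using KK KQ by (simp add: algebra_simps power2_eq_square)
    also have "\<dots> \<le> 28 * (K\<^sup>2 * Q) * b" using mult_left_mono[OF b(1), of "28 * (K\<^sup>2 * Q)"] KQ KK by simp
    finally have "14 + (K + 5) * K + Q \<le> 28 * (K\<^sup>2 * Q) * b" .
    moreover have "2 * b \<le> 2 * (K\<^sup>2 * Q) * b" using KQ KK b by (intro mult_right_mono) linarith+
    ultimately show ?thesis by (simp add: algebra_simps)
  qed
  then have "exp (- (30 * K\<^sup>2 * Q * b)) \<le> exp (- (2 * b + (14 + (K + 5) * K + Q)))" by simp
  then have e1: "exp (- (30 * K\<^sup>2 * Q * b)) \<le> 1 / (exp b * exp b * (exp 14 * exp ((K + 5) * K) * exp Q))"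
  proof -
    have P: "exp b * exp b * (exp 14 * exp ((K + 5) * K) * exp Q) = exp (2 * b + (14 + (K + 5) * K + Q))"
      by (simp only: exp_add mult_2)
    show ?thesis unfolding P using \<open>exp (- (30 * K\<^sup>2 * Q * b)) \<le> _\<close> by (simp only: exp_minus inverse_eq_divide)
  qed
  have kk: "real (k ^ k) * K ^ 5 \<le> exp ((K + 5) * K)"
  proof -
    have "real (k ^ k) * K ^ 5 = K ^ (k + 5)" by (simp only: K_def power_add of_nat_power)
    also have "\<dots> \<le> exp K ^ (k + 5)" using K le_exp by (intro power_mono) auto
    also have "\<dots> = exp (real (k + 5) * K)" by (rule exp_of_nat_mult[symmetric])
    finally show ?thesis by (simp add: K_def)
  qed
  have e14: "2 ^ 14 \<le> exp (14 :: real)"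
  proof -
    have "2 \<le> exp (1 :: real)" using exp_ge_add_one_self[of "1 :: real"] by simp
    then have "(2 :: real) ^ 14 \<le> exp 1 ^ 14" by (rule power_mono) simp
    also have "exp 1 ^ 14 = exp (14 :: real)" using exp_of_nat_mult[of 14 "1 :: real"] by simp
    finally show ?thesis .
  qed
  have mb: "real (batches k q + 1) \<le> 4096 * K ^ 3 * Q"
  proof -
    have "1 \<le> K ^ 3" using K by simp
    then have "1 * 1 \<le> K ^ 3 * Q" using Q K by (intro mult_mono) auto
    moreover have "real (batches k q + 1) = 2048 * (K ^ 3 * Q) + 1" by (simp add: batches_def K_def Q_def)
    ultimately show ?thesis unfolding mult.assoc by linarith
  qed
  have n1: "real (n + 1) \<le> 2 * real n" using n by simp
  have "real k * (real (batches k q + 1) * (real (k ^ k * k * (n + 1)) * 2))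
     \<le> K * ((4096 * K ^ 3 * Q) * ((real (k ^ k) * K * (2 * real n)) * 2))"
    unfolding of_nat_mult K_def[symmetric] using mb n1 K Q by (intro mult_mono) auto
  also have "\<dots> = 2 ^ 14 * (real (k ^ k) * K ^ 5) * Q * real n"
    by (simp add: eval_nat_numeral)
  also have "\<dots> \<le> exp 14 * exp ((K + 5) * K) * exp Q * exp b"
    using e14 kk le_exp[of Q] b(2) K Q by (intro mult_mono) auto
  finally have "real k * (real (batches k q + 1) * (real (k ^ k * k * (n + 1)) * 2)) * exp (- (30 * K\<^sup>2 * Q * b))
     \<le> (exp 14 * exp ((K + 5) * K) * exp Q * exp b) * (1 / (exp b * exp b * (exp 14 * exp ((K + 5) * K) * exp Q)))"
    using e1 by (rule mult_mono) auto
  also have "\<dots> = 1 / exp b" by simp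
  also have "\<dots> \<le> 1 / real n" using b(2) n by (intro divide_left_mono) auto
  finally have F: "real k * (real (batches k q + 1) * (real (k ^ k * k * (n + 1)) * 2)) * exp (- (30 * K\<^sup>2 * Q * b)) \<le> 1 / real n" .
  have "- real (rate k q * bits n) * (accuracy k q / 4)\<^sup>2 / 2 = - (30 * K\<^sup>2 * Q * b)"
    by (subst ex[symmetric]) simp
  then show ?thesis using F by (simp only: mult.assoc)
qed

text \<open>The exponential turns the power into an exact multiple of the exponent, and
  \<open>exp x \<le> 1 + x + x\<^sup>2\<close> with \<open>x = 1 / (2 * q)\<close> leads
  back.\<close>

lemma growth_bound:
  assumes k: "1 \<le> k" and q: "1 \<le> q"
  shows "(1 + 256 * (real k)\<^sup>2 * accuracy k q) ^ k \<le> 1 + 1 / real q"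
proof -
  have "256 * (real k)\<^sup>2 * accuracy k q = 1 / (2 * real k * real q)"
    using k q by (simp add: accuracy_def field_simps power2_eq_square power3_eq_cube)
  then have "(1 + 256 * (real k)\<^sup>2 * accuracy k q) ^ k \<le> exp (1 / (2 * real k * real q)) ^ k"
    using exp_ge_add_one_self[of "1 / (2 * real k * real q)"] by (intro power_mono) auto
  also have "\<dots> = exp (1 / (2 * real q))" using k by (simp flip: exp_of_nat_mult)
  also have "\<dots> \<le> 1 + 1 / (2 * real q) + (1 / (2 * real q))\<^sup>2"
    using q by (intro exp_bound) (auto simp: field_simps)
  also have "(1 / (2 * real q))\<^sup>2 \<le> 1 / (2 * real q)"
  proof -
    have "1 / (2 * real q) \<le> 1" using q by (simp add: field_simps)
    then show ?thesis unfolding power2_eq_square by (rule mult_left_le) simp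
  qed
  finally show ?thesis by (simp add: field_simps)
qed

text \<open>The monomial \<open>U\<close> dominates all summands up to the factor
  \<open>2 ^ 32\<close>. Since \<open>z = n * k * q\<close> is at least 4, \<open>z ^ 19\<close>
  absorbs this factor, being at least \<open>2 ^ 38\<close>, and \<open>U \<le> z ^ 8\<close>; this
  gives 27. The hypothesis on \<open>q\<close> puts \<open>z\<close> below the argument of the
  logarithm in \<open>word_size\<close>.\<close>

lemma word_bound:
  fixes \<epsilon> :: real
  assumes k: "2 \<le> k" and n: "2 \<le> n" and q: "1 \<le> q" "real q \<le> 1 + 1 / \<epsilon>" and \<epsilon>: "0 < \<epsilon>"
  shows "4 * (n * k + n + 2 * (rate k q * bits n) + 3 * k + batches k q + 2) \<le> 2 ^ word_size 27 n k \<epsilon>"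
proof -
  define Y where "Y = real n * real k * (1 + 1 / \<epsilon>)"
  define z where "z = n * k * q"
  have zY: "real z \<le> Y" unfolding z_def Y_def of_nat_mult using q by (intro mult_left_mono) auto
  have z4: "4 \<le> z"
  proof -
    have "2 * 2 * 1 \<le> n * k * q" using k n q by (intro mult_le_mono) auto
    then show ?thesis by (simp add: z_def)
  qed
  define U where "U = n * k ^ 8 * q ^ 3"
  have U: "n * k \<le> U" "n \<le> U" "k \<le> U" "1 \<le> U" "k ^ 3 * q \<le> U" "k ^ 8 * q ^ 3 * bits n \<le> U"
  proof -
    have p: "1 \<le> k ^ 8" "1 \<le> q ^ 3" "k ^ 1 \<le> k ^ 8" "k ^ 3 \<le> k ^ 8" "q ^ 1 \<le> q ^ 3"
      using power_increasing[of 1 8 k] power_increasing[of 3 8 k] power_increasing[of 1 3 q] k q by simp_all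
    have "n * k * 1 \<le> U" "n * 1 * 1 \<le> U" "1 * k * 1 \<le> U" "1 * 1 * 1 \<le> U" "1 * k ^ 3 * q \<le> U"
      unfolding U_def using p n by (intro mult_le_mono; simp)+
    moreover have "bits n * k ^ 8 * q ^ 3 \<le> U" unfolding U_def using bits_le by (intro mult_le_mono) auto
    ultimately show "n * k \<le> U" "n \<le> U" "k \<le> U" "1 \<le> U" "k ^ 3 * q \<le> U" "k ^ 8 * q ^ 3 * bits n \<le> U" by (simp_all add: mult_ac)
  qed
  have "4 * (n * k + n + 2 * (rate k q * bits n) + 3 * k + batches k q + 2) \<le> 2 ^ 32 * U"
  proof -
    have e: "rate k q * bits n = 251658240 * (k ^ 8 * q ^ 3 * bits n)" "batches k q = 2048 * (k ^ 3 * q)"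
      by (simp_all add: rate_def batches_def)
    have "rate k q * bits n \<le> 251658240 * U" unfolding e(1) by (rule mult_le_mono2[OF U(6)])
    moreover have "batches k q \<le> 2048 * U" unfolding e(2) by (rule mult_le_mono2[OF U(5)])
    ultimately have "4 * (n * k + n + 2 * (rate k q * bits n) + 3 * k + batches k q + 2)
      \<le> 4 * (U + U + 2 * (251658240 * U) + 3 * U + 2048 * U + 2 * U)"
      using U(1-4) by (intro mult_le_mono2 add_mono) simp_all
    also have "\<dots> \<le> 2 ^ 32 * U" by simp
    finally show ?thesis .
  qed
  also have "\<dots> \<le> 2 ^ 38 * z ^ 8"
  proof -
    have "n ^ 1 \<le> n ^ 8" "q ^ 3 \<le> q ^ 8" using power_increasing[of 1 8 n] power_increasing[of 3 8 q] n q by simp_all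
    then have "U \<le> z ^ 8" unfolding U_def z_def power_mult_distrib by (intro mult_le_mono) auto
    then show ?thesis by (intro mult_le_mono) auto
  qed
  also have "\<dots> \<le> z ^ 19 * z ^ 8"
  proof -
    have "(4 :: nat) ^ 19 \<le> z ^ 19" using z4 by (rule power_mono) simp
    then show ?thesis by (intro mult_le_mono1) simp
  qed
  finally have fin: "4 * (n * k + n + 2 * (rate k q * bits n) + 3 * k + batches k q + 2) \<le> z ^ 27"
    by (simp flip: power_add)
  have "Y > 1" using zY z4 by linarith
  then have "Y = 2 powr (log 2 Y)" by simp
  also have "\<dots> \<le> 2 powr real (nat \<lceil>log 2 Y\<rceil>)" by (intro powr_mono) linarith+
  also have "\<dots> = 2 ^ nat \<lceil>log 2 Y\<rceil>" by (simp add: powr_realpow)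
  finally have "real z \<le> 2 ^ nat \<lceil>log 2 Y\<rceil>" using zY by linarith
  then have "real z ^ 27 \<le> (2 ^ nat \<lceil>log 2 Y\<rceil>) ^ 27" by (intro power_mono) auto
  also have "\<dots> = real (2 ^ word_size 27 n k \<epsilon>)" unfolding word_size_def Y_def[symmetric]
    by (simp add: mult.commute flip: power_mult)
  finally have "z ^ 27 \<le> 2 ^ word_size 27 n k \<epsilon>" by (metis of_nat_le_iff of_nat_power)
  with fin show ?thesis by (rule le_trans)
qed

text \<open>Apart from the outer factor \<open>k\<close>, every summand is a constant times a
  product of some of \<open>n\<close>, \<open>m\<close>, \<open>S\<close> and \<open>k\<close>,
  hence at most that constant times \<open>X\<close>.\<close>

lemma time_bound:
  fixes n k S m b :: nat
  assumes "1 \<le> n" "1 \<le> k" "1 \<le> S" "1 \<le> m" "b \<le> S"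
  shows "(b * 3 + n * 5 + n * k * 5 + k * 6 + 26) + (k * Suc (S * (k * 21 + 30) + k * 16 + 34 + m * (S * (k * 12 + 21) + 15) +
    (n + m) * (S * 17 + k * 28 + 23) + n * 13) + 1) \<le> 400 * (n * m * S * k ^ 2)"
proof -
  define X where "X = n * m * S * k"
  have x: "a * b * c * d \<le> X" if "a \<le> n" "b \<le> m" "c \<le> S" "d \<le> k" for a b c d
    unfolding X_def using that by (intro mult_le_mono)
  have m1: "S * k \<le> X" "S \<le> X" "k \<le> X" "1 \<le> X" "m * S * k \<le> X" "m * S \<le> X" "m \<le> X" "n * S \<le> X" "n * k \<le> X" "n \<le> X" "m * k \<le> X"
    using x[of 1 1 S k] x[of 1 1 S 1] x[of 1 1 1 k] x[of 1 1 1 1] x[of 1 m S k] x[of 1 m S 1] x[of 1 m 1 1] x[of n 1 S 1]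
      x[of n 1 1 k] x[of n 1 1 1] x[of 1 m 1 k] assms by simp_all
  define R where "R = S * (k * 21 + 30) + k * 16 + 34 + m * (S * (k * 12 + 21) + 15) + (n + m) * (S * 17 + k * 28 + 23) + n * 13"
  have "R = 21 * (S * k) + 30 * S + 16 * k + 34 + 12 * (m * S * k) + 21 * (m * S) + 15 * m + 17 * (n * S) + 28 * (n * k) + 23 * n
     + 17 * (m * S) + 28 * (m * k) + 23 * m + 13 * n" unfolding R_def by (simp add: algebra_simps)
  then have "R \<le> 350 * X" using m1 by linarith
  then have "k * Suc R \<le> k * (351 * X)" using m1(4) by (intro mult_le_mono2) linarith
  moreover have "X \<le> k * X" using assms by simp
  moreover have "b * 3 + n * 5 + n * k * 5 + k * 6 + 26 + 1 \<le> 46 * X" using m1 assms(5) by linarith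
  ultimately have "(b * 3 + n * 5 + n * k * 5 + k * 6 + 26) + (k * Suc R + 1) \<le> 400 * (k * X)" by linarith
  also have "k * X = n * m * S * k ^ 2" by (simp add: X_def power2_eq_square)
  finally show ?thesis unfolding R_def .
qed

text \<open>As \<epsilon> grows, the bounds tend to 0, so the constant is taken for \<epsilon> up to
  \<open>\<epsilon>\<^sub>0\<close>. It is fixed together with the word size multiple before
  \<epsilon> and \<open>k\<close>, and the program before \<open>n\<close>.\<close>

theorem theorem2:
  fixes \<epsilon>\<^sub>0 :: real
  assumes "\<epsilon>\<^sub>0 > 0"
  shows "\<exists>(C :: real) (b :: nat). \<forall>(\<epsilon> :: real) (k :: nat). 0 < \<epsilon> \<longrightarrow> \<epsilon> \<le> \<epsilon>\<^sub>0 \<longrightarrow> k \<ge> 2 \<longrightarrow>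
    (\<exists>prog. \<forall>n\<ge>2. solves_MinDisAgree prog (word_size b n k \<epsilon>) \<epsilon> k n
       (C * (real k ^ 14 * ln (real k) * ln (real n) / \<epsilon> ^ 6))
       (C * (real n * real k ^ 14 * ln (real k) * ln (real n) / \<epsilon> ^ 6)))"
proof -
  \<comment> \<open>The factors come from \<open>time_bound\<close>, \<open>batches\<close>,
    \<open>rate\<close>, \<open>bits_le_ln\<close>, the passage from \<open>q ^ 4\<close> to
    \<open>1 / \<epsilon> ^ 6\<close>, and \<open>1 \<le> 2 * ln (real k)\<close>, in this
    order.\<close>
  define B :: real where "B = 400 * 2048 * (30 * 2 ^ 23) * 3 * (1 + \<epsilon>\<^sub>0) ^ 4 * \<epsilon>\<^sub>0\<^sup>2 * 2"
  have main: "solves_MinDisAgree (main_prog k (batches k q) (rate k q)) (word_size 27 n k \<epsilon>) \<epsilon> k n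
       (B * (real k ^ 14 * ln (real k) * ln (real n) / \<epsilon> ^ 6))
       (B * (real n * real k ^ 14 * ln (real k) * ln (real n) / \<epsilon> ^ 6))"
    if e: "0 < \<epsilon>" "\<epsilon> \<le> \<epsilon>\<^sub>0" and k: "2 \<le> k" and n: "2 \<le> n" and q: "q = nat \<lceil>1 / \<epsilon>\<rceil>" for \<epsilon> k n q
    unfolding solves_MinDisAgree_def
  proof (intro allI impI)
    fix pos P assume pos: "pos \<subseteq> edges n" and opt: "optimal_clustering k n pos P"
    define w where "w = word_size 27 n k \<epsilon>"
    define S where "S = rate k q * bits n"
    define m where "m = batches k q"
    define \<gamma> where "\<gamma> = accuracy k q"
    have q1: "1 \<le> q" using e unfolding q by (simp add: Suc_le_eq)
    have qe: "1 / \<epsilon> \<le> real q" "real q \<le> 1 + 1 / \<epsilon>" 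
    proof -
      have "0 \<le> 1 / \<epsilon>" using e by simp
      then have "real q = of_int \<lceil>1 / \<epsilon>\<rceil>" unfolding q by simp
      then show "1 / \<epsilon> \<le> real q" "real q \<le> 1 + 1 / \<epsilon>" by linarith+
    qed
    have part: "partition_on {..<n} P" "card P \<le> k" and opt': "disagreements n pos P = min_disagreements k n pos"
      using opt by (auto simp: optimal_clustering_def clusterings_def)
    have S1: "1 \<le> S" "bits n \<le> S" and m1: "1 \<le> m"
    proof -
      have r: "1 \<le> rate k q" using k q1 by (simp add: rate_def Suc_le_eq)
      show "1 \<le> S" using r bits_le_ln(2)[OF n] unfolding S_def by (metis mult_le_mono mult_1)
      show "bits n \<le> S" using r unfolding S_def by simp
      show "1 \<le> m" using k q1 by (simp add: m_def batches_def Suc_le_eq)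
    qed
    interpret sampling_algorithm w pos P n k S m \<gamma>
    proof
      show "partition_on {..<n} P" "card P \<le> k" "1 \<le> k" "0 < n" "0 < S" "0 < m" "pos \<subseteq> edges n"
        using part pos k n S1 m1 by auto
      show "4 * (n * k + n + 2 * S + 3 * k + m + 2) \<le> 2 ^ w"
        unfolding S_def m_def w_def by (rule word_bound[OF k n q1 qe(2) e(1)])
      show "0 < \<gamma>" using k q1 by (simp add: \<gamma>_def accuracy_def)
      show "4 \<le> \<gamma> * real m" using k q1 by (simp add: \<gamma>_def accuracy_def m_def batches_def)
      show "\<gamma> \<le> 1 / (32 * real k)"
      proof -
        have "real k * 1 * 1 \<le> real k * (real k * real k) * real q"
          using k q1 by (intro mult_mono) (auto intro: mult_ge1_I)
        then show ?thesis using k q1 by (simp add: \<gamma>_def accuracy_def frac_le power3_eq_cube)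
      qed
    qed
    define t where "t = (bits n * 3 + n * 5 + NK * 5 + k * 6 + 26) + (k * Suc round_time + 1)"
    have "prob_triple (main_prog k m (rate k q)) start t
      (\<lambda>s. state_inv s \<and> len s = 0 \<and> queries s \<le> k * ((m + 1) * (S * k))) True
      (\<lambda>s. \<forall>c. consistent c s \<longrightarrow> cost (hybrid c s) \<le> cost c * growth ^ k) (real k * (real (m + 1) * pfail))"
      unfolding t_def by (rule main_ok[OF S_def]) (use k q1 in \<open>simp add: rate_def\<close>)
    then obtain D where D: "terminates (main_prog k m (rate k q), start) t D"
      "\<forall>s\<in>set_pmf D. state_inv s \<and> len s = 0 \<and> queries s \<le> k * ((m + 1) * (S * k))"
      "measure_pmf.prob D {s. \<not> (\<forall>c. consistent c s \<longrightarrow> cost (hybrid c s) \<le> cost c * growth ^ k)} \<le> real k * (real (m + 1) * pfail)"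
      unfolding prob_triple_def by blast
    have init: "init (main_prog k m (rate k q)) n = (main_prog k m (rate k q), start)"
      by (simp add: init_def start_def)
    have run: "run w pos P t (init (main_prog k m (rate k q)) n) = map_pmf (Pair []) D"
      using D(1) unfolding init terminates_def by blast
    have bound: "real (400 * (m * S * k ^ 2)) \<le> B * (real k ^ 14 * ln (real k) * ln (real n) / \<epsilon> ^ 6)"
    proof -
      have "real (400 * (m * S * k ^ 2)) = 400 * 2048 * (30 * 2 ^ 23) * (real k ^ 13 * real q ^ 4 * real (bits n))"
      proof -
        have k13: "k ^ 13 = k ^ 3 * (k ^ 8 * k ^ 2)" by (simp flip: power_add)
        have q4: "q ^ 4 = q * q ^ 3" by (simp flip: power_Suc)
        have "400 * (m * S * k ^ 2) = 400 * 2048 * (30 * 2 ^ 23) * (k ^ 13 * q ^ 4 * bits n)"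
          unfolding m_def S_def batches_def rate_def k13 q4 by (simp only: mult_ac)
        then show ?thesis by (simp only: of_nat_mult of_nat_power of_nat_numeral)
      qed
      also have "\<dots> \<le> 400 * 2048 * (30 * 2 ^ 23) * ((real k ^ 14 * (2 * ln (real k))) * ((1 + \<epsilon>\<^sub>0) ^ 4 * \<epsilon>\<^sub>0\<^sup>2 / \<epsilon> ^ 6) * (3 * ln (real n)))"
      proof (intro mult_left_mono mult_mono)
        have "1 \<le> 2 * ln (real k)"
        proof -
          have "ln 2 \<le> ln (real k)" using k by simp
          then show ?thesis using ln2_ge_two_thirds by linarith
        qed
        moreover have "real k ^ 13 \<le> real k ^ 14" using k by (intro power_increasing) auto
        ultimately have "real k ^ 13 * 1 \<le> real k ^ 14 * (2 * ln (real k))" by (intro mult_mono) auto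
        then show "real k ^ 13 \<le> real k ^ 14 * (2 * ln (real k))" by simp
        have "real q \<le> (1 + \<epsilon>\<^sub>0) / \<epsilon>" using qe(2) e by (simp add: field_simps)
        then have "real q ^ 4 \<le> ((1 + \<epsilon>\<^sub>0) / \<epsilon>) ^ 4" by (intro power_mono) auto
        \<comment> \<open>Only four powers of 1/\<epsilon> arise from \<open>q ^ 4\<close>; the
          other two are bought with the factor \<open>\<epsilon>\<^sub>0\<^sup>2\<close>.\<close>
        also have "\<dots> = (1 + \<epsilon>\<^sub>0) ^ 4 * \<epsilon>\<^sup>2 / \<epsilon> ^ 6" using e by (simp add: power_divide field_simps flip: power_add)
        also have "\<dots> \<le> (1 + \<epsilon>\<^sub>0) ^ 4 * \<epsilon>\<^sub>0\<^sup>2 / \<epsilon> ^ 6"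
          using e by (intro divide_right_mono mult_left_mono power_mono) auto
        finally show "real q ^ 4 \<le> (1 + \<epsilon>\<^sub>0) ^ 4 * \<epsilon>\<^sub>0\<^sup>2 / \<epsilon> ^ 6" .
        show "real (bits n) \<le> 3 * ln (real n)" by (rule bits_le_ln(1)[OF n])
      qed (use k e in auto)
      also have "\<dots> = B * (real k ^ 14 * ln (real k) * ln (real n) / \<epsilon> ^ 6)" unfolding B_def by simp
      finally show ?thesis .
    qed
    have qb: "real (k * ((m + 1) * (S * k))) \<le> B * (real k ^ 14 * ln (real k) * ln (real n) / \<epsilon> ^ 6)"
    proof -
      have "k * ((m + 1) * (S * k)) \<le> k * ((400 * m) * (S * k))" using m1 by (intro mult_le_mono) auto
      also have "\<dots> = 400 * (m * S * k ^ 2)" by (simp add: power2_eq_square)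
      finally show ?thesis using bound of_nat_mono[where 'a = real] by (meson order_trans)
    qed
    have tbd: "real t \<le> B * (real n * real k ^ 14 * ln (real k) * ln (real n) / \<epsilon> ^ 6)"
    proof -
      have "t \<le> 400 * (n * m * S * k ^ 2)"
        unfolding t_def round_time_def NK_def by (rule time_bound) (use n k S1 m1 in auto)
      then have "real t \<le> real (400 * (n * m * S * k ^ 2))" by (rule of_nat_mono)
      also have "\<dots> = real n * real (400 * (m * S * k ^ 2))" by simp
      also have "\<dots> \<le> real n * (B * (real k ^ 14 * ln (real k) * ln (real n) / \<epsilon> ^ 6))"
        using bound by (rule mult_left_mono) simp
      finally show ?thesis by (simp add: mult_ac)
    qed
    have fail: "real k * (real (m + 1) * pfail) \<le> 1 / real n"
      unfolding pfail_def unfolding \<gamma>_def m_def S_def by (rule failure_bound) (use k q1 n in auto)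
    have round_good: "growth ^ k \<le> 1 + \<epsilon>"
    proof -
      have "growth ^ k \<le> 1 + 1 / real q" unfolding growth_def unfolding \<gamma>_def by (rule growth_bound) (use k q1 in auto)
      also have "1 / real q \<le> \<epsilon>" using qe(1) e q1 by (simp add: field_simps)
      finally show ?thesis by simp
    qed
    have good: "approx_solution \<epsilon> k n pos (output_clustering n ([], s))"
      if "s \<in> set_pmf D" "\<forall>c. consistent c s \<longrightarrow> cost (hybrid c s) \<le> cost c * growth ^ k" for s
    proof (rule output_ok)
      show "state_inv s" "len s = 0" using D(2) that(1) by auto
      show "\<forall>c. consistent c s \<longrightarrow> cost (hybrid c s) \<le> cost c * (1 + \<epsilon>)"
      proof (intro allI impI)
        fix c assume "consistent c s"
        then have "real_of_int (cost (hybrid c s)) \<le> cost c * growth ^ k" using that(2) by blast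
        also have "\<dots> \<le> cost c * (1 + \<epsilon>)"
          using round_good by (rule mult_left_mono) (simp add: cost_def sum_nonneg vcost_nonneg)
        finally show "cost (hybrid c s) \<le> cost c * (1 + \<epsilon>)" .
      qed
    qed (rule opt')
    have "1 - 1 / real n \<le> measure_pmf.prob D {s. approx_solution \<epsilon> k n pos (output_clustering n ([], s))}"
    proof -
      let ?A = "{s. approx_solution \<epsilon> k n pos (output_clustering n ([], s))}"
      have "measure_pmf.prob D (UNIV - ?A) = measure_pmf.prob D ((UNIV - ?A) \<inter> set_pmf D)"
        by (simp add: measure_Int_set_pmf)
      also have "\<dots> \<le> measure_pmf.prob D {s. \<not> (\<forall>c. consistent c s \<longrightarrow> cost (hybrid c s) \<le> cost c * growth ^ k)}"
        by (rule measure_pmf.finite_measure_mono) (use good in auto)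
      also have "\<dots> \<le> 1 / real n" using D(3) fail by linarith
      finally show ?thesis using measure_pmf.prob_compl[of ?A D] by simp
    qed
    then have "1 - 1 / real n \<le> measure_pmf.prob (run w pos P t (init (main_prog k m (rate k q)) n))
        {c. approx_solution \<epsilon> k n pos (output_clustering n c)}"
      unfolding run by (simp add: vimage_def)
    moreover have "halted c \<and> real (queries (snd c)) \<le> B * (real k ^ 14 * ln (real k) * ln (real n) / \<epsilon> ^ 6)"
      if c: "c \<in> set_pmf (run w pos P t (init (main_prog k m (rate k q)) n))" for c
    proof -
      obtain s where s: "c = ([], s)" "s \<in> set_pmf D" using c unfolding run by auto
      have "queries s \<le> k * ((m + 1) * (S * k))" using D(2) s(2) by blast
      then have "real (queries s) \<le> real (k * ((m + 1) * (S * k)))" by (rule of_nat_mono)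
      then show ?thesis using qb s by (simp add: halted_def)
    qed
    ultimately show "\<exists>t. real t \<le> B * (real n * real k ^ 14 * ln (real k) * ln (real n) / \<epsilon> ^ 6) \<and>
         (\<forall>c\<in>set_pmf (run (word_size 27 n k \<epsilon>) pos P t (init (main_prog k (batches k q) (rate k q)) n)).
            halted c \<and> real (queries (snd c)) \<le> B * (real k ^ 14 * ln (real k) * ln (real n) / \<epsilon> ^ 6)) \<and>
         1 - 1 / real n \<le> measure_pmf.prob (run (word_size 27 n k \<epsilon>) pos P t (init (main_prog k (batches k q) (rate k q)) n))
           {c. approx_solution \<epsilon> k n pos (output_clustering n c)}"
      using tbd unfolding w_def m_def by blast
  qed
  show ?thesis
    by (intro exI[of _ B] exI[of _ 27] allI impI) (rule exI, intro allI impI, rule main[OF _ _ _ _ refl])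
qed

end
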